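(* Let $k\in\mathbb{N}_0$ and suppose $h\in C^{k,k}(\overline\Theta\times\overline\Theta)$ is positive definite. Let $\{(\lambda_{j,k},e_{j,k})\}_j$ denote the eigensystem of the associated kernel operator $T_{h,k}$. Then $T_{h,k}$ is nuclear, $T_{h,k}\in N(H^k)$, and non-negative, with $$\|T_{h,k}\|_{N(H^k)}=\sum_j\lambda_{j,k}=\sum_{|\alpha|\le k}\int_\Theta\partial^{[\alpha,\alpha]}h(x,x)\,dx .$$ Therefore, for all $j\ge1$, $$\lambda_{j,k}\le j^{-1}\,\mathrm{vol}(\Theta)\sum_{|\alpha|\le k}\ \sup_{x\in\overline\Theta}\big|\partial^{[\alpha,\alpha]}h(x,x)\big| .$$
   Context: $d\in\mathbb{N}$ and $\Theta\subset\mathbb{R}^d$ is a bounded domain, meaning a bounded open subset; $\mathrm{vol}(\Theta)$ is its Lebesgue measure. All functions are real-valued; $\alpha,\beta\in\mathbb{N}_0^d$ are multi-indices. $f^{(\alpha)}$ is the weak derivative. $\partial^{[\alpha,\beta]}h$ is the classical mixed derivative of a kernel $h$ on $\Theta\times\Theta$, of order $\alpha$ in the first variable and $\beta$ in the second. $C^{k,k}(\overline\Theta\times\overline\Theta)$ is the class of uniformly continuous kernels $h\colon\Theta\times\Theta\to\mathbb{R}$ whose mixed partial derivatives $\partial^{[\alpha,\beta]}h$ exist and are uniformly continuous on $\Theta\times\Theta$ for $|\alpha|,|\beta|\le k$; these are identified with their continuous extensions to $\overline\Theta\times\overline\Theta$. A kernel $h$ is positive definite if it is symmetric and $\sum_{i,j\le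 n}c_i\,h(x_i,x_j)\,c_j\ge0$ for all $n\in\mathbb{N}$, $c_i\in\mathbb{R}$, $x_i\in\Theta$. $H^k(\Theta)$ is the $L^2$-based Sobolev space with inner product $\langle f,g\rangle_{H^k}=\sum_{|\alpha|\le k}\langle f^{(\alpha)},g^{(\alpha)}\rangle_{L^2}$. The kernel operator of order $k$ associated with $h$ is the self-adjoint Hilbert-Schmidt operator $T_{h,k}\colon H^k(\Theta)\to H^k(\Theta)$, $$[T_{h,k}f](y)=\int_\Theta\sum_{|\alpha|\le k}\partial^{[\alpha,0]}h(x,y)\,f^{(\alpha)}(x)\,dx .$$ Its eigensystem consists of the non-zero eigenvalues $\lambda_{j,k}$, counted with multiplicity and in order of decreasing absolute value, with corresponding $H^k$-orthonormal eigenfunctions $e_{j,k}$. The index $j$ runs over $\mathbb{N}$, or over $\{1,\dots,N\}$ if $N=\mathrm{rank}(T_{h,k})<\infty$; sums over $j$ are over this index set. $N(H^k)$ is the space of nuclear (trace-class) operators on $H^k(\Theta)$, with norm the sum of the singular values. An operator $T$ is non-negative if $\langle Tf,f\rangle_{H^k}\ge0$ for all $f$. *)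

theory Defs
  imports "HOL-Analysis.Analysis"
begin

text \<open>
  \<open>iter_pd [v\<^sub>1, \<dots>, v\<^sub>n] f\<close> is \<open>\<partial>\<^bsub>v\<^sub>1\<^esub> \<dots> \<partial>\<^bsub>v\<^sub>n\<^esub> f\<close>. It is meaningful at the points of an open
  set \<open>S\<close> when \<open>pd_exists S [v\<^sub>1, \<dots>, v\<^sub>n] f\<close> holds; on \<open>S\<close> it then depends only on \<open>f\<close> restricted
  to \<open>S\<close>.
\<close>

primrec iter_pd :: "'b::real_normed_vector list \<Rightarrow> ('b \<Rightarrow> real) \<Rightarrow> 'b \<Rightarrow> real" where
  "iter_pd [] f = f"
| "iter_pd (v # vs) f = (\<lambda>x. deriv (\<lambda>t. iter_pd vs f (x + t *\<^sub>R v)) 0)"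

primrec pd_exists :: "'b::real_normed_vector set \<Rightarrow> 'b list \<Rightarrow> ('b \<Rightarrow> real) \<Rightarrow> bool" where
  "pd_exists S [] f \<longleftrightarrow> True"
| "pd_exists S (v # vs) f \<longleftrightarrow> pd_exists S vs f \<and>
     (\<forall>x\<in>S. (\<lambda>t. iter_pd vs f (x + t *\<^sub>R v)) field_differentiable at 0)"

definition multi_indices :: "nat \<Rightarrow> ('d::finite \<Rightarrow> nat) set" where
  "multi_indices k = {\<alpha>. (\<Sum>i\<in>UNIV. \<alpha> i) \<le> k}"

lemma finite_multi_indices [simp]: "finite (multi_indices k :: ('d::finite \<Rightarrow> nat) set)"
proof (rule finite_subset)
  show "multi_indices k \<subseteq> (PiE UNIV (\<lambda>_. {..k}) :: ('d \<Rightarrow> nat) set)"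
  proof
    fix \<alpha> :: "'d \<Rightarrow> nat" assume a: "\<alpha> \<in> multi_indices k"
    have "\<alpha> i \<le> k" for i
      using member_le_sum[of i UNIV \<alpha>] a by (simp add: multi_indices_def)
    then show "\<alpha> \<in> PiE UNIV (\<lambda>_. {..k})" by auto
  qed
  show "finite (PiE UNIV (\<lambda>_. {..k}) :: ('d \<Rightarrow> nat) set)"
    by (intro finite_PiE) auto
qed

text \<open>
  An arbitrary but fixed ordering of the coordinates, in which multi-index derivatives are
  carried out. For the functions considered here all iterated derivatives are continuous, so
  the ordering is immaterial.
\<close>

definition coords :: "'d::finite list" where
  "coords = (SOME is. distinct is \<and> set is = UNIV)"

definition mi_list :: "('d::finite \<Rightarrow> nat) \<Rightarrow> 'd list" where
  "mi_list \<alpha> = concat (map (\<lambda>i. replicate (\<alpha> i) i) coords)"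

definition pderiv_mi :: "('d::finite \<Rightarrow> nat) \<Rightarrow> (real^'d \<Rightarrow> real) \<Rightarrow> real^'d \<Rightarrow> real" where
  "pderiv_mi \<alpha> f = iter_pd (map (\<lambda>i. axis i 1) (mi_list \<alpha>)) f"

text \<open>\<open>mixed_deriv \<alpha> \<beta> h (x, y)\<close> is \<open>\<partial>\<^bsup>[\<alpha>,\<beta>]\<^esup>h(x, y)\<close>.\<close>

definition mixed_deriv ::
  "('d::finite \<Rightarrow> nat) \<Rightarrow> ('d \<Rightarrow> nat) \<Rightarrow> ((real^'d) \<times> (real^'d) \<Rightarrow> real)
     \<Rightarrow> (real^'d) \<times> (real^'d) \<Rightarrow> real" where
  "mixed_deriv \<alpha> \<beta> h =
     iter_pd (map (\<lambda>i. (axis i 1, 0)) (mi_list \<alpha>) @ map (\<lambda>i. (0, axis i 1)) (mi_list \<beta>)) h"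

text \<open>
  \<open>C\<^bsup>k,k\<^esup>\<close>: all iterated partial derivatives, in any order, with at most \<open>k\<close> differentiations in
  the first variable and at most \<open>k\<close> in the second, exist and are uniformly continuous on
  \<open>\<Theta> \<times> \<Theta>\<close>. The empty list gives the uniform continuity of \<open>h\<close> itself.
\<close>

definition Ckk :: "nat \<Rightarrow> (real^'d::finite) set \<Rightarrow> ((real^'d) \<times> (real^'d) \<Rightarrow> real) set" where
  "Ckk k \<Theta> = {h. \<forall>vs. set vs \<subseteq> Basis
      \<and> length (filter (\<lambda>v. snd v = 0) vs) \<le> k \<and> length (filter (\<lambda>v. fst v = 0) vs) \<le> k
      \<longrightarrow> pd_exists (\<Theta> \<times> \<Theta>) vs h \<and> uniformly_continuous_on (\<Theta> \<times> \<Theta>) (iter_pd vs h)}"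

definition cont_ext :: "'b::metric_space set \<Rightarrow> ('b \<Rightarrow> real) \<Rightarrow> 'b \<Rightarrow> real" where
  "cont_ext S f x = (if x \<in> S then f x else Lim (at x within S) f)"

definition pos_def_kernel :: "'a set \<Rightarrow> ('a \<times> 'a \<Rightarrow> real) \<Rightarrow> bool" where
  "pos_def_kernel \<Theta> h \<longleftrightarrow>
     (\<forall>x\<in>\<Theta>. \<forall>y\<in>\<Theta>. h (x, y) = h (y, x)) \<and>
     (\<forall>(n::nat) (c::nat \<Rightarrow> real) (x::nat \<Rightarrow> 'a). (\<forall>i<n. x i \<in> \<Theta>) \<longrightarrow>
        0 \<le> (\<Sum>i<n. \<Sum>j<n. c i * h (x i, x j) * c j))"

text \<open>
  Elements of \<open>H\<^sup>k(\<Theta>)\<close> are represented by functions on the whole space of which only the values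
  on \<open>\<Theta>\<close> matter; equality in \<open>H\<^sup>k(\<Theta>)\<close> is equality almost everywhere on \<open>\<Theta>\<close>.
\<close>

definition ae_eq :: "(real^'d::finite) set \<Rightarrow> (real^'d \<Rightarrow> real) \<Rightarrow> (real^'d \<Rightarrow> real) \<Rightarrow> bool" where
  "ae_eq \<Theta> f g \<longleftrightarrow> (AE x in lebesgue_on \<Theta>. f x = g x)"

definition test_function :: "(real^'d::finite) set \<Rightarrow> (real^'d \<Rightarrow> real) \<Rightarrow> bool" where
  "test_function \<Theta> \<phi> \<longleftrightarrow>
     (\<forall>vs. set vs \<subseteq> Basis \<longrightarrow> pd_exists UNIV vs \<phi> \<and> continuous_on UNIV (iter_pd vs \<phi>)) \<and>
     compact (closure {x. \<phi> x \<noteq> 0}) \<and> closure {x. \<phi> x \<noteq> 0} \<subseteq> \<Theta>"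

definition locally_integrable :: "(real^'d::finite) set \<Rightarrow> (real^'d \<Rightarrow> real) \<Rightarrow> bool" where
  "locally_integrable \<Theta> f \<longleftrightarrow> (\<forall>K. compact K \<and> K \<subseteq> \<Theta> \<longrightarrow> integrable (lebesgue_on K) f)"

definition has_weak_deriv ::
  "(real^'d::finite) set \<Rightarrow> ('d \<Rightarrow> nat) \<Rightarrow> (real^'d \<Rightarrow> real) \<Rightarrow> (real^'d \<Rightarrow> real) \<Rightarrow> bool" where
  "has_weak_deriv \<Theta> \<alpha> f g \<longleftrightarrow>
     locally_integrable \<Theta> f \<and> locally_integrable \<Theta> g \<and>
     (\<forall>\<phi>. test_function \<Theta> \<phi> \<longrightarrow>
        (LINT x|lebesgue_on \<Theta>. f x * pderiv_mi \<alpha> \<phi> x) =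
        (- 1) ^ (\<Sum>i\<in>UNIV. \<alpha> i) * (LINT x|lebesgue_on \<Theta>. g x * \<phi> x))"

text \<open>A representative of the weak derivative, which is unique almost everywhere on \<open>\<Theta>\<close>.\<close>

definition weak_deriv ::
  "(real^'d::finite) set \<Rightarrow> ('d \<Rightarrow> nat) \<Rightarrow> (real^'d \<Rightarrow> real) \<Rightarrow> real^'d \<Rightarrow> real" where
  "weak_deriv \<Theta> \<alpha> f = (SOME g. has_weak_deriv \<Theta> \<alpha> f g)"

definition L2 :: "(real^'d::finite) set \<Rightarrow> (real^'d \<Rightarrow> real) set" where
  "L2 \<Theta> = {f. f \<in> borel_measurable (lebesgue_on \<Theta>) \<and> integrable (lebesgue_on \<Theta>) (\<lambda>x. (f x)\<^sup>2)}"

definition sobolev :: "nat \<Rightarrow> (real^'d::finite) set \<Rightarrow> (real^'d \<Rightarrow> real) set" where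
  "sobolev k \<Theta> = {f \<in> L2 \<Theta>. \<forall>\<alpha>\<in>multi_indices k. \<exists>g\<in>L2 \<Theta>. has_weak_deriv \<Theta> \<alpha> f g}"

definition sob_inner ::
  "nat \<Rightarrow> (real^'d::finite) set \<Rightarrow> (real^'d \<Rightarrow> real) \<Rightarrow> (real^'d \<Rightarrow> real) \<Rightarrow> real" where
  "sob_inner k \<Theta> f g =
     (\<Sum>\<alpha>\<in>multi_indices k. LINT x|lebesgue_on \<Theta>. weak_deriv \<Theta> \<alpha> f x * weak_deriv \<Theta> \<alpha> g x)"

definition sob_norm :: "nat \<Rightarrow> (real^'d::finite) set \<Rightarrow> (real^'d \<Rightarrow> real) \<Rightarrow> real" where
  "sob_norm k \<Theta> f = sqrt (sob_inner k \<Theta> f f)"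

definition kernel_op ::
  "nat \<Rightarrow> (real^'d::finite) set \<Rightarrow> ((real^'d) \<times> (real^'d) \<Rightarrow> real)
     \<Rightarrow> (real^'d \<Rightarrow> real) \<Rightarrow> real^'d \<Rightarrow> real" where
  "kernel_op k \<Theta> h f = (\<lambda>y. LINT x|lebesgue_on \<Theta>.
     (\<Sum>\<alpha>\<in>multi_indices k. mixed_deriv \<alpha> (\<lambda>_. 0) h (x, y) * weak_deriv \<Theta> \<alpha> f x))"

type_synonym 'd operator = "(real^'d \<Rightarrow> real) \<Rightarrow> (real^'d \<Rightarrow> real)"

definition linear_op :: "nat \<Rightarrow> (real^'d::finite) set \<Rightarrow> 'd operator \<Rightarrow> bool" where
  "linear_op k \<Theta> T \<longleftrightarrow>
     (\<forall>f\<in>sobolev k \<Theta>. T f \<in> sobolev k \<Theta>) \<and>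
     (\<forall>f\<in>sobolev k \<Theta>. \<forall>g\<in>sobolev k \<Theta>. \<forall>a b.
        ae_eq \<Theta> (T (\<lambda>x. a * f x + b * g x)) (\<lambda>x. a * T f x + b * T g x))"

text \<open>
  Compactness entails boundedness, and hence, with linearity, that \<open>T\<close> maps functions that are
  equal almost everywhere to functions that are equal almost everywhere.
\<close>

definition compact_op :: "nat \<Rightarrow> (real^'d::finite) set \<Rightarrow> 'd operator \<Rightarrow> bool" where
  "compact_op k \<Theta> T \<longleftrightarrow> linear_op k \<Theta> T \<and>
     (\<forall>f::nat \<Rightarrow> real^'d \<Rightarrow> real.
        (\<forall>n. f n \<in> sobolev k \<Theta>) \<and> (\<exists>C. \<forall>n. sob_norm k \<Theta> (f n) \<le> C) \<longrightarrow>
        (\<exists>r::nat \<Rightarrow> nat. \<exists>g\<in>sobolev k \<Theta>. strict_mono r \<and>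
           (\<lambda>n. sob_norm k \<Theta> (\<lambda>x. T (f (r n)) x - g x)) \<longlonglongrightarrow> 0))"

definition adjoint_op :: "nat \<Rightarrow> (real^'d::finite) set \<Rightarrow> 'd operator \<Rightarrow> 'd operator \<Rightarrow> bool" where
  "adjoint_op k \<Theta> T S \<longleftrightarrow> linear_op k \<Theta> S \<and>
     (\<forall>f\<in>sobolev k \<Theta>. \<forall>g\<in>sobolev k \<Theta>. sob_inner k \<Theta> (T f) g = sob_inner k \<Theta> f (S g))"

definition nonneg_op :: "nat \<Rightarrow> (real^'d::finite) set \<Rightarrow> 'd operator \<Rightarrow> bool" where
  "nonneg_op k \<Theta> T \<longleftrightarrow> (\<forall>f\<in>sobolev k \<Theta>. 0 \<le> sob_inner k \<Theta> (T f) f)"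

text \<open>
  Eigensystem of a compact self-adjoint operator \<open>T\<close>: the non-zero eigenvalues \<open>lam j\<close>, \<open>j \<in> J\<close>,
  in order of decreasing absolute value, with orthonormal eigenfunctions \<open>e j\<close>. The last clause
  says that every non-zero eigenvalue is listed with its full multiplicity: the \<open>e j\<close> with
  \<open>lam j = \<mu>\<close> form an orthonormal basis of the eigenspace of \<open>\<mu>\<close>. It forces \<open>J\<close> to be infinite or
  of cardinality \<open>rank T\<close>.
\<close>

definition eigensystem ::
  "nat \<Rightarrow> (real^'d::finite) set \<Rightarrow> 'd operator \<Rightarrow> nat set \<Rightarrow> (nat \<Rightarrow> real)
     \<Rightarrow> (nat \<Rightarrow> real^'d \<Rightarrow> real) \<Rightarrow> bool" where
  "eigensystem k \<Theta> T J lam e \<longleftrightarrow>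
     (J = {1..} \<or> (\<exists>N. J = {1..N})) \<and>
     (\<forall>j\<in>J. e j \<in> sobolev k \<Theta> \<and> lam j \<noteq> 0 \<and> ae_eq \<Theta> (T (e j)) (\<lambda>x. lam j * e j x)) \<and>
     (\<forall>i\<in>J. \<forall>j\<in>J. sob_inner k \<Theta> (e i) (e j) = (if i = j then 1 else 0)) \<and>
     (\<forall>i\<in>J. \<forall>j\<in>J. i \<le> j \<longrightarrow> \<bar>lam j\<bar> \<le> \<bar>lam i\<bar>) \<and>
     (\<forall>\<mu>. \<forall>f\<in>sobolev k \<Theta>. \<mu> \<noteq> 0 \<and> ae_eq \<Theta> (T f) (\<lambda>x. \<mu> * f x) \<and>
        (\<forall>j\<in>J. lam j = \<mu> \<longrightarrow> sob_inner k \<Theta> f (e j) = 0) \<longrightarrow> ae_eq \<Theta> f (\<lambda>_. 0))"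

text \<open>
  The (non-zero) singular values of \<open>T\<close> are the square roots of the non-zero eigenvalues of
  \<open>T\<^sup>*T\<close>, counted with multiplicity.
\<close>

definition singular_values ::
  "nat \<Rightarrow> (real^'d::finite) set \<Rightarrow> 'd operator \<Rightarrow> nat set \<Rightarrow> (nat \<Rightarrow> real) \<Rightarrow> bool" where
  "singular_values k \<Theta> T J s \<longleftrightarrow>
     (\<exists>S mu e. adjoint_op k \<Theta> T S \<and> eigensystem k \<Theta> (S \<circ> T) J mu e \<and> (\<forall>j\<in>J. s j = sqrt (mu j)))"

definition nuclear_op :: "nat \<Rightarrow> (real^'d::finite) set \<Rightarrow> 'd operator \<Rightarrow> bool" where
  "nuclear_op k \<Theta> T \<longleftrightarrow> compact_op k \<Theta> T \<and> (\<exists>J s. singular_values k \<Theta> T J s \<and> s summable_on J)"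

definition nuclear_norm :: "nat \<Rightarrow> (real^'d::finite) set \<Rightarrow> 'd operator \<Rightarrow> real" where
  "nuclear_norm k \<Theta> T = (THE r. \<exists>J s. singular_values k \<Theta> T J s \<and> r = (\<Sum>\<^sub>\<infinity>j\<in>J. s j))"

end

theory Submission
  imports Defs "HOL-Complex_Analysis.Great_Picard"
begin

text \<open>
  Weak derivatives embed \<open>H\<^sup>k(\<Theta>)\<close> isometrically into the space of \<open>L\<^sup>2\<close> families indexed by
  \<open>|\<alpha>| \<le> k\<close>, and there \<open>T\<^bsub>h,k\<^esub>\<close> is the restriction of the integral operator with matrix kernel
  \<open>\<partial>\<^bsup>[\<alpha>,\<beta>]\<^esup>h\<close>, whose range consists of families of weak derivatives; so both operators have the
  same non-zero eigenvalues. Finite differences carry the positive definiteness of \<open>h\<close> over to the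
  matrix kernel, and the integral operator is compact by Arzela--Ascoli and non-negative. The trace
  formula follows Mercer: testing positivity against a point mass corrected by finitely many
  eigenfunctions bounds \<open>\<Sum>\<^sub>j \<lambda>\<^sub>j |e\<^sub>j(x)|\<^sup>2\<close> by the diagonal of the kernel, and compressing the operator
  to families that are constant on small cells gives the reverse inequality. Since
  \<open>T\<^sup>*T = T\<^sup>2\<close> and \<open>T\<close> is non-negative, the singular values are the eigenvalues, and
  \<open>j \<lambda>\<^sub>j \<le> \<lambda>\<^sub>1 + \<dots> + \<lambda>\<^sub>j\<close> bounds \<open>\<lambda>\<^sub>j\<close>.
\<close>

section \<open>Compact non-negative operators on semi-inner product spaces\<close>

text \<open>The enlargement from H^k to families is forced by the trace. The two trace inequalities
  are tested with the point value of a single component and with the indicator of a cell in a single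
  component; in general neither is the family of weak derivatives of a function in H^k, whose
  components are tied together. On families the kernel is an ordinary bounded, uniformly continuous
  matrix kernel and both tests are available. Eigenfunctions are classes up to null sets, so point
  values are taken only of images under the integral operator, which are continuous on \<Theta>: an
  eigenfunction is represented by its image divided by the eigenvalue. Only finite partial sums are
  compared with the diagonal. Eigensystems, adjoints and singular values are described by properties
  and not constructed. Two things are therefore owed besides the estimates: that an eigensystem
  exists, and that the nuclear norm is the same for every choice. The second comes out of the trace
  formula itself, since both inequalities hold for an arbitrary eigensystem and so every one of them
  sums to the same integral over the diagonal.\<close>

text \<open>
  Spaces of functions that are only determined up to null vectors, with pointwise linear
  structure. Completeness is never needed: limits are supplied by compactness of the operator.
\<close>

locale semi_inner =
  fixes V :: "('x \<Rightarrow> real) set" and ip :: "('x \<Rightarrow> real) \<Rightarrow> ('x \<Rightarrow> real) \<Rightarrow> real"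
  assumes nonempty: "V \<noteq> {}"
    and lincomb: "\<And>f g a b. f \<in> V \<Longrightarrow> g \<in> V \<Longrightarrow> (\<lambda>x. a * f x + b * g x) \<in> V"
    and ip_lin: "\<And>f g u a b. f \<in> V \<Longrightarrow> g \<in> V \<Longrightarrow> u \<in> V \<Longrightarrow>
       ip (\<lambda>x. a * f x + b * g x) u = a * ip f u + b * ip g u"
    and ip_sym: "\<And>f g. f \<in> V \<Longrightarrow> g \<in> V \<Longrightarrow> ip f g = ip g f"
    and ip_nonneg: "\<And>f. f \<in> V \<Longrightarrow> 0 \<le> ip f f"
begin

lemma zero_in: "(\<lambda>x. 0) \<in> V"
proof -
  obtain f where "f \<in> V" using nonempty by auto
  from lincomb[OF this this, of 0 0] show ?thesis by simp
qed

lemma ip_zero: "u \<in> V \<Longrightarrow> ip (\<lambda>x. 0) u = 0"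
  using ip_lin[OF zero_in zero_in, of u 0 0] by simp

lemma scale_in: "f \<in> V \<Longrightarrow> (\<lambda>x. a * f x) \<in> V"
  using lincomb[of f f a 0] by simp

lemma diff_in: "f \<in> V \<Longrightarrow> g \<in> V \<Longrightarrow> (\<lambda>x. f x - g x) \<in> V"
  using lincomb[of f g 1 "-1"] by simp

lemma ip_scale: "f \<in> V \<Longrightarrow> u \<in> V \<Longrightarrow> ip (\<lambda>x. a * f x) u = a * ip f u"
  using ip_lin[of f f u a 0] by simp

lemma ip_diff: "f \<in> V \<Longrightarrow> g \<in> V \<Longrightarrow> u \<in> V \<Longrightarrow> ip (\<lambda>x. f x - g x) u = ip f u - ip g u"
  using ip_lin[of f g u 1 "-1"] by simp

lemma ip_lin2: "f \<in> V \<Longrightarrow> g \<in> V \<Longrightarrow> u \<in> V \<Longrightarrow>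
    ip u (\<lambda>x. a * f x + b * g x) = a * ip u f + b * ip u g"
  using ip_lin[of f g u a b] lincomb[of f g a b] ip_sym by simp

lemma ip_scale2: "f \<in> V \<Longrightarrow> u \<in> V \<Longrightarrow> ip u (\<lambda>x. a * f x) = a * ip u f"
  using ip_lin2[of f f u a 0] by simp

lemma ip_diff2: "f \<in> V \<Longrightarrow> g \<in> V \<Longrightarrow> u \<in> V \<Longrightarrow> ip u (\<lambda>x. f x - g x) = ip u f - ip u g"
  using ip_lin2[of f g u 1 "-1"] by simp

lemma sum_in:
  assumes "finite F" "\<And>i. i \<in> F \<Longrightarrow> e i \<in> V"
  shows "(\<lambda>x. \<Sum>i\<in>F. c i * e i x) \<in> V"
  using assms
proof (induction F rule: finite_induct)
  case empty then show ?case using zero_in by simp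
next
  case (insert i F)
  then show ?case using lincomb[of "e i" "\<lambda>x. \<Sum>i\<in>F. c i * e i x" "c i" 1] by simp
qed

lemma ip_sum:
  assumes "finite F" "\<And>i. i \<in> F \<Longrightarrow> e i \<in> V" "u \<in> V"
  shows "ip (\<lambda>x. \<Sum>i\<in>F. c i * e i x) u = (\<Sum>i\<in>F. c i * ip (e i) u)"
  using assms
proof (induction F rule: finite_induct)
  case empty then show ?case using ip_zero by simp
next
  case (insert i F)
  then show ?case
    using ip_lin[of "e i" "\<lambda>x. \<Sum>i\<in>F. c i * e i x" u "c i" 1] sum_in[of F e c] by simp
qed

text \<open>The form is non-negative on all combinations of \<open>f\<close> and \<open>g\<close>.
  As it may be degenerate, \<open>ip g g = 0\<close> is a case of its own: there the expression with
  \<open>a = 1\<close> is affine in \<open>b\<close>, and the chosen \<open>b\<close> would give it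
  the value -1. Otherwise \<open>a = ip g g\<close>, \<open>b = - ip f g\<close> yields the claim
  multiplied by \<open>ip g g\<close>.\<close>

lemma cauchy_schwarz:
  assumes f: "f \<in> V" and g: "g \<in> V"
  shows "(ip f g)\<^sup>2 \<le> ip f f * ip g g"
proof -
  have q: "0 \<le> a\<^sup>2 * ip f f + 2 * a * b * ip f g + b\<^sup>2 * ip g g" for a b
  proof -
    have "0 \<le> ip (\<lambda>x. a * f x + b * g x) (\<lambda>x. a * f x + b * g x)"
      by (intro ip_nonneg lincomb f g)
    also have "\<dots> = a * (a * ip f f + b * ip f g) + b * (a * ip f g + b * ip g g)"
      using f g by (simp add: ip_lin ip_lin2 lincomb ip_sym[of g f])
    finally show ?thesis by (simp add: algebra_simps power2_eq_square)
  qed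
  show ?thesis
  proof (cases "ip g g = 0")
    case True
    have "ip f g = 0"
    proof (rule ccontr)
      assume n: "ip f g \<noteq> 0"
      have "0 \<le> ip f f + 2 * b * ip f g" for b using q[of 1 b] True by simp
      from this[of "- (ip f f + 1) / (2 * ip f g)"] n show False by (simp add: field_simps)
    qed
    then show ?thesis using True by simp
  next
    case False
    then have p: "ip g g > 0" using ip_nonneg[OF g] by simp
    have "0 \<le> ip g g * (ip f f * ip g g - (ip f g)\<^sup>2)"
      using q[of "ip g g" "- ip f g"] by (simp add: algebra_simps power2_eq_square)
    then show ?thesis using p by (simp add: zero_le_mult_iff)
  qed
qed

lemma null_ip: "f \<in> V \<Longrightarrow> g \<in> V \<Longrightarrow> ip f f = 0 \<Longrightarrow> ip f g = 0"
  using cauchy_schwarz[of f g] by simp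

lemma ip_diff_self:
  assumes "f \<in> V" "g \<in> V"
  shows "ip (\<lambda>x. f x - g x) (\<lambda>x. f x - g x) = ip f f - 2 * ip f g + ip g g"
  using assms by (simp add: ip_diff ip_diff2 diff_in ip_sym[of g f])

text \<open>A triangle inequality that stays with squared norms: by the parallelogram law |p + q|^2
  is at most 2|p|^2 + 2|q|^2. The later limit arguments are all phrased in squared norms.\<close>

lemma ip_diff_le:
  assumes "f \<in> V" "g \<in> V" "u \<in> V"
  shows "ip (\<lambda>x. f x - u x) (\<lambda>x. f x - u x)
     \<le> 2 * ip (\<lambda>x. f x - g x) (\<lambda>x. f x - g x) + 2 * ip (\<lambda>x. g x - u x) (\<lambda>x. g x - u x)"
proof -
  define p q where "p = (\<lambda>x. f x - g x)" and "q = (\<lambda>x. g x - u x)"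
  have pq: "p \<in> V" "q \<in> V" unfolding p_def q_def using assms by (auto intro: diff_in)
  have "0 \<le> ip (\<lambda>x. p x - q x) (\<lambda>x. p x - q x)" by (intro ip_nonneg diff_in pq)
  also have "\<dots> = ip p p - 2 * ip p q + ip q q" using pq by (rule ip_diff_self)
  finally have "2 * ip p q \<le> ip p p + ip q q" by simp
  moreover have "ip (\<lambda>x. 1 * p x + 1 * q x) (\<lambda>x. 1 * p x + 1 * q x) = ip p p + 2 * ip p q + ip q q"
    by (subst ip_lin, (intro pq lincomb)+, (subst ip_lin2, (intro pq)+)+) (simp add: ip_sym[OF pq(2) pq(1)])
  moreover have "(\<lambda>x. 1 * p x + 1 * q x) = (\<lambda>x. f x - u x)" by (simp add: p_def q_def)
  ultimately show ?thesis by (simp add: p_def q_def)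
qed

lemma tendsto_ip:
  assumes "\<And>n. f n \<in> V" "g \<in> V" "u \<in> V"
    and "(\<lambda>n. ip (\<lambda>x. f n x - g x) (\<lambda>x. f n x - g x)) \<longlonglongrightarrow> 0"
  shows "(\<lambda>n. ip (f n) u) \<longlonglongrightarrow> ip g u"
proof -
  have "(\<lambda>n. (ip (f n) u - ip g u)\<^sup>2) \<longlonglongrightarrow> 0"
  proof (rule tendsto_sandwich[OF _ _ tendsto_const])
    show "(\<lambda>n. ip (\<lambda>x. f n x - g x) (\<lambda>x. f n x - g x) * ip u u) \<longlonglongrightarrow> 0"
      using tendsto_mult_right[OF assms(4), of "ip u u"] by simp
    show "\<forall>\<^sub>F n in sequentially. (ip (f n) u - ip g u)\<^sup>2 \<le> ip (\<lambda>x. f n x - g x) (\<lambda>x. f n x - g x) * ip u u"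
      using cauchy_schwarz[OF diff_in[OF assms(1) assms(2)] assms(3)] assms(1-3)
      by (simp add: ip_diff)
  qed simp
  then have "(\<lambda>n. ip (f n) u - ip g u) \<longlonglongrightarrow> 0" by simp
  then show ?thesis by (simp add: LIM_zero_iff)
qed

text \<open>Expand 0 \<le> |s - u|^2 for the combination \<open>s\<close> of the \<open>e i\<close>
  with coefficients \<open>ip (e i) u\<close>. Asking for \<open>\<le> 1\<close> instead of unit
  length admits zero vectors in the system; the normalised indicator of a cell of measure zero is
  such a vector.\<close>

lemma bessel:
  assumes "finite F" "\<And>i. i \<in> F \<Longrightarrow> e i \<in> V" "u \<in> V"
    and ortho: "\<And>i j. i \<in> F \<Longrightarrow> j \<in> F \<Longrightarrow> i \<noteq> j \<Longrightarrow> ip (e i) (e j) = 0"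
    and unit: "\<And>i. i \<in> F \<Longrightarrow> ip (e i) (e i) \<le> 1"
  shows "(\<Sum>i\<in>F. (ip (e i) u)\<^sup>2) \<le> ip u u"
proof -
  define s where "s = (\<lambda>x. \<Sum>i\<in>F. ip (e i) u * e i x)"
  have s: "s \<in> V" unfolding s_def by (intro sum_in assms)
  have su: "ip s v = (\<Sum>i\<in>F. ip (e i) u * ip (e i) v)" if "v \<in> V" for v
    unfolding s_def using assms that by (simp add: ip_sum)
  have "ip s s = (\<Sum>i\<in>F. ip (e i) u * (\<Sum>j\<in>F. ip (e j) u * ip (e j) (e i)))"
    using su[OF s] su[OF assms(2)] ip_sym[OF s assms(2)] by simp
  also have "\<dots> = (\<Sum>i\<in>F. ip (e i) u * (ip (e i) u * ip (e i) (e i)))"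
  proof (intro sum.cong refl)
    fix i assume i: "i \<in> F"
    have "(\<Sum>j\<in>F. ip (e j) u * ip (e j) (e i)) = (\<Sum>j\<in>F. if j = i then ip (e i) u * ip (e i) (e i) else 0)"
      using i ortho by (intro sum.cong) auto
    then show "ip (e i) u * (\<Sum>j\<in>F. ip (e j) u * ip (e j) (e i)) = ip (e i) u * (ip (e i) u * ip (e i) (e i))"
      using i \<open>finite F\<close> by simp
  qed
  also have "\<dots> \<le> (\<Sum>i\<in>F. (ip (e i) u)\<^sup>2)"
  proof (rule sum_mono)
    fix i assume "i \<in> F"
    then have "(ip (e i) u)\<^sup>2 * ip (e i) (e i) \<le> (ip (e i) u)\<^sup>2 * 1"
      by (intro mult_left_mono unit) auto
    then show "ip (e i) u * (ip (e i) u * ip (e i) (e i)) \<le> (ip (e i) u)\<^sup>2"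
      by (simp add: power2_eq_square mult.assoc)
  qed
  finally have ss: "ip s s \<le> (\<Sum>i\<in>F. (ip (e i) u)\<^sup>2)" .
  have "0 \<le> ip (\<lambda>x. s x - u x) (\<lambda>x. s x - u x)" by (intro ip_nonneg diff_in s assms)
  also have "\<dots> = ip s s - 2 * ip s u + ip u u" using s assms by (simp add: ip_diff_self)
  also have "ip s u = (\<Sum>i\<in>F. (ip (e i) u)\<^sup>2)" using su[OF assms(3)] by (simp add: power2_eq_square)
  finally show ?thesis using ss by linarith
qed

text \<open>Tested against \<open>V\<close>, because \<open>T f = \<mu> f\<close> can only be asked for up to a null vector.\<close>

definition eigv :: "(('x \<Rightarrow> real) \<Rightarrow> ('x \<Rightarrow> real)) \<Rightarrow> real \<Rightarrow> ('x \<Rightarrow> real) \<Rightarrow> bool" where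
  "eigv T \<mu> f \<longleftrightarrow> f \<in> V \<and> (\<forall>u\<in>V. ip (T f) u = \<mu> * ip f u)"

text \<open>The difference \<open>T f - \<mu> f\<close> is orthogonal to everything exactly if it is
  null: in one direction it is tested against itself, in the other Cauchy--Schwarz applies. This
  connects the weak eigenvalue equation with equality almost everywhere.\<close>

lemma eigv_iff_null:
  assumes "f \<in> V" "T f \<in> V"
  shows "eigv T \<mu> f \<longleftrightarrow> ip (\<lambda>x. T f x - \<mu> * f x) (\<lambda>x. T f x - \<mu> * f x) = 0"
proof
  assume "eigv T \<mu> f"
  then have "ip (T f) u = \<mu> * ip f u" if "u \<in> V" for u using that by (auto simp: eigv_def)
  then show "ip (\<lambda>x. T f x - \<mu> * f x) (\<lambda>x. T f x - \<mu> * f x) = 0"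
    using assms by (simp add: ip_diff scale_in diff_in ip_scale)
next
  assume n: "ip (\<lambda>x. T f x - \<mu> * f x) (\<lambda>x. T f x - \<mu> * f x) = 0"
  show "eigv T \<mu> f" unfolding eigv_def
  proof (intro conjI ballI assms)
    fix u assume u: "u \<in> V"
    from null_ip[OF _ u n] show "ip (T f) u = \<mu> * ip f u"
      using assms u by (simp add: ip_diff scale_in diff_in ip_scale)
  qed
qed

text \<open>The counterpart of \<open>eigensystem\<close> with almost everywhere equality replaced
  by equality up to null vectors, so that one notion serves H^k and the space of families
  alike.\<close>

definition eigsys where
  "eigsys T J lam e \<longleftrightarrow>
     (J = {1::nat..} \<or> (\<exists>N. J = {1..N})) \<and>
     (\<forall>j\<in>J. lam j \<noteq> 0 \<and> eigv T (lam j) (e j)) \<and>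
     (\<forall>i\<in>J. \<forall>j\<in>J. ip (e i) (e j) = (if i = j then 1 else 0)) \<and>
     (\<forall>i\<in>J. \<forall>j\<in>J. i \<le> j \<longrightarrow> \<bar>lam j\<bar> \<le> \<bar>lam i\<bar>) \<and>
     (\<forall>\<mu> f. \<mu> \<noteq> 0 \<and> eigv T \<mu> f \<and>
        (\<forall>j\<in>J. lam j = \<mu> \<longrightarrow> ip f (e j) = 0) \<longrightarrow> ip f f = 0)"

end

section \<open>Spectral theorem for a compact symmetric operator with non-negative quadratic
  form\<close>

locale psd_compact = semi_inner +
  fixes T :: "('a \<Rightarrow> real) \<Rightarrow> ('a \<Rightarrow> real)" and B :: real
  assumes T_in: "\<And>f. f \<in> V \<Longrightarrow> T f \<in> V"
    and T_sym: "\<And>f g. f \<in> V \<Longrightarrow> g \<in> V \<Longrightarrow> ip (T f) g = ip f (T g)"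
    and T_pos: "\<And>f. f \<in> V \<Longrightarrow> 0 \<le> ip (T f) f"
    and T_bdd: "\<And>f. f \<in> V \<Longrightarrow> ip (T f) f \<le> B * ip f f"
    and T_compact: "\<And>(f :: nat \<Rightarrow> 'a \<Rightarrow> real) C. (\<And>n. f n \<in> V) \<Longrightarrow> (\<And>n. ip (f n) (f n) \<le> C) \<Longrightarrow>
        \<exists>r g. strict_mono (r :: nat \<Rightarrow> nat) \<and> g \<in> V \<and>
          (\<lambda>n. ip (\<lambda>x. T (f (r n)) x - g x) (\<lambda>x. T (f (r n)) x - g x)) \<longlonglongrightarrow> 0"
begin

text \<open>Symmetry moves \<open>T\<close> to the other argument, where the combination is expanded
  by linearity of \<open>ip\<close>. Linearity of \<open>T\<close> thus comes for free, up to null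
  vectors.\<close>

lemma T_lin: 
  assumes "f \<in> V" "g \<in> V" "u \<in> V"
  shows "ip (T (\<lambda>x. a * f x + b * g x)) u = a * ip (T f) u + b * ip (T g) u"
  using assms by (simp add: T_sym lincomb ip_lin T_in)

text \<open>\<open>ip (T f) g\<close> is itself a semi-inner product, usually a degenerate one, so
  the general inequality applies to it.\<close>

lemma T_cauchy_schwarz:
  assumes "f \<in> V" "g \<in> V"
  shows "(ip (T f) g)\<^sup>2 \<le> ip (T f) f * ip (T g) g"
proof -
  interpret Q: semi_inner V "\<lambda>f g. ip (T f) g"
  proof
    show "V \<noteq> {}" by (rule nonempty)
    show "ip (T f) g = ip (T g) f" if "f \<in> V" "g \<in> V" for f g
      using that T_sym[of f g] ip_sym[of f "T g"] T_in by simp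
  qed (use lincomb T_lin T_pos in auto)
  show ?thesis using Q.cauchy_schwarz[OF assms] .
qed

lemma eigv_ortho:
  assumes "eigv T \<mu> f" "eigv T \<nu> g" "\<mu> \<noteq> \<nu>"
  shows "ip f g = 0"
proof -
  have "\<mu> * ip f g = \<nu> * ip f g"
    using assms T_sym[of f g] ip_sym[of f "T g"] ip_sym[of f g] T_in by (auto simp: eigv_def)
  then show ?thesis using assms(3) by simp
qed

lemma eigv_nonneg: 
  assumes "eigv T \<mu> f" "ip f f > 0" shows "\<mu> \<ge> 0"
  using assms T_pos[of f] by (auto simp: eigv_def zero_le_mult_iff)

text \<open>
  A maximising sequence \<open>f\<^sub>n\<close> of the quadratic form on the orthogonal complement of the \<open>e i\<close> satisfies
  \<open>|T f\<^sub>n|\<^sup>2 \<le> m \<langle>T f\<^sub>n, f\<^sub>n\<rangle>\<close> by Cauchy--Schwarz for that form, hence \<open>T f\<^sub>n - m f\<^sub>n \<rightarrow> 0\<close>.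
\<close>

lemma max_eigenvector:
  assumes ev: "\<And>i. i \<in> I \<Longrightarrow> eigv T (lam i) (e i)"
    and f0: "f0 \<in> V" "\<And>i. i \<in> I \<Longrightarrow> ip f0 (e i) = 0" "ip (T f0) f0 > 0"
  obtains m g where "m > 0" "eigv T m g" "ip g g = 1" "\<And>i. i \<in> I \<Longrightarrow> ip g (e i) = 0"
    "\<And>f. f \<in> V \<Longrightarrow> (\<And>i. i \<in> I \<Longrightarrow> ip f (e i) = 0) \<Longrightarrow> ip (T f) f \<le> m * ip f f"
proof -
  define W where "W = {f \<in> V. \<forall>i\<in>I. ip f (e i) = 0}"
  define Q where "Q = (\<lambda>f. ip (T f) f) ` {f \<in> W. ip f f \<le> 1}"
  define m where "m = Sup Q"
  have eV: "e i \<in> V" if "i \<in> I" for i using ev[OF that] by (simp add: eigv_def)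
  have W_scale: "(\<lambda>x. a * f x) \<in> W" if "f \<in> W" for a f
    using that eV by (auto simp: W_def scale_in ip_scale)
  \<comment> \<open>By symmetry the complement of a set of eigenvectors is invariant, so the bound
    by \<open>m\<close> is also available at \<open>T f\<close>.\<close>
  have W_T: "T f \<in> W" if "f \<in> W" for f
  proof -
    have "ip (T f) (e i) = 0" if i: "i \<in> I" for i
      using ev[OF i] \<open>f \<in> W\<close> i T_sym[of f "e i"] ip_sym[of f "T (e i)"] ip_sym[of f "e i"] T_in
      by (auto simp: eigv_def W_def)
    then show ?thesis using that by (auto simp: W_def T_in)
  qed
  have TV: "ip (T (\<lambda>x. a * f x)) (\<lambda>x. a * f x) = a\<^sup>2 * ip (T f) f" if "f \<in> V" for a f
    using that T_lin[of f f _ a 0] by (simp add: scale_in ip_scale2 T_in power2_eq_square)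
  have bdd: "bdd_above Q" unfolding bdd_above_def
  proof (rule exI[of _ "\<bar>B\<bar>"], rule ballI)
    fix q assume "q \<in> Q"
    then obtain f where f: "f \<in> V" "ip f f \<le> 1" "q = ip (T f) f" by (auto simp: Q_def W_def)
    have "q \<le> B * ip f f" using f T_bdd by simp
    also have "\<dots> \<le> \<bar>B\<bar> * ip f f" using ip_nonneg[OF f(1)] by (intro mult_right_mono) auto
    also have "\<dots> \<le> \<bar>B\<bar> * 1" using f by (intro mult_left_mono) auto
    finally show "q \<le> \<bar>B\<bar>" by simp
  qed
  have le_m: "ip (T f) f \<le> m * ip f f" if f: "f \<in> W" for f
  proof (cases "ip f f = 0")
    case True
    have fV: "f \<in> V" using f by (simp add: W_def)
    then have "ip f (T f) = 0" using True T_in null_ip by blast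
    then show ?thesis using True fV T_in ip_sym by simp
  next
    case False
    have fV: "f \<in> V" using f by (simp add: W_def)
    have p: "ip f f > 0" using False ip_nonneg[OF fV] by simp
    define a where "a = 1 / sqrt (ip f f)"
    have a2: "a\<^sup>2 = 1 / ip f f" using p by (simp add: a_def power_divide)
    have "ip (T (\<lambda>x. a * f x)) (\<lambda>x. a * f x) \<in> Q" unfolding Q_def
      using W_scale[OF f] fV p a2
      by (intro imageI) (simp add: ip_scale ip_scale2 scale_in power2_eq_square[symmetric] flip: mult.assoc)
    then have "a\<^sup>2 * ip (T f) f \<le> m" using cSup_upper[OF _ bdd] TV[OF fV] by (simp add: m_def)
    then show ?thesis using p by (simp add: a2 field_simps)
  qed
  have f0W: "f0 \<in> W" using f0 by (simp add: W_def)
  have mpos: "m > 0"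
  proof (rule ccontr)
    assume "\<not> m > 0"
    then have "m * ip f0 f0 \<le> 0" using ip_nonneg[OF f0(1)] by (simp add: mult_nonpos_nonneg)
    then show False using le_m[OF f0W] f0(3) by simp
  qed
  have Qne: "Q \<noteq> {}"
    using W_scale[OF f0W, of 0] ip_zero[OF zero_in] by (auto simp: Q_def intro!: exI[of _ "\<lambda>x. 0"])
  have "\<exists>f. f \<in> W \<and> ip f f \<le> 1 \<and> ip (T f) f > m - 1 / real (Suc n)" for n
  proof -
    have "m - 1 / real (Suc n) < Sup Q" by (simp add: m_def)
    then obtain q where "q \<in> Q" "q > m - 1 / real (Suc n)" using less_cSup_iff[OF Qne bdd] by auto
    then show ?thesis by (auto simp: Q_def)
  qed
  then obtain f where fW: "\<And>n. f n \<in> W" and f1: "\<And>n. ip (f n) (f n) \<le> 1"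
    and fq: "\<And>n. ip (T (f n)) (f n) > m - 1 / real (Suc n)" by metis
  have fV: "f n \<in> V" for n using fW by (simp add: W_def)
  have TfV: "T (f n) \<in> V" for n using fV T_in by simp
  have TfW: "T (f n) \<in> W" for n using fW W_T by simp
  have fqm: "ip (T (f n)) (f n) \<le> m" for n
  proof -
    have "m * ip (f n) (f n) \<le> m * 1" using f1[of n] mpos by (intro mult_left_mono) auto
    then show ?thesis using le_m[OF fW, of n] by simp
  qed
  have q_lim: "(\<lambda>n. ip (T (f n)) (f n)) \<longlonglongrightarrow> m"
  proof (rule tendsto_sandwich[OF _ _ _ tendsto_const])
    show "(\<lambda>n. m - 1 / real (Suc n)) \<longlonglongrightarrow> m"
      using tendsto_diff[OF tendsto_const LIMSEQ_inverse_real_of_nat, of m] by (simp add: inverse_eq_divide)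
  qed (use fq fqm in \<open>auto intro!: always_eventually less_imp_le\<close>)
  have Tf2: "ip (T (f n)) (T (f n)) \<le> m * ip (T (f n)) (f n)" for n
  proof -
    let ?t = "ip (T (f n)) (T (f n))"
    have "?t\<^sup>2 \<le> ip (T (f n)) (f n) * ip (T (T (f n))) (T (f n))"
      using T_cauchy_schwarz[OF fV TfV, of n n] .
    also have "\<dots> \<le> ip (T (f n)) (f n) * (m * ?t)"
      using T_pos[OF fV] le_m[OF TfW] by (intro mult_left_mono) auto
    finally have "?t * ?t \<le> ?t * (m * ip (T (f n)) (f n))" by (simp add: power2_eq_square algebra_simps)
    moreover have "?t \<ge> 0" using ip_nonneg TfV by simp
    moreover have "m * ip (T (f n)) (f n) \<ge> 0" using mpos T_pos[OF fV] by simp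
    ultimately show ?thesis by (cases "?t = 0") auto
  qed
  obtain r y where r: "strict_mono (r :: nat \<Rightarrow> nat)" and y: "y \<in> V"
    and lim: "(\<lambda>n. ip (\<lambda>x. T (f (r n)) x - y x) (\<lambda>x. T (f (r n)) x - y x)) \<longlonglongrightarrow> 0"
    using T_compact[of f 1] fV f1 by blast
  have ql: "(\<lambda>n. ip (T (f (r n))) (f (r n))) \<longlonglongrightarrow> m"
    using LIMSEQ_subseq_LIMSEQ[OF q_lim r] by (simp add: o_def)
  \<comment> \<open>With |f_n| \<le> 1 and \<open>Tf2\<close>, the squared distance of m f_n and T
    f_n is at most m^2 - m <T f_n, f_n>, which tends to 0. So m f_n has the same limit
    \<open>y\<close> as T f_n.\<close>
  have mf: "(\<lambda>n. ip (\<lambda>x. m * f (r n) x - y x) (\<lambda>x. m * f (r n) x - y x)) \<longlonglongrightarrow> 0"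
  proof (rule tendsto_sandwich[OF _ _ tendsto_const])
    let ?D = "\<lambda>n. ip (\<lambda>x. T (f (r n)) x - y x) (\<lambda>x. T (f (r n)) x - y x)"
    have "ip (\<lambda>x. m * f (r n) x - y x) (\<lambda>x. m * f (r n) x - y x)
       \<le> 2 * (m\<^sup>2 - m * ip (T (f (r n))) (f (r n))) + 2 * ?D n" for n
    proof -
      have "ip (\<lambda>x. m * f (r n) x - T (f (r n)) x) (\<lambda>x. m * f (r n) x - T (f (r n)) x)
        = m\<^sup>2 * ip (f (r n)) (f (r n)) - 2 * m * ip (T (f (r n))) (f (r n)) + ip (T (f (r n))) (T (f (r n)))"
        using fV TfV by (simp add: ip_diff_self scale_in ip_scale ip_scale2 power2_eq_square ip_sym[of "f (r n)" "T (f (r n))"])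
      also have "\<dots> \<le> m\<^sup>2 * 1 - 2 * m * ip (T (f (r n))) (f (r n)) + m * ip (T (f (r n))) (f (r n))"
        using Tf2[of "r n"] f1[of "r n"] mpos by (intro add_mono diff_mono mult_left_mono) auto
      finally show ?thesis
        using ip_diff_le[of "\<lambda>x. m * f (r n) x" "T (f (r n))" y] fV TfV y by (simp add: scale_in)
    qed
    then show "\<forall>\<^sub>F n in sequentially. ip (\<lambda>x. m * f (r n) x - y x) (\<lambda>x. m * f (r n) x - y x)
       \<le> 2 * (m\<^sup>2 - m * ip (T (f (r n))) (f (r n))) + 2 * ?D n" by simp
    have "(\<lambda>n. 2 * (m\<^sup>2 - m * ip (T (f (r n))) (f (r n))) + 2 * ?D n) \<longlonglongrightarrow> 2 * (m\<^sup>2 - m * m) + 2 * 0"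
      by (intro tendsto_intros ql lim)
    then show "(\<lambda>n. 2 * (m\<^sup>2 - m * ip (T (f (r n))) (f (r n))) + 2 * ?D n) \<longlonglongrightarrow> 0"
      by (simp add: power2_eq_square)
    show "\<forall>\<^sub>F n in sequentially. 0 \<le> ip (\<lambda>x. m * f (r n) x - y x) (\<lambda>x. m * f (r n) x - y x)"
      using fV y by (auto intro!: always_eventually ip_nonneg diff_in scale_in)
  qed
  have yu: "(\<lambda>n. m * ip (f (r n)) u) \<longlonglongrightarrow> ip y u" if "u \<in> V" for u
    using tendsto_ip[OF _ y that mf] fV that by (simp add: scale_in ip_scale)
  have yu': "(\<lambda>n. ip (T (f (r n))) u) \<longlonglongrightarrow> ip y u" if "u \<in> V" for u
    using tendsto_ip[OF _ y that lim] TfV that by simp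
  \<comment> \<open>The sequence m <f_n, T u> = m <T f_n, u> is evaluated twice: once through m f_n
    tending to \<open>y\<close>, once through T f_n tending to \<open>y\<close>.\<close>
  have yev: "ip (T y) u = m * ip y u" if u: "u \<in> V" for u
  proof -
    have "(\<lambda>n. m * ip (f (r n)) (T u)) \<longlonglongrightarrow> ip y (T u)" using yu T_in u by simp
    moreover have "(\<lambda>n. m * ip (f (r n)) (T u)) \<longlonglongrightarrow> m * ip y u"
      using tendsto_mult_left[OF yu'[OF u], of m] T_sym fV u by simp
    ultimately show ?thesis using LIMSEQ_unique T_sym y u by metis
  qed
  have yW: "ip y (e i) = 0" if "i \<in> I" for i
  proof -
    have "ip (f n) (e i) = 0" for n using fW that by (simp add: W_def)
    then show ?thesis using yu[OF eV[OF that]] by (simp add: LIMSEQ_const_iff)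
  qed
  \<comment> \<open>If \<open>y\<close> were null, Cauchy--Schwarz would bound <T f_n, f_n>^2 by |T
    f_n - y|^2, which tends to 0, while <T f_n, f_n> tends to m > 0.\<close>
  have ypos: "ip y y > 0"
  proof (rule ccontr)
    assume "\<not> ?thesis"
    then have y0: "ip y y = 0" using ip_nonneg[OF y] by simp
    have b: "(ip (T (f (r n))) (f (r n)))\<^sup>2 \<le> ip (\<lambda>x. T (f (r n)) x - y x) (\<lambda>x. T (f (r n)) x - y x)" for n
    proof -
      have eq: "ip (\<lambda>x. T (f (r n)) x - y x) (f (r n)) = ip (T (f (r n))) (f (r n))"
        using fV TfV y null_ip[OF y fV y0] by (simp add: ip_diff)
      have "(ip (T (f (r n))) (f (r n)))\<^sup>2 \<le> ip (\<lambda>x. T (f (r n)) x - y x) (\<lambda>x. T (f (r n)) x - y x) * ip (f (r n)) (f (r n))"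
        using cauchy_schwarz[OF diff_in[OF TfV[of "r n"] y] fV[of "r n"]] unfolding eq .
      also have "\<dots> \<le> ip (\<lambda>x. T (f (r n)) x - y x) (\<lambda>x. T (f (r n)) x - y x) * 1"
        using f1 fV TfV y by (intro mult_left_mono ip_nonneg diff_in) auto
      finally show ?thesis by simp
    qed
    have "(\<lambda>n. (ip (T (f (r n))) (f (r n)))\<^sup>2) \<longlonglongrightarrow> m\<^sup>2" by (intro tendsto_intros ql)
    from LIMSEQ_le[OF this lim] b have "m\<^sup>2 \<le> 0" by auto
    then show False using mpos by simp
  qed
  define a where "a = 1 / sqrt (ip y y)"
  have a2: "a * (a * ip y y) = 1" using ypos
    by (simp add: a_def flip: mult.assoc real_sqrt_mult power2_eq_square)
  show thesis
  proof (rule that[of m "\<lambda>x. a * y x"])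
    show "eigv T m (\<lambda>x. a * y x)" unfolding eigv_def
      using y yev T_lin[of y y _ a 0] by (simp add: scale_in ip_scale)
    show "ip (\<lambda>x. a * y x) (\<lambda>x. a * y x) = 1" using y a2 by (simp add: scale_in ip_scale ip_scale2)
    show "ip (\<lambda>x. a * y x) (e i) = 0" if "i \<in> I" for i
      using y yW[OF that] eV[OF that] by (simp add: ip_scale)
    show "ip (T f) f \<le> m * ip f f" if "f \<in> V" "\<And>i. i \<in> I \<Longrightarrow> ip f (e i) = 0" for f
      using le_m that by (simp add: W_def)
  qed (rule mpos)
qed

text \<open>The images of orthonormal eigenvectors with eigenvalues at least \<mu> have squared
  mutual distance at least 2 \<mu>^2, so no sequence of them can approach a limit. Two images within
  squared distance \<mu>^2 / 4 of the limit would be at squared distance below \<mu>^2.\<close>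

lemma no_large_eigenvalues:
  fixes e :: "nat \<Rightarrow> 'a \<Rightarrow> real"
  assumes ev: "\<And>n. eigv T (lam n) (e n)" and on: "\<And>i j. ip (e i) (e j) = (if i = j then 1 else 0)"
    and "\<mu> > 0" and large: "\<And>n. lam n \<ge> \<mu>"
  shows False
proof -
  have eV: "e n \<in> V" for n using ev by (simp add: eigv_def)
  obtain r y where r: "strict_mono (r :: nat \<Rightarrow> nat)" and y: "y \<in> V"
    and lim: "(\<lambda>n. ip (\<lambda>x. T (e (r n)) x - y x) (\<lambda>x. T (e (r n)) x - y x)) \<longlonglongrightarrow> 0"
    using T_compact[of e 1] eV on by auto
  let ?D = "\<lambda>n. ip (\<lambda>x. T (e (r n)) x - y x) (\<lambda>x. T (e (r n)) x - y x)"
  have "\<forall>\<^sub>F n in sequentially. ?D n < \<mu>\<^sup>2 / 4" using lim \<open>\<mu> > 0\<close> by (intro order_tendstoD) auto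
  then obtain N where N: "\<And>n. n \<ge> N \<Longrightarrow> ?D n < \<mu>\<^sup>2 / 4" by (auto simp: eventually_sequentially)
  define f where "f = T (e (r N))"
  define g where "g = T (e (r (Suc N)))"
  have fg: "f \<in> V" "g \<in> V" using eV T_in by (simp_all add: f_def g_def)
  have ne: "r N \<noteq> r (Suc N)" using r by (metis n_not_Suc_n strict_mono_eq)
  have T1: "ip (T (e i)) (T (e j)) = lam i * lam j * (if i = j then 1 else 0)" for i j
    using ev[of i] ev[of j] eV T_in on[of j i] ip_sym[of "e i" "T (e j)"] 
    by (auto simp: eigv_def)
  have "ip (\<lambda>x. f x - g x) (\<lambda>x. f x - g x) = (lam (r N))\<^sup>2 + (lam (r (Suc N)))\<^sup>2"
    using fg ne by (simp add: ip_diff_self) (simp add: f_def g_def T1 power2_eq_square)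
  moreover have "(lam (r N))\<^sup>2 \<ge> \<mu>\<^sup>2" "(lam (r (Suc N)))\<^sup>2 \<ge> \<mu>\<^sup>2"
    using large \<open>\<mu> > 0\<close> by (auto intro!: power_mono)
  ultimately have 1: "ip (\<lambda>x. f x - g x) (\<lambda>x. f x - g x) \<ge> 2 * \<mu>\<^sup>2" by simp
  have "ip (\<lambda>x. y x - g x) (\<lambda>x. y x - g x) = ?D (Suc N)"
    using fg y by (simp add: g_def[symmetric] ip_diff_self ip_sym[of y g])
  then have "ip (\<lambda>x. f x - g x) (\<lambda>x. f x - g x) \<le> 2 * ?D N + 2 * ?D (Suc N)"
    using ip_diff_le[OF fg(1) y fg(2)] by (simp add: f_def)
  also have "\<dots> < 2 * (\<mu>\<^sup>2 / 4) + 2 * (\<mu>\<^sup>2 / 4)" using N[of N] N[of "Suc N"] by simp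
  finally have "ip (\<lambda>x. f x - g x) (\<lambda>x. f x - g x) < \<mu>\<^sup>2" by simp
  then show False using 1 by (smt (verit) zero_le_power2)
qed

lemma eigsys_pos:
  assumes "eigsys T J lam e" "j \<in> J"
  shows "lam j > 0" "e j \<in> V" "eigv T (lam j) (e j)" "ip (T (e j)) (e j) = lam j"
proof -
  have ev: "eigv T (lam j) (e j)" "lam j \<noteq> 0" "ip (e j) (e j) = 1"
    using assms by (auto simp: eigsys_def)
  then show "lam j > 0" using eigv_nonneg[OF ev(1)] by simp
  show "e j \<in> V" "ip (T (e j)) (e j) = lam j" "eigv T (lam j) (e j)" using ev by (auto simp: eigv_def)
qed

text \<open>The maximum of the form on the complement of \<open>F\<close> is attained at an
  eigenvector \<open>g\<close> with eigenvalue \<open>m\<close>. If \<open>m > c\<close>, no index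
  outside \<open>F\<close> carries the eigenvalue \<open>m\<close>, so \<open>g\<close> is
  orthogonal to every listed eigenvector for \<open>m\<close>, and the completeness clause would
  make it null.\<close>

lemma eigsys_remainder:
  assumes es: "eigsys T J lam e" and "F \<subseteq> J" "c \<ge> 0"
    and c: "\<And>j. j \<in> J - F \<Longrightarrow> lam j \<le> c"
    and f: "f \<in> V" "\<And>j. j \<in> F \<Longrightarrow> ip f (e j) = 0"
  shows "ip (T f) f \<le> c * ip f f"
proof (cases "ip (T f) f > 0")
  case False
  have "0 \<le> c * ip f f" using \<open>c \<ge> 0\<close> ip_nonneg f by simp
  then show ?thesis using False by simp
next
  case True
  have ev: "eigv T (lam j) (e j)" if "j \<in> F" for j using es that \<open>F \<subseteq> J\<close> by (auto simp: eigsys_def)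
  obtain m g where m: "m > 0" and g: "eigv T m g" "ip g g = 1" "\<And>i. i \<in> F \<Longrightarrow> ip g (e i) = 0"
    and max: "\<And>f. f \<in> V \<Longrightarrow> (\<And>i. i \<in> F \<Longrightarrow> ip f (e i) = 0) \<Longrightarrow> ip (T f) f \<le> m * ip f f"
    using max_eigenvector[of F lam e f, OF ev f True] by blast
  have "m \<le> c"
  proof (rule ccontr)
    assume "\<not> m \<le> c"
    then have "\<forall>j\<in>J. lam j = m \<longrightarrow> ip g (e j) = 0" using c g(3) by (metis DiffI)
    then have "ip g g = 0" using es m g(1) unfolding eigsys_def by (metis less_numeral_extra(3))
    then show False using g(2) by simp
  qed
  then have "m * ip f f \<le> c * ip f f" using ip_nonneg f by (intro mult_right_mono) auto
  then show ?thesis using max[OF f] by simp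
qed

text \<open>The spectral expansion of the quadratic form, cut off after finitely many terms:
  \<open>F\<close> contains every eigenvalue above \<open>c\<close>, cross terms vanish because
  \<open>F\<close> spans an invariant subspace, and the remainder \<open>w\<close> contributes at
  most \<open>c * ip u u\<close>. The summand 1 in \<open>c\<close> only guards against
  \<open>ip u u = 0\<close>.\<close>

lemma eigsys_expansion:
  assumes es: "eigsys T J lam e" and u: "u \<in> V" and "\<epsilon> > 0"
  obtains F where "finite F" "F \<subseteq> J" "ip (T u) u \<le> (\<Sum>j\<in>F. lam j * (ip u (e j))\<^sup>2) + \<epsilon>"
proof -
  define c where "c = \<epsilon> / (ip u u + 1)"
  have uu: "ip u u \<ge> 0" using ip_nonneg u by simp
  then have c: "c > 0" using \<open>\<epsilon> > 0\<close> by (simp add: c_def)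
  have cu: "c * ip u u \<le> \<epsilon>" using uu \<open>\<epsilon> > 0\<close> by (simp add: c_def field_simps)
  have "\<exists>F. finite F \<and> F \<subseteq> J \<and> (\<forall>j\<in>J - F. lam j \<le> c)"
  proof (cases "finite J")
    case True then show ?thesis by (intro exI[of _ J]) auto
  next
    case False
    then have J: "J = {1..}" using es by (auto simp: eigsys_def)
    have "\<exists>N\<ge>1. lam N < c"
    proof (rule ccontr)
      assume n: "\<not> ?thesis"
      show False
      proof (rule no_large_eigenvalues[of "\<lambda>n. lam (Suc n)" "\<lambda>n. e (Suc n)" c])
        show "eigv T (lam (Suc n)) (e (Suc n))" for n using es J by (auto simp: eigsys_def)
        show "ip (e (Suc i)) (e (Suc j)) = (if i = j then 1 else 0)" for i j
          using es J by (auto simp: eigsys_def)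
        show "lam (Suc n) \<ge> c" for n using n by (metis le_add1 not_less plus_1_eq_Suc)
      qed (rule c)
    qed
    then obtain N where N: "N \<ge> 1" "lam N < c" by auto
    have "lam j \<le> c" if "j \<ge> N" for j
    proof -
      have "\<bar>lam j\<bar> \<le> \<bar>lam N\<bar>" using es that N J by (auto simp: eigsys_def)
      moreover have "lam N > 0" using eigsys_pos(1)[OF es, of N] J N by simp
      ultimately show ?thesis using N by linarith
    qed
    then show ?thesis using J by (intro exI[of _ "{1..N}"]) auto
  qed
  then obtain F where F: "finite F" "F \<subseteq> J" and Fc: "\<And>j. j \<in> J - F \<Longrightarrow> lam j \<le> c" by auto
  have eV: "e j \<in> V" if "j \<in> F" for j using eigsys_pos(2)[OF es] F that by auto
  have on: "ip (e i) (e j) = (if i = j then 1 else 0)" if "i \<in> F" "j \<in> F" for i j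
    using es subsetD[OF F(2)] that unfolding eigsys_def by blast
  define s where "s = (\<lambda>x. \<Sum>j\<in>F. ip u (e j) * e j x)"
  define w where "w = (\<lambda>x. u x - s x)"
  have s: "s \<in> V" unfolding s_def by (intro sum_in F eV)
  have w: "w \<in> V" unfolding w_def by (intro diff_in s u)
  have su: "ip s v = (\<Sum>j\<in>F. ip u (e j) * ip (e j) v)" if "v \<in> V" for v
    unfolding s_def using F eV that by (simp add: ip_sum)
  have se: "ip s (e i) = ip u (e i)" if "i \<in> F" for i
  proof -
    have "ip s (e i) = (\<Sum>j\<in>F. if j = i then ip u (e i) else 0)"
      unfolding su[OF eV[OF that]] using on that by (intro sum.cong) auto
    then show ?thesis using that F by simp
  qed
  have we: "ip w (e i) = 0" if "i \<in> F" for i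
    using se[OF that] eV[OF that] u s by (simp add: w_def ip_diff)
  have es': "ip (e i) s = ip u (e i)" "ip (e i) w = 0" if "i \<in> F" for i
    using se[OF that] we[OF that] ip_sym[OF eV[OF that]] s w by simp_all
  have ws: "ip s w = 0" using su[OF w] es' by simp
  have Tes: "ip (T (e j)) v = lam j * ip (e j) v" if "j \<in> F" "v \<in> V" for j v
    using eigsys_pos(3)[OF es] that F by (auto simp: eigv_def)
  have Ts: "ip (T s) v = (\<Sum>j\<in>F. ip u (e j) * (lam j * ip (e j) v))" if v: "v \<in> V" for v
  proof -
    have "ip (T s) v = ip s (T v)" using T_sym s v by simp
    also have "\<dots> = (\<Sum>j\<in>F. ip u (e j) * ip (T (e j)) v)"
      using su[OF T_in[OF v]] T_sym eV v by simp
    finally show ?thesis using Tes v by simp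
  qed
  have Tsw: "ip (T s) w = 0" using Ts[OF w] es' by simp
  have Tss: "ip (T s) s = (\<Sum>j\<in>F. lam j * (ip u (e j))\<^sup>2)"
    using Ts[OF s] es' by (simp add: power2_eq_square algebra_simps)
  have u_eq: "u = (\<lambda>x. 1 * s x + 1 * w x)" by (simp add: w_def)
  have Tu: "ip (T u) v = ip (T s) v + ip (T w) v" if "v \<in> V" for v
    using T_lin[OF s w that, of 1 1] u_eq by simp
  have up: "ip v u = ip v s + ip v w" if "v \<in> V" for v
    using ip_lin2[OF s w that, of 1 1] u_eq by simp
  have "ip (T w) s = ip (T s) w" using T_sym w s ip_sym T_in by metis
  then have Tuu: "ip (T u) u = (\<Sum>j\<in>F. lam j * (ip u (e j))\<^sup>2) + ip (T w) w"
    using Tu[OF s] Tu[OF w] up[OF T_in[OF u]] Tss Tsw by simp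
  have "ip u u = ip s s + ip w w"
    using up[OF s] up[OF w] up[OF u] ip_sym[OF w s] ip_sym[OF u s] ip_sym[OF u w] ws by simp
  then have "ip w w \<le> ip u u" using ip_nonneg[OF s] by simp
  moreover have "ip (T w) w \<le> c * ip w w"
    using eigsys_remainder[OF es F(2) _ Fc w we] c by simp
  ultimately have "ip (T w) w \<le> c * ip u u" using c by (smt (verit) mult_left_mono)
  then show thesis using that F Tuu cu by simp
qed

text \<open>Expand each \<open>ip (T (u i)) (u i)\<close> along the eigenvectors, exchange the sums
  and use that the squared coefficients of one unit vector \<open>e j\<close> along the system
  \<open>u\<close> add up to at most 1. The errors \<open>d\<close> are chosen so that all of them
  together stay below \<epsilon>.\<close>

lemma trace_le_sum_eigenvalues:
  assumes es: "eigsys T J lam e" and "finite I" and u: "\<And>i. i \<in> I \<Longrightarrow> u i \<in> V"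
    and bessel: "\<And>g. g \<in> V \<Longrightarrow> (\<Sum>i\<in>I. (ip (u i) g)\<^sup>2) \<le> ip g g"
    and s: "\<And>F. finite F \<Longrightarrow> F \<subseteq> J \<Longrightarrow> (\<Sum>j\<in>F. lam j) \<le> s"
  shows "(\<Sum>i\<in>I. ip (T (u i)) (u i)) \<le> s"
proof (rule field_le_epsilon)
  fix \<epsilon> :: real assume \<epsilon>: "\<epsilon> > 0"
  define d where "d = \<epsilon> / (real (card I) + 1)"
  have d: "d > 0" "real (card I) * d \<le> \<epsilon>" using \<epsilon> by (auto simp: d_def field_simps)
  have "\<exists>F. finite F \<and> F \<subseteq> J \<and> ip (T (u i)) (u i) \<le> (\<Sum>j\<in>F. lam j * (ip (u i) (e j))\<^sup>2) + d"
    if "i \<in> I" for i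
    using eigsys_expansion[OF es u[OF that] d(1)] by metis
  then obtain F where F: "\<And>i. i \<in> I \<Longrightarrow> finite (F i)" "\<And>i. i \<in> I \<Longrightarrow> F i \<subseteq> J"
    and b: "\<And>i. i \<in> I \<Longrightarrow> ip (T (u i)) (u i) \<le> (\<Sum>j\<in>F i. lam j * (ip (u i) (e j))\<^sup>2) + d"
    by metis
  define G where "G = (\<Union>i\<in>I. F i)"
  have G: "finite G" "G \<subseteq> J" using F \<open>finite I\<close> by (auto simp: G_def)
  have lam: "lam j > 0" if "j \<in> G" for j using eigsys_pos(1)[OF es] that G by auto
  have "(\<Sum>i\<in>I. ip (T (u i)) (u i)) \<le> (\<Sum>i\<in>I. (\<Sum>j\<in>G. lam j * (ip (u i) (e j))\<^sup>2) + d)"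
  proof (rule sum_mono)
    fix i assume i: "i \<in> I"
    have "(\<Sum>j\<in>F i. lam j * (ip (u i) (e j))\<^sup>2) \<le> (\<Sum>j\<in>G. lam j * (ip (u i) (e j))\<^sup>2)"
      using G i lam by (intro sum_mono2) (auto simp: G_def less_imp_le)
    then show "ip (T (u i)) (u i) \<le> (\<Sum>j\<in>G. lam j * (ip (u i) (e j))\<^sup>2) + d"
      using b[OF i] by simp
  qed
  also have "\<dots> = (\<Sum>j\<in>G. lam j * (\<Sum>i\<in>I. (ip (u i) (e j))\<^sup>2)) + real (card I) * d"
    by (simp add: sum.distrib sum_distrib_left) (rule sum.swap)
  also have "\<dots> \<le> (\<Sum>j\<in>G. lam j * 1) + \<epsilon>"
  proof (intro add_mono sum_mono mult_left_mono d)
    fix j assume j: "j \<in> G"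
    have "ip (e j) (e j) = 1" "e j \<in> V" using es j G eigsys_pos(2)[OF es, of j] by (auto simp: eigsys_def)
    then show "(\<Sum>i\<in>I. (ip (u i) (e j))\<^sup>2) \<le> 1" using bessel[of "e j"] by simp
    show "0 \<le> lam j" using lam[OF j] by simp
  qed
  also have "\<dots> \<le> s + \<epsilon>" using s[OF G] by simp
  finally show "(\<Sum>i\<in>I. ip (T (u i)) (u i)) \<le> s + \<epsilon>" .
qed

text \<open>Greedy construction: each stage picks a unit eigenvector that maximises the form on the
  complement of those already picked, which also sorts the eigenvalues. An eigenvector orthogonal to
  all of them is impossible. If the construction never stops, its eigenvalue would be a positive
  lower bound for all the others; if it stops after \<open>N\<close> stages, one more stage could
  have been carried out.\<close>

lemma eigsys_exists: "\<exists>J lam e. eigsys T J lam e"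
proof -
  define good where "good = (\<lambda>(S :: (real \<times> ('a \<Rightarrow> real)) set) (p :: real \<times> ('a \<Rightarrow> real)). fst p > 0 \<and> eigv T (fst p) (snd p) \<and> ip (snd p) (snd p) = 1
     \<and> (\<forall>q\<in>S. ip (snd p) (snd q) = 0) \<and>
     (\<forall>f\<in>V. (\<forall>q\<in>S. ip f (snd q) = 0) \<longrightarrow> ip (T f) f \<le> fst p * ip f f))"
  define pick where "pick = (\<lambda>S. SOME p. good S p)"
  define S where "S = rec_nat {} (\<lambda>_ S. insert (pick S) S)"
  have S0: "S 0 = {}" and SS: "S (Suc n) = insert (pick (S n)) (S n)" for n by (simp_all add: S_def)
  have S_eq: "S n = (\<lambda>i. pick (S i)) ` {..<n}" for n
    by (induction n) (simp_all add: S0 SS lessThan_Suc)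
  \<comment> \<open>Stages are counted from 0 and eigenvalues from 1, hence \<open>n - 1\<close>
    below. Requiring success at all earlier stages makes the index set an initial segment.\<close>
  define J0 where "J0 = {n. \<forall>i\<le>n. \<exists>p. good (S i) p}"
  define lam where "lam = (\<lambda>n. fst (pick (S (n - 1))))"
  define e where "e = (\<lambda>n. snd (pick (S (n - 1))))"
  have g: "good (S n) (lam (Suc n), e (Suc n))" if "n \<in> J0" for n
    using that someI_ex[of "good (S n)"] by (auto simp: J0_def lam_def e_def pick_def)
  have S_eq': "S n = (\<lambda>i. (lam (Suc i), e (Suc i))) ` {..<n}" for n
    by (subst S_eq) (simp add: lam_def e_def)
  define J where "J = Suc ` J0"
  have gJ: "lam j > 0" "eigv T (lam j) (e j)" "ip (e j) (e j) = 1" if "j \<in> J" for j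
    using that g by (auto simp: J_def good_def)
  have ortho: "ip (e j) (e i) = 0" if "j \<in> J" "1 \<le> i" "i < j" for i j
  proof -
    from that(1) obtain j' where j: "j = Suc j'" "j' \<in> J0" by (auto simp: J_def)
    from that(2) obtain i' where i: "i = Suc i'" by (cases i) auto
    have "(lam i, e i) \<in> S j'" unfolding S_eq' using that(3) i j by simp
    then show ?thesis using g[OF j(2)] unfolding good_def fst_conv snd_conv j(1) by fastforce
  qed
  have mx: "ip (T f) f \<le> lam j * ip f f" if "j \<in> J" "f \<in> V" "\<And>i. 1 \<le> i \<Longrightarrow> i < j \<Longrightarrow> ip f (e i) = 0" for j f
  proof -
    from that(1) obtain i where i: "j = Suc i" "i \<in> J0" by (auto simp: J_def)
    have "\<forall>q\<in>S i. ip f (snd q) = 0" unfolding S_eq' using that(3) i by simp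
    then show ?thesis using g[OF i(2)] that(2) unfolding good_def fst_conv snd_conv i(1) by blast
  qed
  have down: "i \<in> J" if "j \<in> J" "1 \<le> i" "i \<le> j" for i j
  proof -
    from that obtain i' j' where "i = Suc i'" "j = Suc j'" "j' \<in> J0" by (cases i) (auto simp: J_def)
    then show ?thesis using that by (auto simp: J_def J0_def)
  qed
  have eV: "e j \<in> V" if "j \<in> J" for j using gJ(2)[OF that] by (simp add: eigv_def)
  have on: "ip (e i) (e j) = (if i = j then 1 else 0)" if ij: "i \<in> J" "j \<in> J" for i j
  proof -
    have "1 \<le> i" "1 \<le> j" using ij by (auto simp: J_def)
    then show ?thesis using ij gJ(3) ortho[of i j] ortho[of j i] eV ip_sym[of "e i" "e j"]
      by (cases i j rule: linorder_cases) auto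
  qed
  have J1: "1 \<le> j" if "j \<in> J" for j using that by (auto simp: J_def)
  have J_cases: "J = {1..} \<or> (\<exists>N. J = {1..N} \<and> Suc N \<notin> J)"
  proof (cases "\<forall>j\<ge>1. j \<in> J")
    case True then show ?thesis using J1 by auto
  next
    case False
    define N where "N = (LEAST n. Suc n \<notin> J)"
    have "\<exists>n. Suc n \<notin> J" using False by (metis One_nat_def Suc_le_D)
    then have N: "Suc N \<notin> J" unfolding N_def by (rule LeastI_ex)
    have "Suc n \<in> J" if "n < N" for n using not_less_Least[of n "\<lambda>n. Suc n \<notin> J"] that by (auto simp: N_def)
    then have "{1..N} \<subseteq> J"
      by (metis One_nat_def Suc_le_D Suc_le_lessD atLeastAtMost_iff subsetI)
    moreover have "j \<le> N" if "j \<in> J" for j using down[OF that, of "Suc N"] N by (rule_tac ccontr) simp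
    ultimately show ?thesis using N J1 by (intro disjI2 exI[of _ N]) auto
  qed
  have "eigsys T J lam e" unfolding eigsys_def
  proof (intro conjI ballI allI impI)
    show "J = {1..} \<or> (\<exists>N. J = {1..N})" using J_cases by auto
    show "lam j \<noteq> 0" "eigv T (lam j) (e j)" if "j \<in> J" for j using gJ that by fastforce+
    show "ip (e i) (e j) = (if i = j then 1 else 0)" if "i \<in> J" "j \<in> J" for i j using on that by blast
    show "\<bar>lam j\<bar> \<le> \<bar>lam i\<bar>" if ij: "i \<in> J" "j \<in> J" "i \<le> j" for i j
    proof -
      have "ip (T (e j)) (e j) \<le> lam i * ip (e j) (e j)"
        using mx[OF ij(1) eV[OF ij(2)]] ortho[OF ij(2)] ij(3) by simp
      then have "lam j \<le> lam i" using gJ(2,3)[OF ij(2)] by (simp add: eigv_def)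
      then show ?thesis using gJ(1)[OF ij(1)] gJ(1)[OF ij(2)] by simp
    qed
    fix \<mu> f
    assume "\<mu> \<noteq> 0 \<and> eigv T \<mu> f \<and> (\<forall>j\<in>J. lam j = \<mu> \<longrightarrow> ip f (e j) = 0)"
    then have \<mu>: "\<mu> \<noteq> 0" and f: "eigv T \<mu> f" and "\<And>j. j \<in> J \<Longrightarrow> lam j = \<mu> \<Longrightarrow> ip f (e j) = 0" by auto
    then have fo: "ip f (e j) = 0" if "j \<in> J" for j using eigv_ortho[OF f gJ(2)[OF that]] that by metis
    have fV: "f \<in> V" using f by (simp add: eigv_def)
    show "ip f f = 0"
    proof (rule ccontr)
      assume "ip f f \<noteq> 0"
      then have ff: "ip f f > 0" using ip_nonneg[OF fV] by simp
      then have \<mu>0: "\<mu> > 0" using eigv_nonneg[OF f] \<mu> by simp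
      have Tf: "ip (T f) f = \<mu> * ip f f" using f fV by (simp add: eigv_def)
      consider "J = {1..}" | N where "J = {1..N}" "Suc N \<notin> J" using J_cases by auto
      then show False
      proof cases
        case 1
        have "\<mu> \<le> lam j" if "j \<in> J" for j
        proof -
          have "ip (T f) f \<le> lam j * ip f f" using mx[OF that fV] fo 1 by simp
          then show ?thesis using Tf ff by simp
        qed
        then show False
          using no_large_eigenvalues[of "\<lambda>n. lam (Suc n)" "\<lambda>n. e (Suc n)" \<mu>] gJ(2) on \<mu>0 1 by auto
      next
        case (2 N)
        have "\<exists>p. good (S N) p"
        proof -
          have "\<And>i. i \<in> J \<Longrightarrow> eigv T (lam i) (e i)" using gJ by simp
          then obtain m h where "m > 0" "eigv T m h" "ip h h = 1" "\<And>i. i \<in> J \<Longrightarrow> ip h (e i) = 0"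
            "\<And>f. f \<in> V \<Longrightarrow> (\<And>i. i \<in> J \<Longrightarrow> ip f (e i) = 0) \<Longrightarrow> ip (T f) f \<le> m * ip f f"
            using max_eigenvector[of J lam e f] fV fo Tf ff \<mu>0 by (metis mult_pos_pos)
          moreover have "S N = (\<lambda>i. (lam i, e i)) ` J"
            unfolding S_eq' 2(1) image_Suc_lessThan[symmetric] image_image ..
          ultimately have "good (S N) (m, h)" by (simp add: good_def)
          then show ?thesis by blast
        qed
        moreover have "\<exists>p. good (S i) p" if "i < N" for i
        proof -
          have "Suc i \<in> J" using that 2 by simp
          then show ?thesis by (auto simp: J_def J0_def)
        qed
        ultimately have "N \<in> J0" by (auto simp: J0_def le_less)
        then have "Suc N \<in> J" unfolding J_def by (rule imageI)
        then show False using 2(2) by simp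
      qed
    qed
  qed
  then show ?thesis by blast
qed

section \<open>Eigensystems of the operator and of its square\<close>

context
  fixes S :: "('a \<Rightarrow> real) \<Rightarrow> ('a \<Rightarrow> real)"
  assumes S: "\<And>f u. f \<in> V \<Longrightarrow> u \<in> V \<Longrightarrow> ip (S f) u = ip (T (T f)) u"
begin

lemma eigv_square: "eigv T \<mu> f \<Longrightarrow> eigv S (\<mu>\<^sup>2) f"
  using T_sym T_in S unfolding eigv_def power2_eq_square by (metis mult.assoc)

text \<open>Factor T^2 - \<mu> into (T + sqrt \<mu>)(T - sqrt \<mu>). The vector w = (T - sqrt
  \<mu>) f satisfies T w = - sqrt \<mu> w, which a non-negative operator allows only for null w or
  \<mu> = 0; in the latter case w = T f, whose squared norm is \<mu> |f|^2 = 0.\<close>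

lemma eigv_sqrt:
  assumes f: "eigv S \<mu> f" and "ip f f > 0"
  shows "\<mu> \<ge> 0" "eigv T (sqrt \<mu>) f"
proof -
  have fV: "f \<in> V" using f by (simp add: eigv_def)
  have "\<mu> * ip f f = ip (T f) (T f)" using f fV S T_sym T_in by (simp add: eigv_def)
  also have "\<dots> \<ge> 0" by (intro ip_nonneg T_in fV)
  finally show \<mu>: "\<mu> \<ge> 0" using assms(2) by (simp add: zero_le_mult_iff)
  define w where "w = (\<lambda>x. T f x - sqrt \<mu> * f x)"
  have w: "w \<in> V" unfolding w_def by (intro diff_in scale_in T_in fV)
  have wu: "ip w u = ip (T f) u - sqrt \<mu> * ip f u" if "u \<in> V" for u
    unfolding w_def using that fV by (simp add: ip_diff T_in scale_in ip_scale)
  have Tw: "ip (T w) u = - sqrt \<mu> * ip w u" if u: "u \<in> V" for u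
  proof -
    have "ip (T w) u = ip (T (T f)) u - sqrt \<mu> * ip (T f) u"
      using T_lin[of "T f" f u 1 "- sqrt \<mu>"] fV T_in u by (simp add: w_def)
    also have "ip (T (T f)) u = sqrt \<mu> * sqrt \<mu> * ip f u" using f S fV u \<mu> by (simp add: eigv_def)
    finally show ?thesis unfolding wu[OF u] by (simp only: algebra_simps)
  qed
  have "ip w w = 0"
  proof (rule ccontr)
    assume "ip w w \<noteq> 0"
    then have "ip w w > 0" using ip_nonneg[OF w] by simp
    moreover have "eigv T (- sqrt \<mu>) w" using Tw w by (simp add: eigv_def)
    ultimately have "sqrt \<mu> = 0" using eigv_nonneg \<mu> by fastforce
    then have "ip w w = ip (T f) (T f)" "\<mu> = 0" by (simp_all add: w_def)
    then show False using \<open>\<mu> * ip f f = ip (T f) (T f)\<close> \<open>ip w w \<noteq> 0\<close> by simp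
  qed
  then show "eigv T (sqrt \<mu>) f" using eigv_iff_null[of f T, OF fV T_in[OF fV]] by (simp add: w_def)
qed

lemma eigsys_square:
  assumes "eigsys T J lam e"
  shows "eigsys S J (\<lambda>j. (lam j)\<^sup>2) e"
  unfolding eigsys_def
proof (intro conjI ballI allI impI)
  show "\<bar>(lam j)\<^sup>2\<bar> \<le> \<bar>(lam i)\<^sup>2\<bar>" if "i \<in> J" "j \<in> J" "i \<le> j" for i j
    using assms that by (auto simp: eigsys_def abs_le_square_iff)
  show "eigv S ((lam j)\<^sup>2) (e j)" if "j \<in> J" for j using eigv_square assms that by (auto simp: eigsys_def)
  fix \<mu> f assume *: "\<mu> \<noteq> 0 \<and> eigv S \<mu> f \<and> (\<forall>j\<in>J. (lam j)\<^sup>2 = \<mu> \<longrightarrow> ip f (e j) = 0)"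
  have fV: "f \<in> V" using * by (simp add: eigv_def)
  show "ip f f = 0"
  proof (rule ccontr)
    assume n: "ip f f \<noteq> 0"
    then have "ip f f > 0" using ip_nonneg[OF fV] by simp
    then have "\<mu> \<ge> 0" "eigv T (sqrt \<mu>) f" using eigv_sqrt * by blast+
    moreover have "\<forall>j\<in>J. lam j = sqrt \<mu> \<longrightarrow> ip f (e j) = 0" using * \<open>\<mu> \<ge> 0\<close> by auto
    ultimately have "ip f f = 0" using assms * unfolding eigsys_def by (metis real_sqrt_eq_zero_cancel_iff)
    then show False using n by simp
  qed
qed (use assms in \<open>auto simp: eigsys_def\<close>)

text \<open>The eigenvectors of the square are eigenvectors of \<open>T\<close> itself, so the
  singular values of \<open>T\<close>, listed from any eigensystem of the square, form an
  eigensystem of \<open>T\<close> without any rearrangement.\<close>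

lemma eigsys_sqrt:
  assumes "eigsys S J mu e"
  shows "eigsys T J (\<lambda>j. sqrt (mu j)) e"
  unfolding eigsys_def
proof (intro conjI ballI allI impI)
  have ev: "eigv S (mu j) (e j)" "ip (e j) (e j) > 0" "mu j \<noteq> 0" if "j \<in> J" for j
    using assms that by (auto simp: eigsys_def)
  show "eigv T (sqrt (mu j)) (e j)" if "j \<in> J" for j using eigv_sqrt(2) ev that by blast
  have pos: "mu j > 0" if "j \<in> J" for j using eigv_sqrt(1) ev[OF that] by fastforce
  show "\<bar>sqrt (mu j)\<bar> \<le> \<bar>sqrt (mu i)\<bar>" if "i \<in> J" "j \<in> J" "i \<le> j" for i j
  proof -
    have "\<bar>mu j\<bar> \<le> \<bar>mu i\<bar>" using assms that unfolding eigsys_def by blast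
    then show ?thesis using pos[OF that(1)] pos[OF that(2)] by simp
  qed
  fix \<mu> f assume *: "\<mu> \<noteq> 0 \<and> eigv T \<mu> f \<and> (\<forall>j\<in>J. sqrt (mu j) = \<mu> \<longrightarrow> ip f (e j) = 0)"
  have fV: "f \<in> V" using * by (simp add: eigv_def)
  show "ip f f = 0"
  proof (rule ccontr)
    assume n: "ip f f \<noteq> 0"
    then have "ip f f > 0" using ip_nonneg[OF fV] by simp
    then have "\<mu> \<ge> 0" using eigv_nonneg * by blast
    then have "\<forall>j\<in>J. mu j = \<mu>\<^sup>2 \<longrightarrow> ip f (e j) = 0" using * by auto
    moreover have "eigv S (\<mu>\<^sup>2) f" using eigv_square * by blast
    ultimately have "ip f f = 0" using assms * unfolding eigsys_def by (metis zero_eq_power2)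
    then show False using n by simp
  qed
qed (use assms in \<open>auto simp: eigsys_def\<close>)

end

end

section \<open>Iterated partial derivatives\<close>

text \<open>The mean value theorem, applied first along \<open>v\<close> and then along \<open>w\<close>.\<close>

lemma mixed_difference_quotient:
  fixes G Gv Gwv :: "'b::real_normed_vector \<Rightarrow> real"
  assumes "open S" "p \<in> S"
    and Gv: "\<And>x. x \<in> S \<Longrightarrow> ((\<lambda>t. G (x + t *\<^sub>R v)) has_field_derivative Gv x) (at 0)"
    and Gwv: "\<And>x. x \<in> S \<Longrightarrow> ((\<lambda>t. Gv (x + t *\<^sub>R w)) has_field_derivative Gwv x) (at 0)"
    and cont: "isCont Gwv p"
  shows "((\<lambda>t. (G (p + t *\<^sub>R v + t *\<^sub>R w) - G (p + t *\<^sub>R v) - G (p + t *\<^sub>R w) + G p) / t\<^sup>2)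
           \<longlongrightarrow> Gwv p) (at_right 0)"
proof (rule tendstoI)
  fix \<epsilon> :: real assume "\<epsilon> > 0"
  obtain d1 where d1: "d1 > 0" "\<And>x. dist x p < d1 \<Longrightarrow> x \<in> S"
    using assms(1,2) by (metis mem_ball open_contains_ball subset_iff dist_commute)
  obtain d2 where d2: "d2 > 0" "\<And>x. dist x p < d2 \<Longrightarrow> dist (Gwv x) (Gwv p) < \<epsilon>"
    using cont \<open>\<epsilon> > 0\<close> unfolding continuous_at_eps_delta by blast
  \<comment> \<open>Small enough that every corner and every intermediate point of the parallelogram
    spanned by \<open>t v\<close> and \<open>t w\<close> stays in \<open>S\<close> and in the
    continuity neighbourhood of \<open>p\<close>.\<close>
  define d where "d = min d1 d2 / (norm v + norm w + 1)"
  have nvw: "0 < norm v + norm w + 1" by (simp add: add_nonneg_pos)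
  then have d: "d > 0" using d1 d2 by (simp add: d_def)
  have near: "dist (p + s *\<^sub>R v + r *\<^sub>R w) p < min d1 d2"
    if "0 \<le> s" "s < d" "0 \<le> r" "r < d" for s r
  proof -
    have "dist (p + s *\<^sub>R v + r *\<^sub>R w) p = norm (s *\<^sub>R v + r *\<^sub>R w)" by (simp add: dist_norm add.assoc)
    also have "\<dots> \<le> s * norm v + r * norm w" using that norm_triangle_ineq[of "s *\<^sub>R v" "r *\<^sub>R w"] by simp
    also have "\<dots> \<le> d * norm v + d * norm w" using that by (intro add_mono mult_right_mono) auto
    also have "\<dots> < d * (norm v + norm w + 1)" using d by (simp add: algebra_simps)
    also have "\<dots> = min d1 d2" using nvw by (simp add: d_def)
    finally show ?thesis .
  qed
  have inS: "p + s *\<^sub>R v + r *\<^sub>R w \<in> S" if "0 \<le> s" "s < d" "0 \<le> r" "r < d" for s r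
    using near[OF that] d1(2) by simp
  have shift: "((\<lambda>s. g (y + s *\<^sub>R z)) has_real_derivative D) (at s0)"
    if "((\<lambda>t. g (y + s0 *\<^sub>R z + t *\<^sub>R z)) has_field_derivative D) (at 0)" for g :: "'b \<Rightarrow> real" and y z D s0
  proof -
    have "(\<lambda>t. g (y + (t + s0) *\<^sub>R z)) = (\<lambda>t. g (y + s0 *\<^sub>R z + t *\<^sub>R z))"
      by (simp add: scaleR_add_left add_ac)
    then show ?thesis
      using that DERIV_shift[of "\<lambda>s. g (y + s *\<^sub>R z)" D 0 s0] by simp
  qed
  show "\<forall>\<^sub>F t in at_right 0. dist ((G (p + t *\<^sub>R v + t *\<^sub>R w) - G (p + t *\<^sub>R v) - G (p + t *\<^sub>R w) + G p) / t\<^sup>2) (Gwv p) < \<epsilon>"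
    unfolding eventually_at_right_field
  proof (intro exI[of _ d] conjI allI impI d)
    fix t :: real assume t: "0 < t" "t < d"
    define \<phi> where "\<phi> = (\<lambda>s. G (p + t *\<^sub>R w + s *\<^sub>R v) - G (p + s *\<^sub>R v))"
    have "\<exists>s. 0 < s \<and> s < t \<and> \<phi> t - \<phi> 0 = (t - 0) * (Gv (p + t *\<^sub>R w + s *\<^sub>R v) - Gv (p + s *\<^sub>R v))"
    proof (rule MVT2[OF t(1)])
      fix s assume s: "0 \<le> s" "s \<le> t"
      have "((\<lambda>s. G (p + t *\<^sub>R w + s *\<^sub>R v)) has_real_derivative Gv (p + t *\<^sub>R w + s *\<^sub>R v)) (at s)"
        using inS[of s t] s t by (rule_tac shift, rule_tac Gv) (simp add: add_ac)
      moreover have "((\<lambda>s. G (p + s *\<^sub>R v)) has_real_derivative Gv (p + s *\<^sub>R v)) (at s)"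
        using inS[of s 0] s t d by (rule_tac shift, rule_tac Gv) (simp add: add_ac)
      ultimately show "(\<phi> has_real_derivative (Gv (p + t *\<^sub>R w + s *\<^sub>R v) - Gv (p + s *\<^sub>R v))) (at s)"
        unfolding \<phi>_def by (rule DERIV_diff)
    qed
    then obtain s where s: "0 < s" "s < t" "\<phi> t - \<phi> 0 = t * (Gv (p + s *\<^sub>R v + t *\<^sub>R w) - Gv (p + s *\<^sub>R v + 0 *\<^sub>R w))"
      by (auto simp: add_ac)
    have "\<exists>r. 0 < r \<and> r < t \<and> Gv (p + s *\<^sub>R v + t *\<^sub>R w) - Gv (p + s *\<^sub>R v + 0 *\<^sub>R w) = (t - 0) * Gwv (p + s *\<^sub>R v + r *\<^sub>R w)"
    proof (rule MVT2[OF t(1)])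
      fix r assume r: "0 \<le> r" "r \<le> t"
      show "((\<lambda>r. Gv (p + s *\<^sub>R v + r *\<^sub>R w)) has_real_derivative Gwv (p + s *\<^sub>R v + r *\<^sub>R w)) (at r)"
        using inS[of s r] s r t by (rule_tac shift, rule_tac Gwv) simp
    qed
    then obtain r where r: "0 < r" "r < t" "Gv (p + s *\<^sub>R v + t *\<^sub>R w) - Gv (p + s *\<^sub>R v + 0 *\<^sub>R w) = t * Gwv (p + s *\<^sub>R v + r *\<^sub>R w)"
      by auto
    have "\<phi> t - \<phi> 0 = t\<^sup>2 * Gwv (p + s *\<^sub>R v + r *\<^sub>R w)" using s r by (simp add: power2_eq_square)
    then have "(G (p + t *\<^sub>R v + t *\<^sub>R w) - G (p + t *\<^sub>R v) - G (p + t *\<^sub>R w) + G p) / t\<^sup>2 = Gwv (p + s *\<^sub>R v + r *\<^sub>R w)"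
      using t by (simp add: \<phi>_def field_simps add_ac)
    moreover have "dist (Gwv (p + s *\<^sub>R v + r *\<^sub>R w)) (Gwv p) < \<epsilon>"
      using near[of s r] s r t d2(2) by simp
    ultimately show "dist ((G (p + t *\<^sub>R v + t *\<^sub>R w) - G (p + t *\<^sub>R v) - G (p + t *\<^sub>R w) + G p) / t\<^sup>2) (Gwv p) < \<epsilon>"
      by simp
  qed
qed

lemma iter_pd_has_derivative:
  assumes "pd_exists S (v # vs) f" "x \<in> S"
  shows "((\<lambda>t. iter_pd vs f (x + t *\<^sub>R v)) has_field_derivative iter_pd (v # vs) f x) (at 0)"
  using assms by (simp add: field_differentiable_derivI DERIV_deriv_iff_field_differentiable)

lemma iter_pd_append: "iter_pd (us @ vs) f = iter_pd us (iter_pd vs f)"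
  by (induction us) auto

lemma pd_exists_append: "pd_exists S (us @ vs) f \<longleftrightarrow> pd_exists S vs f \<and> pd_exists S us (iter_pd vs f)"
  by (induction us) (auto simp: iter_pd_append)

lemma iter_pd_cong:
  assumes "open S" "\<And>x. x \<in> S \<Longrightarrow> f x = g x" "x \<in> S"
  shows "iter_pd vs f x = iter_pd vs g x"
  using assms(3)
proof (induction vs arbitrary: x)
  case (Cons v vs)
  have "\<forall>\<^sub>F t in nhds 0. x + t *\<^sub>R v \<in> S"
  proof -
    have "((\<lambda>t. x + t *\<^sub>R v) \<longlongrightarrow> x + 0 *\<^sub>R v) (nhds 0)" by (intro tendsto_intros filterlim_ident)
    from topological_tendstoD[OF this assms(1)] Cons.prems show ?thesis by simp
  qed
  then have "\<forall>\<^sub>F t in nhds 0. iter_pd vs f (x + t *\<^sub>R v) = iter_pd vs g (x + t *\<^sub>R v)"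
    by eventually_elim (rule Cons.IH)
  then show ?case by (simp add: deriv_cong_ev)
qed (use assms in auto)

text \<open>Schwarz's theorem: the second difference quotient is symmetric in \<open>v\<close> and
  \<open>w\<close>, and it converges to the mixed derivative in either order.\<close>

lemma iter_pd_swap:
  assumes "open S" "p \<in> S"
    and "pd_exists S (v # w # vs) f" "pd_exists S (w # v # vs) f"
    and "continuous_on S (iter_pd (v # w # vs) f)" "continuous_on S (iter_pd (w # v # vs) f)"
  shows "iter_pd (v # w # vs) f p = iter_pd (w # v # vs) f p"
proof -
  let ?G = "iter_pd vs f"
  have ex: "pd_exists S (v # vs) f" "pd_exists S (w # vs) f" using assms(3,4) by auto
  have ic: "isCont (iter_pd (v # w # vs) f) p" "isCont (iter_pd (w # v # vs) f) p"
    using assms by (meson continuous_on_eq_continuous_at)+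
  have 1: "((\<lambda>t. (?G (p + t *\<^sub>R v + t *\<^sub>R w) - ?G (p + t *\<^sub>R v) - ?G (p + t *\<^sub>R w) + ?G p) / t\<^sup>2)
      \<longlongrightarrow> iter_pd (w # v # vs) f p) (at_right 0)"
    using mixed_difference_quotient[OF assms(1,2) iter_pd_has_derivative[OF ex(1)] iter_pd_has_derivative[OF assms(4)] ic(2)] .
  have 2: "((\<lambda>t. (?G (p + t *\<^sub>R w + t *\<^sub>R v) - ?G (p + t *\<^sub>R w) - ?G (p + t *\<^sub>R v) + ?G p) / t\<^sup>2)
      \<longlongrightarrow> iter_pd (v # w # vs) f p) (at_right 0)"
    using mixed_difference_quotient[OF assms(1,2) iter_pd_has_derivative[OF ex(2)] iter_pd_has_derivative[OF assms(3)] ic(1)] .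
  have "?G (p + t *\<^sub>R w + t *\<^sub>R v) - ?G (p + t *\<^sub>R w) - ?G (p + t *\<^sub>R v)
     = ?G (p + t *\<^sub>R v + t *\<^sub>R w) - ?G (p + t *\<^sub>R v) - ?G (p + t *\<^sub>R w)" for t
    by (simp add: add_ac)
  with 2 have "((\<lambda>t. (?G (p + t *\<^sub>R v + t *\<^sub>R w) - ?G (p + t *\<^sub>R v) - ?G (p + t *\<^sub>R w) + ?G p) / t\<^sup>2)
      \<longlongrightarrow> iter_pd (v # w # vs) f p) (at_right 0)" by (simp only:)
  from tendsto_unique[OF _ this 1] show ?thesis by simp
qed

text \<open>Induction on the length. If the two lists begin with different directions, the tail of
  \<open>vs\<close> is reordered to begin with the head of \<open>ws\<close>, the first two
  directions are exchanged, and the new tail is reordered. The regularity assumption ranges over all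
  sub-multisets because every intermediate ordering has to be a continuous derivative.\<close>

lemma iter_pd_perm:
  assumes "open S" "mset vs = mset ws" "p \<in> S"
    and "\<And>us. set us \<subseteq> set vs \<Longrightarrow> mset us \<subseteq># mset vs \<Longrightarrow>
      pd_exists S us f \<and> continuous_on S (iter_pd us f)"
  shows "iter_pd vs f p = iter_pd ws f p"
  using assms(2-)
proof (induction "length vs" arbitrary: vs ws p rule: less_induct)
  case less
  show ?case
  proof (cases vs)
    case Nil then show ?thesis using less.prems by simp
  next
    case (Cons v vs')
    then obtain w ws' where ws: "ws = w # ws'" using less.prems(1) by (cases ws) auto
    have sub: "set us \<subseteq> set vs" if "mset us \<subseteq># mset vs" for us
      using set_mset_mono[OF that] by simp
    have ex: "pd_exists S us f \<and> continuous_on S (iter_pd us f)" if "mset us \<subseteq># mset vs" for us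
      using less.prems(3)[OF sub[OF that] that] .
    have tl: "iter_pd (x # us) f p = iter_pd (x # us') f p"
      if "mset us = mset us'" "mset (x # us) \<subseteq># mset vs" "length us < length vs" "p \<in> S" for x us us' p
    proof -
      have "iter_pd us f q = iter_pd us' f q" if q: "q \<in> S" for q
      proof (rule less.hyps[OF \<open>length us < length vs\<close> \<open>mset us = mset us'\<close> q])
        fix us'' assume "mset us'' \<subseteq># mset us"
        also have "mset us \<subseteq># mset (x # us)" by simp
        finally have "mset us'' \<subseteq># mset vs"
          using \<open>mset (x # us) \<subseteq># mset vs\<close> by (rule subset_mset.order_trans)
        then show "pd_exists S us'' f \<and> continuous_on S (iter_pd us'' f)" by (rule ex)
      qed
      from iter_pd_cong[OF assms(1) this \<open>p \<in> S\<close>, where vs = "[x]"] show ?thesis by simp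
    qed
    show ?thesis
    proof (cases "v = w")
      case True
      then show ?thesis using tl[of vs' ws' v p] less.prems Cons ws by simp
    next
      case False
      then have "w \<in># mset vs'" using less.prems(1) Cons ws by (metis insert_noteq_member mset.simps(2))
      then obtain us where us: "mset vs' = mset (w # us)" by (metis ex_mset insert_DiffM mset.simps(2))
      then have ws': "mset ws' = mset (v # us)" using less.prems(1) Cons ws by (simp add: add_mset_commute)
      have len: "length vs' = Suc (length us)" using us by (metis length_Cons size_mset)
      have "iter_pd vs f p = iter_pd (v # w # us) f p"
        unfolding Cons using us Cons less.prems(2) by (intro tl) auto
      also have "\<dots> = iter_pd (w # v # us) f p"
        using us Cons less.prems(2) by (intro iter_pd_swap[OF assms(1)] conjunct1[OF ex] conjunct2[OF ex]) (auto simp: add_mset_commute)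
      also have "\<dots> = iter_pd (w # ws') f p"
        using us Cons ws' less.prems(2) len by (intro tl) (auto simp: add_mset_commute)
      finally show ?thesis by (simp add: ws)
    qed
  qed
qed

section \<open>Positive definiteness of the derivatives of a kernel\<close>

text \<open>A jet \<open>(us, x)\<close> stands for the functional "derivative along
  \<open>us\<close> at \<open>x\<close>"; this is \<open>h\<close> with one such functional applied
  in each variable. Lists in place of multi-indices allow a single direction to be split
  off.\<close>

definition jet_kernel ::
  "(('b::real_normed_vector) \<times> 'b \<Rightarrow> real) \<Rightarrow> 'b list \<times> 'b \<Rightarrow> 'b list \<times> 'b \<Rightarrow> real" where
  "jet_kernel h p q =
     iter_pd (map (\<lambda>v. (v, 0)) (fst p) @ map (\<lambda>v. (0, v)) (fst q)) h (snd p, snd q)"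

definition jets :: "('b::euclidean_space) set \<Rightarrow> nat \<Rightarrow> ('b list \<times> 'b) set" where
  "jets \<Theta> m = {(us, x). set us \<subseteq> Basis \<and> length us \<le> m \<and> x \<in> \<Theta>}"

definition psd_on :: "'a set \<Rightarrow> ('a \<Rightarrow> 'a \<Rightarrow> real) \<Rightarrow> bool" where
  "psd_on S K \<longleftrightarrow> (\<forall>(n::nat) (c::nat \<Rightarrow> real) x. (\<forall>i<n. x i \<in> S) \<longrightarrow>
     0 \<le> (\<Sum>i<n. \<Sum>j<n. c i * K (x i) (x j) * c j))"

lemma psd_on_sum:
  assumes "psd_on S K" "finite I" "\<And>i. i \<in> I \<Longrightarrow> x i \<in> S"
  shows "0 \<le> (\<Sum>i\<in>I. \<Sum>j\<in>I. c i * K (x i) (x j) * (c j :: real))"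
proof -
  obtain b where b: "bij_betw b {..<card I} I"
    using ex_bij_betw_nat_finite[OF assms(2)] by (auto simp: atLeast0LessThan)
  have "0 \<le> (\<Sum>i<card I. \<Sum>j<card I. c (b i) * K (x (b i)) (x (b j)) * c (b j))"
    using assms(1)[unfolded psd_on_def, rule_format, of "card I" "\<lambda>i. x (b i)" "\<lambda>i. c (b i)"]
      assms(3) bij_betwE[OF b] by auto
  also have "\<dots> = (\<Sum>i\<in>I. \<Sum>j\<in>I. c i * K (x i) (x j) * c j)"
    by (simp add: sum.reindex_bij_betw[OF b, of "\<lambda>j. c (b i) * K (x (b i)) (x j) * c j" for i]
        sum.reindex_bij_betw[OF b, of "\<lambda>i. \<Sum>j\<in>I. c i * K (x i) (x j) * c j"])
  finally show ?thesis .
qed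

lemma Ckk_D:
  assumes "h \<in> Ckk k \<Theta>" "set vs \<subseteq> Basis"
    "length (filter (\<lambda>v. snd v = 0) vs) \<le> k" "length (filter (\<lambda>v. fst v = 0) vs) \<le> k"
  shows "pd_exists (\<Theta> \<times> \<Theta>) vs h" "uniformly_continuous_on (\<Theta> \<times> \<Theta>) (iter_pd vs h)"
  using assms unfolding Ckk_def by blast+

context
  fixes \<Theta> :: "(real^'d::finite) set" and h :: "(real^'d) \<times> (real^'d) \<Rightarrow> real" and k :: nat
  assumes open_\<Theta>: "open \<Theta>" and h: "h \<in> Ckk k \<Theta>"
begin

text \<open>The condition in \<open>Ckk\<close> only counts the directions in each variable. It is
  therefore inherited by every rearrangement and every part of an admissible list, which is what
  commuting derivatives requires.\<close>

lemma split_list_valid: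
  fixes us ws :: "(real^'d) list"
  assumes "set us \<subseteq> Basis" "set ws \<subseteq> Basis" "length us \<le> k" "length ws \<le> k"
    and "mset vs \<subseteq># mset (map (\<lambda>v. (v, 0)) us @ map (\<lambda>v. (0, v)) ws)"
  shows "pd_exists (\<Theta> \<times> \<Theta>) vs h" "uniformly_continuous_on (\<Theta> \<times> \<Theta>) (iter_pd vs h)"
proof -
  let ?L = "map (\<lambda>v. (v, 0)) us @ map (\<lambda>v. (0, v)) ws :: ((real^'d) \<times> (real^'d)) list"
  have "set ?L \<subseteq> Basis" using assms(1,2) by (auto simp: Basis_prod_def)
  then have 1: "set vs \<subseteq> Basis" using set_mset_mono[OF assms(5)] by (simp only: set_mset_mset)
  have nz: "v \<noteq> 0" if "v \<in> set us \<union> set ws" for v using that assms(1,2) nonzero_Basis by blast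
  have f: "filter (\<lambda>v. snd v = 0) ?L = map (\<lambda>v. (v, 0)) us" "filter (\<lambda>v. fst v = 0) ?L = map (\<lambda>v. (0, v)) ws"
    using nz by (auto simp: filter_map o_def filter_empty_conv)
  have le: "length (filter P vs) \<le> length (filter P ?L)" for P
    using size_mset_mono[OF multiset_filter_mono[OF assms(5), of P]] by (simp only: mset_filter[symmetric] size_mset)
  have "length (filter (\<lambda>v. snd v = 0) vs) \<le> k" "length (filter (\<lambda>v. fst v = 0) vs) \<le> k"
    using le[of "\<lambda>v. snd v = 0"] le[of "\<lambda>v. fst v = 0"] assms(3,4) unfolding f by simp_all
  from Ckk_D[OF h 1 this] show "pd_exists (\<Theta> \<times> \<Theta>) vs h" "uniformly_continuous_on (\<Theta> \<times> \<Theta>) (iter_pd vs h)" .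
qed

lemma split_list_perm:
  fixes us ws :: "(real^'d) list"
  assumes "set us \<subseteq> Basis" "set ws \<subseteq> Basis" "length us \<le> k" "length ws \<le> k"
    and "mset vs = mset (map (\<lambda>v. (v, 0)) us @ map (\<lambda>v. (0, v)) ws)" "p \<in> \<Theta> \<times> \<Theta>"
  shows "iter_pd vs h p = iter_pd (map (\<lambda>v. (v, 0)) us @ map (\<lambda>v. (0, v)) ws) h p"
  using open_\<Theta> assms(5,6) split_list_valid[OF assms(1-4)]
  by (intro iter_pd_perm[of "\<Theta> \<times> \<Theta>"])
     (auto intro!: open_Times uniformly_continuous_imp_continuous simp del: mset_append)

text \<open>Exchanging the variables of \<open>h\<close> exchanges them in each direction, but
  leaves the second-variable derivatives outermost; commuting derivatives restores the order used in
  \<open>jet_kernel\<close>.\<close>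

lemma jet_kernel_sym:
  assumes sym: "\<And>x y. x \<in> \<Theta> \<Longrightarrow> y \<in> \<Theta> \<Longrightarrow> h (x, y) = h (y, x)"
    and "p \<in> jets \<Theta> k" "q \<in> jets \<Theta> k"
  shows "jet_kernel h p q = jet_kernel h q p"
proof -
  obtain us x ws y where p: "p = (us, x)" and q: "q = (ws, y)" by (cases p, cases q) auto
  have us: "set us \<subseteq> Basis" "length us \<le> k" "x \<in> \<Theta>" and ws: "set ws \<subseteq> Basis" "length ws \<le> k" "y \<in> \<Theta>"
    using assms(2,3) by (auto simp: jets_def p q)
  have swap: "iter_pd vs (h \<circ> prod.swap) = iter_pd (map prod.swap vs) h \<circ> prod.swap" for vs
  proof (induction vs)
    case (Cons v vs)
    have "prod.swap (z + t *\<^sub>R v) = prod.swap z + t *\<^sub>R prod.swap v" for z t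
      by (cases z, cases v) simp
    then show ?case using Cons by (simp add: o_def)
  qed simp
  have "jet_kernel h p q = iter_pd (map (\<lambda>v. (v, 0)) us @ map (\<lambda>v. (0, v)) ws) (h \<circ> prod.swap) (x, y)"
    unfolding p q jet_kernel_def fst_conv snd_conv using us ws sym open_\<Theta>
    by (intro iter_pd_cong[of "\<Theta> \<times> \<Theta>"]) (auto intro: open_Times)
  also have "\<dots> = iter_pd (map (\<lambda>v. (0, v)) us @ map (\<lambda>v. (v, 0)) ws) h (y, x)"
    by (subst swap) (simp add: o_def)
  also have "\<dots> = jet_kernel h q p"
    unfolding p q jet_kernel_def fst_conv snd_conv using us ws by (intro split_list_perm) auto
  finally show ?thesis .
qed

text \<open>Every jet of order \<open>Suc m\<close> is replaced by a difference quotient of two jets of order \<open>m\<close>.\<close>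

lemma psd_on_jets_Suc:
  assumes m: "psd_on (jets \<Theta> m) (jet_kernel h)" "Suc m \<le> k"
  shows "psd_on (jets \<Theta> (Suc m)) (jet_kernel h)"
  unfolding psd_on_def
proof (intro allI impI)
  fix n :: nat and c :: "nat \<Rightarrow> real" and p :: "nat \<Rightarrow> (real^'d) list \<times> (real^'d)"
  assume p: "\<forall>i<n. p i \<in> jets \<Theta> (Suc m)"
  \<comment> \<open>\<open>hi\<close> marks the jets of top order; \<open>b i\<close> is the
    direction split off from such a jet and \<open>us i\<close> the rest. The quotient has weight
    \<open>1 / t\<close> at the shifted point and \<open>- 1 / t\<close> at the base point. A jet of
    lower order is kept as it is: \<open>b i = 0\<close>, with weights 1 and 0.\<close>
  define hi where "hi = (\<lambda>i. length (fst (p i)) = Suc m)"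
  define x where "x = (\<lambda>i. snd (p i))"
  define b where "b = (\<lambda>i. if hi i then hd (fst (p i)) else 0)"
  define us where "us = (\<lambda>i. if hi i then tl (fst (p i)) else fst (p i))"
  define a where "a = (\<lambda>t::real. \<lambda>i s. if hi i then (if s then 1 / t else - 1 / t) else if s then 1 else 0)"
  define J where "J = (\<lambda>t i s. (us i, if s then x i + t *\<^sub>R b i else x i))"
  define Q where "Q = (\<lambda>t i j. \<Sum>s\<in>UNIV. \<Sum>s'\<in>UNIV. a t i s * jet_kernel h (J t i s) (J t j s') * a t j s')"
  have p_eq: "p i = (if hi i then (b i # us i, x i) else (us i, x i))" if "i < n" for i
    by (cases "p i", cases "fst (p i)") (auto simp: hi_def b_def us_def x_def)
  have pj: "set (fst (p i)) \<subseteq> Basis" "length (fst (p i)) \<le> Suc m" "snd (p i) \<in> \<Theta>" if "i < n" for i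
    using p[rule_format, OF that] unfolding jets_def case_prod_beta by simp_all
  have ne: "fst (p i) \<noteq> []" if "hi i" for i using that by (auto simp: hi_def)
  have xT: "x i \<in> \<Theta>" if "i < n" for i using pj(3)[OF that] by (simp add: x_def)
  have usm: "length (us i) \<le> m" if "i < n" for i
    using pj(2)[OF that] by (cases "hi i") (auto simp: us_def hi_def)
  have usB: "set (us i) \<subseteq> Basis" if "i < n" for i
    using pj(1)[OF that] ne[of i] by (cases "hi i") (auto simp: us_def dest: list.set_sel(2))
  have bB: "b i \<in> Basis" if "hi i" "i < n" for i
    using pj(1)[OF that(2)] ne[OF that(1)] that(1) by (auto simp: b_def)
  \<comment> \<open>Two top-order jets produce a second difference quotient of the common function
    \<open>G\<close>, one produces an ordinary quotient, none a constant. A direction split off in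
    the second variable appears outermost in the limit and is commuted into place.\<close>
  have Q: "((\<lambda>t. Q t i j) \<longlongrightarrow> jet_kernel h (p i) (p j)) (at_right 0)" if ij: "i < n" "j < n" for i j
  proof -
    let ?L = "map (\<lambda>v. (v, 0)) (us i) @ map (\<lambda>v. (0, v)) (us j)"
    let ?P = "(x i, x j)" and ?v = "(b i, 0)" and ?w = "(0, b j)"
    define G where "G = iter_pd ?L h"
    have P: "?P \<in> \<Theta> \<times> \<Theta>" using xT ij by auto
    have jk: "jet_kernel h (us i, x i + t *\<^sub>R b i) (us j, x j + t *\<^sub>R b j) = G (?P + t *\<^sub>R ?v + t *\<^sub>R ?w)"
      "jet_kernel h (us i, x i + t *\<^sub>R b i) (us j, x j) = G (?P + t *\<^sub>R ?v)"
      "jet_kernel h (us i, x i) (us j, x j + t *\<^sub>R b j) = G (?P + t *\<^sub>R ?w)"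
      "jet_kernel h (us i, x i) (us j, x j) = G ?P" for t
      by (auto simp: jet_kernel_def G_def)
    have quot: "((\<lambda>t. (g t - g 0) / t) \<longlongrightarrow> D) (at_right 0)"
      if "(g has_field_derivative D) (at 0)" for g :: "real \<Rightarrow> real" and D
      using tendsto_mono[OF at_le[OF subset_UNIV] that[unfolded has_field_derivative_iff]] by simp
    have len: "Suc (length (us i)) \<le> k" "Suc (length (us j)) \<le> k" using usm[OF ij(1)] usm[OF ij(2)] m(2) by auto
    show ?thesis
    proof (cases "hi i"; cases "hi j")
      assume hh: "hi i" "hi j"
      have B: "set (b i # us i) \<subseteq> Basis" "set (b j # us j) \<subseteq> Basis"
        "length (b i # us i) \<le> k" "length (b j # us j) \<le> k"
        using usB bB hh ij len by auto
      have ex: "pd_exists (\<Theta> \<times> \<Theta>) vs h" "continuous_on (\<Theta> \<times> \<Theta>) (iter_pd vs h)"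
        if "mset vs \<subseteq># mset (map (\<lambda>v. (v, 0)) (b i # us i) @ map (\<lambda>v. (0, v)) (b j # us j))" for vs
        using split_list_valid[OF B that] by (auto intro: uniformly_continuous_imp_continuous)
      have "((\<lambda>t. (G (?P + t *\<^sub>R ?v + t *\<^sub>R ?w) - G (?P + t *\<^sub>R ?v) - G (?P + t *\<^sub>R ?w) + G ?P) / t\<^sup>2)
         \<longlongrightarrow> iter_pd (?w # ?v # ?L) h ?P) (at_right 0)"
        unfolding G_def
      proof (rule mixed_difference_quotient[OF _ P iter_pd_has_derivative iter_pd_has_derivative])
        show "open (\<Theta> \<times> \<Theta>)" using open_\<Theta> by (intro open_Times)
        show "pd_exists (\<Theta> \<times> \<Theta>) (?v # ?L) h" "pd_exists (\<Theta> \<times> \<Theta>) (?w # ?v # ?L) h"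
          by (intro ex; simp)+
        show "isCont (iter_pd (?w # ?v # ?L) h) ?P"
          using ex(2)[of "?w # ?v # ?L"] P \<open>open (\<Theta> \<times> \<Theta>)\<close> by (simp add: continuous_on_eq_continuous_at)
      qed
      also have "iter_pd (?w # ?v # ?L) h ?P = jet_kernel h (p i) (p j)"
        using split_list_perm[OF B _ P, of "?w # ?v # ?L"] ij hh by (simp add: p_eq jet_kernel_def)
      also have "(\<lambda>t. (G (?P + t *\<^sub>R ?v + t *\<^sub>R ?w) - G (?P + t *\<^sub>R ?v) - G (?P + t *\<^sub>R ?w) + G ?P) / t\<^sup>2) = (\<lambda>t. Q t i j)"
        by (simp only: Q_def J_def a_def hh UNIV_bool if_True sum.insert sum.empty finite.intros jk if_False)
           (auto simp: jk add_divide_distrib diff_divide_distrib power2_eq_square fun_eq_iff)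
      finally show ?thesis .
    next
      assume hh: "hi i" "\<not> hi j"
      have B: "set (b i # us i) \<subseteq> Basis" "set (us j) \<subseteq> Basis"
        "length (b i # us i) \<le> k" "length (us j) \<le> k"
        using usB bB hh ij len by auto
      have "((\<lambda>t. G (?P + t *\<^sub>R ?v)) has_field_derivative iter_pd (?v # ?L) h ?P) (at 0)"
        unfolding G_def using split_list_valid(1)[OF B, of "?v # ?L"] P
        by (intro iter_pd_has_derivative[of "\<Theta> \<times> \<Theta>"]) auto
      from quot[OF this] have "((\<lambda>t. (G (?P + t *\<^sub>R ?v) - G ?P) / t) \<longlongrightarrow> iter_pd (?v # ?L) h ?P) (at_right 0)" by simp
      also have "iter_pd (?v # ?L) h ?P = jet_kernel h (p i) (p j)"
        using ij hh by (simp add: p_eq jet_kernel_def)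
      also have "(\<lambda>t. (G (?P + t *\<^sub>R ?v) - G ?P) / t) = (\<lambda>t. Q t i j)"
      proof -
        have "b j = 0" using hh by (simp add: b_def)
        then show ?thesis using hh jk by (auto simp: Q_def J_def a_def UNIV_bool add_divide_distrib diff_divide_distrib fun_eq_iff)
      qed
      finally show ?thesis .
    next
      assume hh: "\<not> hi i" "hi j"
      have B: "set (us i) \<subseteq> Basis" "set (b j # us j) \<subseteq> Basis"
        "length (us i) \<le> k" "length (b j # us j) \<le> k"
        using usB bB hh ij len by auto
      have "((\<lambda>t. G (?P + t *\<^sub>R ?w)) has_field_derivative iter_pd (?w # ?L) h ?P) (at 0)"
        unfolding G_def using split_list_valid(1)[OF B, of "?w # ?L"] P
        by (intro iter_pd_has_derivative[of "\<Theta> \<times> \<Theta>"]) auto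
      from quot[OF this] have "((\<lambda>t. (G (?P + t *\<^sub>R ?w) - G ?P) / t) \<longlongrightarrow> iter_pd (?w # ?L) h ?P) (at_right 0)" by simp
      also have "iter_pd (?w # ?L) h ?P = jet_kernel h (p i) (p j)"
        using split_list_perm[OF B _ P, of "?w # ?L"] ij hh by (simp add: p_eq jet_kernel_def)
      also have "(\<lambda>t. (G (?P + t *\<^sub>R ?w) - G ?P) / t) = (\<lambda>t. Q t i j)"
      proof -
        have "b i = 0" using hh by (simp add: b_def)
        then show ?thesis using hh jk by (auto simp: Q_def J_def a_def UNIV_bool add_divide_distrib diff_divide_distrib fun_eq_iff)
      qed
      finally show ?thesis .
    next
      assume hh: "\<not> hi i" "\<not> hi j"
      have "b i = 0" "b j = 0" using hh by (simp_all add: b_def)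
      then have "Q t i j = jet_kernel h (p i) (p j)" for t
        using hh ij by (simp add: Q_def J_def a_def UNIV_bool p_eq)
      then show ?thesis by simp
    qed
  qed
  have lim: "((\<lambda>t. \<Sum>i<n. \<Sum>j<n. c i * Q t i j * c j) \<longlongrightarrow> (\<Sum>i<n. \<Sum>j<n. c i * jet_kernel h (p i) (p j) * c j)) (at_right 0)"
    by (intro tendsto_intros Q) auto
  \<comment> \<open>For small \<open>t\<close> all shifted points lie in \<Theta>, so the form in
    \<open>Q\<close> is a positive combination over jets of order at most \<open>m\<close>, to which
    the assumption applies.\<close>
  have "\<forall>\<^sub>F t in at_right 0. \<forall>i\<in>{..<n}. x i + t *\<^sub>R b i \<in> \<Theta>"
  proof (intro eventually_ball_finite ballI)
    fix i assume "i \<in> {..<n}"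
    have "((\<lambda>t. x i + t *\<^sub>R b i) \<longlongrightarrow> x i + 0 *\<^sub>R b i) (at_right 0)" by (intro tendsto_intros)
    from topological_tendstoD[OF this open_\<Theta>] show "\<forall>\<^sub>F t in at_right 0. x i + t *\<^sub>R b i \<in> \<Theta>"
      using xT \<open>i \<in> {..<n}\<close> by simp
  qed simp
  then have "\<forall>\<^sub>F t in at_right 0. 0 \<le> (\<Sum>i<n. \<Sum>j<n. c i * Q t i j * c j)"
  proof eventually_elim
    case (elim t)
    have "0 \<le> (\<Sum>q\<in>{..<n} \<times> UNIV. \<Sum>q'\<in>{..<n} \<times> UNIV.
       (c (fst q) * a t (fst q) (snd q)) * jet_kernel h (J t (fst q) (snd q)) (J t (fst q') (snd q')) * (c (fst q') * a t (fst q') (snd q')))"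
      using elim xT usm usB by (intro psd_on_sum[OF m(1)]) (auto simp: J_def jets_def dest: subsetD[OF usB])
    also have "\<dots> = (\<Sum>i<n. \<Sum>s\<in>UNIV. \<Sum>j<n. \<Sum>s'\<in>UNIV.
       (c i * a t i s) * jet_kernel h (J t i s) (J t j s') * (c j * a t j s'))"
      unfolding sum.cartesian_product' by (simp add: sum.cartesian_product')
    also have "\<dots> = (\<Sum>i<n. \<Sum>j<n. c i * Q t i j * c j)"
      unfolding Q_def UNIV_bool
      by (intro sum.cong refl) (simp add: sum.distrib[symmetric] algebra_simps)
    finally show ?case .
  qed
  from tendsto_lowerbound[OF lim this] show "0 \<le> (\<Sum>i<n. \<Sum>j<n. c i * jet_kernel h (p i) (p j) * c j)"
    by simp
qed

lemma psd_on_jets: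
  assumes "pos_def_kernel \<Theta> h"
  shows "psd_on (jets \<Theta> k) (jet_kernel h)"
proof -
  have "m \<le> k \<Longrightarrow> psd_on (jets \<Theta> m) (jet_kernel h)" for m
  proof (induction m)
    case 0
    show ?case unfolding psd_on_def
    proof (intro allI impI)
      fix n :: nat and c :: "nat \<Rightarrow> real" and p :: "nat \<Rightarrow> (real^'d) list \<times> (real^'d)"
      assume p: "\<forall>i<n. p i \<in> jets \<Theta> 0"
      then have "0 \<le> (\<Sum>i<n. \<Sum>j<n. c i * h (snd (p i), snd (p j)) * c j)"
        using assms unfolding pos_def_kernel_def
        by (auto simp: jets_def case_prod_beta elim!: allE[of _ "\<lambda>i. snd (p i)"])
      also have "\<dots> = (\<Sum>i<n. \<Sum>j<n. c i * jet_kernel h (p i) (p j) * c j)"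
        using p by (intro sum.cong refl) (auto simp: jet_kernel_def jets_def case_prod_beta)
      finally show "0 \<le> \<dots>" .
    qed
  next
    case (Suc m)
    then show ?case using psd_on_jets_Suc by simp
  qed
  then show ?thesis by simp
qed

end

section \<open>Test functions and weak derivatives\<close>

definition flat :: "real poly \<Rightarrow> real \<Rightarrow> real" where
  "flat p x = (if x > 0 then poly p (1 / x) * exp (- (1 / x)) else 0)"

lemma flat_tendsto_0: "((\<lambda>x. poly p (1 / x) * exp (- (1 / x))) \<longlongrightarrow> (0::real)) (at_right 0)"
proof -
  have "((\<lambda>u. poly p u * exp (- u)) \<longlongrightarrow> (0::real)) at_top"
  proof -
    have "((\<lambda>u. \<Sum>i\<le>degree p. coeff p i * (u ^ i / exp u)) \<longlongrightarrow> (\<Sum>i\<le>degree p. coeff p i * 0)) at_top"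
      by (intro tendsto_intros tendsto_power_div_exp_0)
    then show ?thesis
      by (simp add: poly_altdef sum_distrib_right exp_minus divide_inverse mult.assoc)
  qed
  moreover have "filterlim (\<lambda>x::real. 1 / x) at_top (at_right 0)"
    using filterlim_inverse_at_top_right by (simp add: inverse_eq_divide)
  ultimately show ?thesis by (rule filterlim_compose)
qed

text \<open>In the variable u = 1/x the function is p(u) exp(-u), and the chain rule gives u^2 (p(u)
  - p'(u)) exp(-u); this is why the polynomial is a parameter. At 0 the right-hand quotient is again
  of this form, with \<open>p\<close> multiplied by u, and tends to 0.\<close>

lemma DERIV_flat: "(flat p has_real_derivative flat ([:0, 0, 1:] * (p - pderiv p)) x) (at x)"
proof (cases x "0 :: real" rule: linorder_cases)
  case less
  have "\<forall>\<^sub>F y in nhds x. flat p y = 0"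
    using eventually_nhds_in_open[of "{..<0}" x] less by (auto simp: flat_def elim!: eventually_mono)
  then show ?thesis using less DERIV_cong_ev[of x x "flat p" "\<lambda>_. 0" 0 0] by (simp add: flat_def)
next
  case equal
  have "((\<lambda>y. (flat p y - flat p 0) / y) \<longlongrightarrow> 0) (at 0)"
    unfolding filterlim_at_split
  proof
    have "\<forall>\<^sub>F y in at_left 0. (flat p y - flat p 0) / y = 0"
      by (auto simp: flat_def eventually_at_filter)
    then show "((\<lambda>y. (flat p y - flat p 0) / y) \<longlongrightarrow> 0) (at_left 0)" by (simp add: tendsto_eventually)
    have "\<forall>\<^sub>F y in at_right 0. poly ([:0, 1:] * p) (1 / y) * exp (- (1 / y)) = (flat p y - flat p 0) / y"
      by (auto simp: flat_def eventually_at_filter field_simps)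
    from Lim_transform_eventually[OF flat_tendsto_0 this]
    show "((\<lambda>y. (flat p y - flat p 0) / y) \<longlongrightarrow> 0) (at_right 0)" .
  qed
  then have "(flat p has_real_derivative 0) (at 0)" by (simp add: has_field_derivative_iff)
  then show ?thesis using equal by (simp add: flat_def)
next
  case greater
  have ev: "\<forall>\<^sub>F y in nhds x. flat p y = poly p (1 / y) * exp (- (1 / y))"
    using eventually_nhds_in_open[of "{0<..}" x] greater by (auto simp: flat_def elim!: eventually_mono)
  have "((\<lambda>y. poly p (1 / y) * exp (- (1 / y))) has_real_derivative flat ([:0, 0, 1:] * (p - pderiv p)) x) (at x)"
    using greater
    by (auto intro!: derivative_eq_intros DERIV_chain'[where g = "poly p" and f = "\<lambda>y. 1 / y", OF _ poly_DERIV]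
        simp: flat_def field_simps power2_eq_square)
  then show ?thesis using DERIV_cong_ev[OF refl ev refl] by simp
qed

text \<open>
  A class of smooth functions containing the bumps that we need and visibly closed under
  directional derivatives, so that no Leibniz formula is required.
\<close>

inductive bumpy :: "(real^'d::finite \<Rightarrow> real) \<Rightarrow> bool" where
  bumpy_flat: "bumpy (\<lambda>x. flat p (c * (x $ i) + a))"
| bumpy_const: "bumpy (\<lambda>x. a)"
| bumpy_add: "bumpy f \<Longrightarrow> bumpy g \<Longrightarrow> bumpy (\<lambda>x. f x + g x)"
| bumpy_mult: "bumpy f \<Longrightarrow> bumpy g \<Longrightarrow> bumpy (\<lambda>x. f x * g x)"

lemma bumpy_prod: "finite I \<Longrightarrow> (\<And>i. i \<in> I \<Longrightarrow> bumpy (f i)) \<Longrightarrow> bumpy (\<lambda>x. \<Prod>i\<in>I. f i x)"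
  by (induction I rule: finite_induct) (auto intro: bumpy.intros)

lemma bumpy_derivative:
  assumes "bumpy f"
  shows "\<exists>f'. bumpy f' \<and> (\<forall>x. ((\<lambda>t. f (x + t *\<^sub>R v)) has_field_derivative f' x) (at 0))"
  using assms
proof induction
  case (bumpy_flat p c i a)
  have "((\<lambda>t. flat p (c * ((x + t *\<^sub>R v) $ i) + a)) has_field_derivative
      flat ([:0, 0, 1:] * (p - pderiv p)) (c * (x $ i) + a) * (c * (v $ i))) (at 0)" for x
    by (rule DERIV_chain'[where f = "\<lambda>t. c * ((x + t *\<^sub>R v) $ i) + a" and g = "flat p"])
       (auto intro!: derivative_eq_intros DERIV_cong[OF DERIV_flat])
  then show ?case
    by (intro exI[of _ "\<lambda>x. flat ([:0, 0, 1:] * (p - pderiv p)) (c * (x $ i) + a) * (c * (v $ i))"])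
       (auto intro: bumpy.intros)
next
  case (bumpy_const a)
  then show ?case by (intro exI[of _ "\<lambda>_. 0"]) (auto intro: bumpy.intros)
next
  case (bumpy_add f g)
  then obtain f' g' where "bumpy f'" "bumpy g'"
    "\<And>x. ((\<lambda>t. f (x + t *\<^sub>R v)) has_field_derivative f' x) (at 0)"
    "\<And>x. ((\<lambda>t. g (x + t *\<^sub>R v)) has_field_derivative g' x) (at 0)" by auto
  then show ?case
    by (intro exI[of _ "\<lambda>x. f' x + g' x"]) (auto intro: bumpy.intros DERIV_add)
next
  case (bumpy_mult f g)
  then obtain f' g' where *: "bumpy f'" "bumpy g'"
    "\<And>x. ((\<lambda>t. f (x + t *\<^sub>R v)) has_field_derivative f' x) (at 0)"
    "\<And>x. ((\<lambda>t. g (x + t *\<^sub>R v)) has_field_derivative g' x) (at 0)" by auto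
  have "((\<lambda>t. f (x + t *\<^sub>R v) * g (x + t *\<^sub>R v)) has_field_derivative f' x * g x + g' x * f x) (at 0)" for x
    using DERIV_mult[OF *(3)[of x] *(4)[of x]] by simp
  then show ?case using * bumpy_mult.hyps
    by (intro exI[of _ "\<lambda>x. f' x * g x + g' x * f x"]) (auto intro: bumpy.intros)
qed

lemma bumpy_continuous: "bumpy f \<Longrightarrow> continuous_on UNIV f"
proof (induction rule: bumpy.induct)
  case (bumpy_flat p c i a)
  have "continuous_on UNIV (flat p)"
    using DERIV_flat by (meson DERIV_isCont continuous_at_imp_continuous_on)
  then show ?case
    by (rule continuous_on_compose2) (auto intro!: continuous_intros)
qed (auto intro: continuous_intros)

lemma bumpy_iter_pd: "bumpy f \<Longrightarrow> bumpy (iter_pd vs f) \<and> pd_exists UNIV vs f"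
proof (induction vs)
  case (Cons v vs)
  then obtain f' where f': "bumpy f'" "\<And>x. ((\<lambda>t. iter_pd vs f (x + t *\<^sub>R v)) has_field_derivative f' x) (at 0)"
    using bumpy_derivative by blast
  then have "iter_pd (v # vs) f = f'" by (auto simp: DERIV_imp_deriv)
  then show ?case using f' Cons by (auto simp: field_differentiable_def)
qed auto

text \<open>Each factor is exp(-1/(n t)), where t is the signed distance to a face of the box, as
  long as n t is positive, and 0 otherwise. Hence the bumps converge to the indicator of the open
  box as \<open>n\<close> grows. The arguments are written in the affine shape of
  \<open>bumpy_flat\<close>.\<close>

definition box_bump :: "real^'d \<Rightarrow> real^'d \<Rightarrow> nat \<Rightarrow> real^'d::finite \<Rightarrow> real" where
  "box_bump a b n x = (\<Prod>i\<in>UNIV. flat 1 (real n * (x $ i) + - (real n * a $ i)) * flat 1 (- real n * (x $ i) + real n * b $ i))"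

lemma flat1: "0 \<le> flat 1 x" "flat 1 x \<le> 1" "x \<le> 0 \<Longrightarrow> flat 1 x = 0"
  by (auto simp: flat_def)

lemma box_bump_bounds: "0 \<le> box_bump a b n x" "box_bump a b n x \<le> 1"
  unfolding box_bump_def
  by (auto intro!: prod_nonneg prod_le_1 mult_nonneg_nonneg mult_le_one flat1)

lemma box_bump_outside: "x \<notin> box a b \<Longrightarrow> box_bump a b n x = 0"
proof -
  assume "x \<notin> box a b"
  then obtain i where "\<not> (a $ i < x $ i \<and> x $ i < b $ i)" by (auto simp: mem_box_cart)
  then have "real n * (x $ i) + - (real n * a $ i) \<le> 0 \<or> - real n * (x $ i) + real n * b $ i \<le> 0"
    using mult_left_mono[of "x $ i" "a $ i" "real n"] mult_left_mono[of "b $ i" "x $ i" "real n"] by auto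
  then have "flat 1 (real n * (x $ i) + - (real n * a $ i)) * flat 1 (- real n * (x $ i) + real n * b $ i) = 0"
    using flat1(3) by auto
  then show ?thesis unfolding box_bump_def by (intro prod_zero) auto
qed

lemma box_bump_tendsto: "(\<lambda>n. box_bump a b n x) \<longlonglongrightarrow> indicat_real (box a b) x"
proof (cases "x \<in> box a b")
  case False
  then show ?thesis by (simp add: box_bump_outside)
next
  case True
  have lim: "(\<lambda>n. flat 1 (real n * c)) \<longlonglongrightarrow> 1" if "c > 0" for c
  proof -
    have "(\<lambda>n. exp (- (1 / c * inverse (real n)))) \<longlonglongrightarrow> exp (- (1 / c * 0))"
      by (intro tendsto_intros lim_inverse_n)
    moreover have "\<forall>\<^sub>F n in sequentially. exp (- (1 / c * inverse (real n))) = flat 1 (real n * c)"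
      using eventually_gt_at_top[of 0] by eventually_elim (auto simp: flat_def that field_simps)
    ultimately show ?thesis by (auto intro: Lim_transform_eventually)
  qed
  have "(\<lambda>n. \<Prod>i\<in>UNIV. flat 1 (real n * (x $ i - a $ i)) * flat 1 (real n * (b $ i - x $ i))) \<longlonglongrightarrow> (\<Prod>i\<in>(UNIV::'a set). 1 * 1)"
    using True by (intro tendsto_intros lim) (auto simp: mem_box_cart)
  then show ?thesis using True by (simp add: box_bump_def algebra_simps)
qed

lemma test_function_box_bump:
  assumes "cbox a b \<subseteq> \<Theta>"
  shows "test_function \<Theta> (box_bump a b n)"
proof -
  have b: "bumpy (box_bump a b n)"
    unfolding box_bump_def[abs_def] by (intro bumpy_prod bumpy.intros) auto
  have "closure {x. box_bump a b n x \<noteq> 0} \<subseteq> closure (cbox a b)"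
    using box_bump_outside box_subset_cbox by (intro closure_mono) blast
  then have cl: "closure {x. box_bump a b n x \<noteq> 0} \<subseteq> cbox a b" by simp
  then have "compact (closure {x. box_bump a b n x \<noteq> 0})"
    by (meson closed_closure bounded_cbox bounded_subset compact_eq_bounded_closed)
  then show ?thesis
    unfolding test_function_def using cl assms bumpy_iter_pd[OF b] bumpy_continuous by blast
qed

section \<open>The fundamental lemma of the calculus of variations\<close>

lemma sigma_finite_lebesgue: "sigma_finite_measure (lebesgue :: 'a::euclidean_space measure)"
proof
  obtain A :: "'a set set" where A: "countable A" "A \<subseteq> sets lborel" "\<Union>A = space lborel" "\<forall>a\<in>A. emeasure lborel a \<noteq> \<infinity>"
    using sigma_finite_measure.sigma_finite_countable[OF lborel.sigma_finite_measure_axioms] by metis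
  then show "\<exists>A. countable A \<and> A \<subseteq> sets lebesgue \<and> \<Union>A = space (lebesgue :: 'a measure) \<and> (\<forall>a\<in>A. emeasure lebesgue a \<noteq> \<infinity>)"
    by (intro exI[of _ A]) (auto simp: subset_iff)
qed

text \<open>The sets over which \<open>f\<close> integrates to 0 form a Dynkin system that contains
  the open boxes, an intersection-stable generator of the Borel sets; a Lebesgue set differs from a
  Borel set by a null set. A box that sticks out of \<open>cbox a b\<close> is first cut down to it,
  which does not alter the integral.\<close>

lemma AE_zero_if_integral_box_zero:
  fixes f :: "real^'d::finite \<Rightarrow> real"
  assumes f: "integrable lebesgue f" and out: "\<And>x. x \<notin> cbox a b \<Longrightarrow> f x = 0"
    and z: "\<And>p q. cbox p q \<subseteq> cbox a b \<Longrightarrow> (LINT x:box p q|lebesgue. f x) = 0"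
  shows "AE x in lebesgue. f x = 0"
proof (rule sigma_finite_measure.density_zero[OF sigma_finite_lebesgue f])
  have null: "cbox a b - box a b \<in> null_sets lebesgue"
    using negligible_frontier_interval negligible_iff_null_sets by blast
  have inte: "set_integrable lebesgue A f" if "A \<in> sets lebesgue" for A
    using f that unfolding set_integrable_def by (rule integrable_mult_indicator[rotated])
  \<comment> \<open>Complements in the Dynkin system require the total integral to vanish;
    \<open>f\<close> lives on \<open>cbox a b\<close>, whose boundary is null.\<close>
  have all: "(LINT x|lebesgue. f x) = 0"
  proof -
    have "(LINT x|lebesgue. f x) = (LINT x:box a b|lebesgue. f x)"
      unfolding set_lebesgue_integral_def
    proof (rule integral_cong_AE)
      show "AE x in lebesgue. f x = indicat_real (box a b) x *\<^sub>R f x"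
        using AE_not_in[OF null] by eventually_elim (use out in \<open>auto simp: indicator_def\<close>)
    qed (use f inte[of "box a b"] in \<open>auto simp: set_integrable_def\<close>)
    then show ?thesis using z by simp
  qed
  have borel: "(LINT x:A|lebesgue. f x) = 0" if "A \<in> sets borel" for A
  proof -
    let ?G = "range (\<lambda>(a, b). box a b :: (real^'d) set)"
    have sb: "sigma_sets UNIV ?G = sets borel" by (subst borel_eq_box) simp
    have A: "A \<in> sigma_sets UNIV ?G" using that sb by simp
    have "Int_stable ?G" unfolding Int_stable_def by (auto simp: box_Int_box)
    moreover have "?G \<subseteq> Pow UNIV" by simp
    ultimately show ?thesis using A
    proof (induction rule: sigma_sets_induct_disjoint)
      case (basic A)
      then obtain p q where A: "A = box p q" by auto
      have int: "box p q \<inter> box a b = box (\<Sum>i\<in>Basis. max (p\<bullet>i) (a\<bullet>i) *\<^sub>R i) (\<Sum>i\<in>Basis. min (q\<bullet>i) (b\<bullet>i) *\<^sub>R i)" (is "_ = box ?p ?q")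
        by (rule box_Int_box)
      have sub: "cbox ?p ?q \<subseteq> cbox a b" by (subst Int_interval[symmetric]) auto
      have "(LINT x:A|lebesgue. f x) = (LINT x:box p q \<inter> box a b|lebesgue. f x)"
        unfolding set_lebesgue_integral_def
      proof (rule integral_cong_AE)
        show "AE x in lebesgue. indicat_real A x *\<^sub>R f x = indicat_real (box p q \<inter> box a b) x *\<^sub>R f x"
          using AE_not_in[OF null] by eventually_elim (use out in \<open>auto simp: indicator_def A\<close>)
      qed (use inte[of "box p q \<inter> box a b"] inte[of "box p q"] A in \<open>auto simp: set_integrable_def\<close>)
      also have "\<dots> = 0" unfolding int by (rule z[OF sub])
      finally show ?case .
    next
      case (compl A)
      have Ab: "A \<in> sets lebesgue" using compl(1) unfolding sb by simp
      have "(LINT x:UNIV - A|lebesgue. f x) = (LINT x|lebesgue. f x) - (LINT x:A|lebesgue. f x)"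
      proof -
        have "(\<lambda>x. indicat_real (UNIV - A) x *\<^sub>R f x) = (\<lambda>x. f x - indicat_real A x *\<^sub>R f x)"
          by (auto simp: indicator_def)
        then show ?thesis
          unfolding set_lebesgue_integral_def
          using Bochner_Integration.integral_diff[OF f inte[OF Ab, unfolded set_integrable_def]] by simp
      qed
      then show ?case using all compl by simp
    next
      case (union A)
      have Ab: "A i \<in> sets lebesgue" for i
        using union(2) unfolding sb by auto
      have "(LINT x:(\<Union>i. A i)|lebesgue. f x) = (\<Sum>i. (LINT x:(A i)|lebesgue. f x))"
        using Ab union(1) by (intro lebesgue_integral_countable_add inte) (auto simp: disjoint_family_on_def)
      then show ?case using union by simp
    qed (auto simp: set_lebesgue_integral_def)
  qed
  fix A :: "(real^'d) set" assume "A \<in> sets lebesgue"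
  then obtain S N N' where A: "A = S \<union> N" "N \<subseteq> N'" "N' \<in> null_sets lborel" "S \<in> sets lborel"
    by (rule sets_completionE)
  have N': "N' \<in> null_sets lebesgue" using A by (simp add: null_sets_completionI)
  have "(LINT x:A|lebesgue. f x) = (LINT x:S|lebesgue. f x)"
    unfolding set_lebesgue_integral_def
  proof (rule integral_cong_AE)
    show "AE x in lebesgue. indicat_real A x *\<^sub>R f x = indicat_real S x *\<^sub>R f x"
      using AE_not_in[OF N'] by eventually_elim (use A in \<open>auto simp: indicator_def\<close>)
  qed (use inte[of A] inte[of S] A \<open>A \<in> sets lebesgue\<close> in \<open>auto simp: set_integrable_def\<close>)
  then show "(LINT x:A|lebesgue. f x) = 0" using borel A by simp
qed

text \<open>Bumps that converge to the indicator of a box turn the vanishing test integrals into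
  vanishing integrals over boxes, by dominated convergence. As \<open>g\<close> is integrable only
  on compact subsets, the argument runs inside one closed box at a time, and countably many of these
  cover \<Theta>.\<close>

lemma fundamental_lemma:
  fixes \<Theta> :: "(real^'d::finite) set"
  assumes "open \<Theta>" and g: "locally_integrable \<Theta> g"
    and z: "\<And>\<phi>. test_function \<Theta> \<phi> \<Longrightarrow> (LINT x|lebesgue_on \<Theta>. g x * \<phi> x) = 0"
  shows "AE x in lebesgue_on \<Theta>. g x = 0"
proof -
  have \<Theta>: "\<Theta> \<in> sets lebesgue" using assms(1) by simp
  have gc: "integrable lebesgue (\<lambda>x. indicat_real (cbox a b) x * g x)" if "cbox a b \<subseteq> \<Theta>" for a b
    using g that integrable_restrict_space[of "cbox a b" lebesgue g]
    by (simp add: locally_integrable_def)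
  have box0: "(LINT x:box p q|lebesgue. g x) = 0" if pq: "cbox p q \<subseteq> \<Theta>" for p q
  proof -
    have "(\<lambda>n. LINT x|lebesgue. (indicat_real (cbox p q) x * g x) * box_bump p q n x)
      \<longlonglongrightarrow> (LINT x|lebesgue. (indicat_real (cbox p q) x * g x) * indicat_real (box p q) x)"
    proof (rule integral_dominated_convergence)
      show "integrable lebesgue (\<lambda>x. \<bar>indicat_real (cbox p q) x * g x\<bar>)" using gc[OF pq] by simp
      have m: "(\<lambda>x. indicat_real (cbox p q) x * g x) \<in> borel_measurable lebesgue" using gc[OF pq] by simp
      have "continuous_on UNIV (box_bump p q n)" for n
        using test_function_box_bump[OF pq, of n] unfolding test_function_def
        by (metis empty_subsetI iter_pd.simps(1) list.set(1))
      then have "box_bump p q n \<in> borel_measurable borel" for n by (rule borel_measurable_continuous_onI)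
      then have "box_bump p q n \<in> borel_measurable lebesgue" for n by (intro measurable_completion) simp
      then show "(\<lambda>x. indicat_real (cbox p q) x * g x * box_bump p q n x) \<in> borel_measurable lebesgue" for n
        by (rule borel_measurable_times[OF m])
      show "(\<lambda>x. indicat_real (cbox p q) x * g x * indicat_real (box p q) x) \<in> borel_measurable lebesgue"
        by (rule borel_measurable_times[OF m]) (auto intro!: borel_measurable_indicator)
      show "AE x in lebesgue. (\<lambda>n. indicat_real (cbox p q) x * g x * box_bump p q n x) \<longlonglongrightarrow> indicat_real (cbox p q) x * g x * indicat_real (box p q) x"
        by (intro AE_I2 tendsto_intros box_bump_tendsto)
      show "AE x in lebesgue. norm (indicat_real (cbox p q) x * g x * box_bump p q n x) \<le> \<bar>indicat_real (cbox p q) x * g x\<bar>" for n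
        using box_bump_bounds[of p q n] by (intro AE_I2) (auto simp: abs_mult mult_left_le)
    qed
    moreover have "(LINT x|lebesgue. (indicat_real (cbox p q) x * g x) * box_bump p q n x) = 0" for n
    proof -
      have "0 = (LINT x|lebesgue_on \<Theta>. g x * box_bump p q n x)"
        using z[OF test_function_box_bump[OF pq]] by simp
      also have "\<dots> = (LINT x|lebesgue. indicat_real \<Theta> x *\<^sub>R (g x * box_bump p q n x))"
        using \<Theta> by (simp add: integral_restrict_space)
      also have "\<dots> = (LINT x|lebesgue. (indicat_real (cbox p q) x * g x) * box_bump p q n x)"
        using pq box_subset_cbox[of p q] box_bump_outside[of _ p q n]
        by (intro Bochner_Integration.integral_cong) (auto simp: indicator_def)
      finally show ?thesis by simp
    qed
    ultimately have "(LINT x|lebesgue. (indicat_real (cbox p q) x * g x) * indicat_real (box p q) x) = 0"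
      by (simp add: LIMSEQ_const_iff)
    also have "(LINT x|lebesgue. (indicat_real (cbox p q) x * g x) * indicat_real (box p q) x) = (LINT x:box p q|lebesgue. g x)"
      unfolding set_lebesgue_integral_def using box_subset_cbox[of p q]
      by (intro Bochner_Integration.integral_cong) (auto simp: indicator_def)
    finally show ?thesis .
  qed
  have AEc: "AE x in lebesgue. x \<in> cbox a b \<longrightarrow> g x = 0" if ab: "cbox a b \<subseteq> \<Theta>" for a b
  proof -
    have "AE x in lebesgue. indicat_real (cbox a b) x * g x = 0"
    proof (rule AE_zero_if_integral_box_zero[OF gc[OF ab]])
      fix p q assume pq: "cbox p q \<subseteq> cbox a b"
      have "(LINT x:box p q|lebesgue. indicat_real (cbox a b) x * g x) = (LINT x:box p q|lebesgue. g x)"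
        unfolding set_lebesgue_integral_def using pq box_subset_cbox[of p q]
        by (intro Bochner_Integration.integral_cong) (auto simp: indicator_def)
      then show "(LINT x:box p q|lebesgue. indicat_real (cbox a b) x * g x) = 0" using box0 pq ab by simp
    qed auto
    then show ?thesis by eventually_elim (auto simp: indicator_def)
  qed
  obtain D where D: "countable D" "D \<subseteq> Pow \<Theta>" "\<And>X. X \<in> D \<Longrightarrow> \<exists>a b. X = cbox a b" "\<Union>D = \<Theta>"
    using open_countable_Union_open_cbox[OF assms(1)] by metis
  have "AE x in lebesgue. \<forall>X\<in>D. x \<in> X \<longrightarrow> g x = 0"
    using D AEc by (subst AE_ball_countable) (auto, metis Pow_iff subsetD)
  then have "AE x in lebesgue. x \<in> \<Theta> \<longrightarrow> g x = 0" by eventually_elim (use D in blast)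
  then show ?thesis using \<Theta> by (simp add: AE_restrict_space_iff)
qed

section \<open>Integration by parts against test functions\<close>

lemma integral_translate_lborel:
  fixes w :: "'a::euclidean_space \<Rightarrow> real"
  assumes "w \<in> borel_measurable borel"
  shows "(LINT x|lborel. w (x + c)) = (LINT x|lborel. w x)"
proof -
  have "(LINT x|lborel. w x) = (LINT x|distr lborel borel ((+) c). w x)" by (simp add: lborel_distr_plus)
  also have "\<dots> = (LINT x|lborel. w (c + x))" by (rule integral_distr) (use assms in simp_all)
  finally show ?thesis by (simp add: add.commute)
qed

lemma integrable_continuous_compact_support:
  fixes w :: "'a::euclidean_space \<Rightarrow> real"
  assumes "continuous_on UNIV w" "compact K" "\<And>x. x \<notin> K \<Longrightarrow> w x = 0"
  shows "integrable lborel w"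
proof -
  have "integrable lborel (\<lambda>x. indicator K x *\<^sub>R w x)"
    using assms by (intro borel_integrable_compact) (auto intro: continuous_on_subset)
  also have "(\<lambda>x. indicator K x *\<^sub>R w x) = w" using assms(3) by (force simp: indicator_def fun_eq_iff)
  finally show ?thesis .
qed

text \<open>Translation invariance of the integral and dominated convergence of difference quotients.\<close>

lemma integral_directional_derivative_eq_0:
  fixes w :: "'a::euclidean_space \<Rightarrow> real"
  assumes d: "\<And>x. ((\<lambda>t. w (x + t *\<^sub>R v)) has_field_derivative w' x) (at 0)"
    and c: "continuous_on UNIV w" "continuous_on UNIV w'"
    and K: "compact K" "\<And>x. x \<notin> K \<Longrightarrow> w x = 0"
  shows "(LINT x|lborel. w' x) = 0"
proof -
  obtain R where R: "\<And>x. x \<in> K \<Longrightarrow> norm x \<le> R" using compact_imp_bounded[OF K(1)] by (auto simp: bounded_iff)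
  \<comment> \<open>\<open>C\<close> contains the supports of all difference quotients with step at
    most 1, and \<open>D\<close> the intermediate points that the mean value theorem supplies for
    points of \<open>C\<close>. A bound of \<open>w'\<close> on \<open>D\<close> thus dominates all
    quotients.\<close>
  define C where "C = cball (0::'a) (R + norm v)"
  define D where "D = cball (0::'a) (R + 2 * norm v)"
  have wC: "w x = 0" if "norm x > R" for x using K(2) R that by force
  have "bounded (w' ` D)" using c(2) by (intro compact_imp_bounded compact_continuous_image) (auto simp: D_def intro: continuous_on_subset)
  then obtain M where M: "\<And>x. x \<in> D \<Longrightarrow> \<bar>w' x\<bar> \<le> M" by (auto simp: bounded_iff)
  define q where "q = (\<lambda>n x. (w (x + (1 / real (Suc n)) *\<^sub>R v) - w x) / (1 / real (Suc n)))"
  have wm: "w \<in> borel_measurable borel" "w' \<in> borel_measurable borel"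
    using c by (auto intro: borel_measurable_continuous_onI)
  have wi: "integrable lborel w" using integrable_continuous_compact_support[OF c(1) K] .
  have wi': "integrable lborel (\<lambda>x. w (x + y))" for y
  proof (rule integrable_continuous_compact_support)
    show "continuous_on UNIV (\<lambda>x. w (x + y))"
      by (rule continuous_on_compose2[OF c(1)]) (auto intro!: continuous_intros)
    show "compact ((\<lambda>x. x - y) ` K)" using K(1) by (intro compact_continuous_image continuous_intros)
    show "w (x + y) = 0" if "x \<notin> (\<lambda>x. x - y) ` K" for x
      using K(2)[of "x + y"] that by (metis add_diff_cancel_right' image_eqI)
  qed
  have q0: "(LINT x|lborel. q n x) = 0" for n
    unfolding q_def using wi wi' integral_translate_lborel[OF wm(1)] by simp
  have shift: "((\<lambda>t. w (x + t *\<^sub>R v)) has_real_derivative w' (x + s *\<^sub>R v)) (at s)" for x s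
  proof -
    have "(\<lambda>t. w (x + (t + s) *\<^sub>R v)) = (\<lambda>t. w (x + s *\<^sub>R v + t *\<^sub>R v))"
      by (simp add: scaleR_add_left add_ac)
    then show ?thesis
      using d[of "x + s *\<^sub>R v"] DERIV_shift[of "\<lambda>t. w (x + t *\<^sub>R v)" "w' (x + s *\<^sub>R v)" 0 s] by simp
  qed
  have "(\<lambda>n. LINT x|lborel. q n x) \<longlonglongrightarrow> (LINT x|lborel. w' x)"
  proof (rule integral_dominated_convergence)
    show "integrable lborel (\<lambda>x. indicator C x *\<^sub>R M)"
      by (rule borel_integrable_compact) (auto simp: C_def)
    show "AE x in lborel. (\<lambda>n. q n x) \<longlonglongrightarrow> w' x"
    proof (rule AE_I2)
      fix x
      have "((\<lambda>t. (w (x + t *\<^sub>R v) - w x) / t) \<longlongrightarrow> w' x) (at 0)"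
        using d[of x] by (simp add: has_field_derivative_iff)
      moreover have "filterlim (\<lambda>n. 1 / real (Suc n)) (at 0) sequentially"
        using LIMSEQ_inverse_real_of_nat by (auto simp: filterlim_at inverse_eq_divide)
      ultimately show "(\<lambda>n. q n x) \<longlonglongrightarrow> w' x"
        unfolding q_def by (rule filterlim_compose)
    qed
    show "AE x in lborel. norm (q n x) \<le> indicator C x *\<^sub>R M" for n
    proof (rule AE_I2)
      fix x
      let ?t = "1 / real (Suc n)"
      have t: "0 < ?t" "?t \<le> 1" by auto
      show "norm (q n x) \<le> indicator C x *\<^sub>R M"
      proof (cases "x \<in> C")
        case False
        then have x: "norm x > R + norm v" by (simp add: C_def)
        have "norm (?t *\<^sub>R v) \<le> norm v" using t mult_right_mono[of ?t 1 "norm v"] by simp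
        then have "norm (x + ?t *\<^sub>R v) > R"
          using x norm_triangle_ineq2[of x "- (?t *\<^sub>R v)"] by simp
        moreover have "norm x > R" using x norm_ge_zero[of v] by linarith
        ultimately have "q n x = 0" unfolding q_def by (simp add: wC)
        then show ?thesis using False by simp
      next
        case True
        obtain s where s: "0 < s" "s < ?t" "w (x + ?t *\<^sub>R v) - w (x + 0 *\<^sub>R v) = (?t - 0) * w' (x + s *\<^sub>R v)"
          using MVT2[OF t(1), of "\<lambda>t. w (x + t *\<^sub>R v)" "\<lambda>s. w' (x + s *\<^sub>R v)"] shift by blast
        then have "q n x = w' (x + s *\<^sub>R v)" by (simp add: q_def)
        moreover have "norm (s *\<^sub>R v) \<le> norm v" using s(1) less_le_trans[OF s(2) t(2)] mult_right_mono[of s 1 "norm v"] by simp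
        then have "x + s *\<^sub>R v \<in> D"
          using True norm_triangle_ineq[of x "s *\<^sub>R v"] by (simp add: C_def D_def)
        ultimately show ?thesis using M True by simp
      qed
    qed
    show "q n \<in> borel_measurable lborel" for n
      unfolding q_def using wi wi' borel_measurable_integrable by (intro borel_measurable_divide borel_measurable_diff) auto
  qed (use wm in simp_all)
  then show ?thesis by (simp add: q0 LIMSEQ_const_iff)
qed

lemma iter_pd_zero: "iter_pd vs (\<lambda>_. 0) = (\<lambda>_. 0)"
  by (induction vs) auto

lemma iter_pd_support:
  assumes "x \<notin> closure {x. \<phi> x \<noteq> 0}"
  shows "iter_pd vs \<phi> x = 0"
proof -
  have "iter_pd vs \<phi> x = iter_pd vs (\<lambda>_. 0) x"
    using assms closure_subset[of "{x. \<phi> x \<noteq> 0}"]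
    by (intro iter_pd_cong[of "- closure {x. \<phi> x \<noteq> 0}"]) (auto simp: open_Compl)
  then show ?thesis by (simp add: iter_pd_zero)
qed

lemma test_function_iter_pd:
  assumes "test_function \<Theta> \<phi>" "set ws \<subseteq> Basis"
  shows "test_function \<Theta> (iter_pd ws \<phi>)"
proof -
  have "closure {x. iter_pd ws \<phi> x \<noteq> 0} \<subseteq> closure (closure {x. \<phi> x \<noteq> 0})"
    using iter_pd_support by (intro closure_mono) blast
  then have sub: "closure {x. iter_pd ws \<phi> x \<noteq> 0} \<subseteq> closure {x. \<phi> x \<noteq> 0}" by simp
  then have "compact (closure {x. iter_pd ws \<phi> x \<noteq> 0})"
    using assms(1) unfolding test_function_def
    by (meson bounded_subset closed_closure compact_eq_bounded_closed)
  moreover have "pd_exists UNIV vs (iter_pd ws \<phi>) \<and> continuous_on UNIV (iter_pd vs (iter_pd ws \<phi>))"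
    if "set vs \<subseteq> Basis" for vs
  proof -
    have "set (vs @ ws) \<subseteq> Basis" using that assms(2) by simp
    then have "pd_exists UNIV (vs @ ws) \<phi> \<and> continuous_on UNIV (iter_pd (vs @ ws) \<phi>)"
      using assms(1) unfolding test_function_def by blast
    then show ?thesis by (simp add: pd_exists_append iter_pd_append)
  qed
  ultimately show ?thesis using assms(1) sub unfolding test_function_def by blast
qed

lemma test_function_continuous: "test_function \<Theta> \<phi> \<Longrightarrow> continuous_on UNIV \<phi>"
  unfolding test_function_def by (metis empty_subsetI iter_pd.simps(1) list.set(1))

text \<open>\<open>u\<close> is controlled on \<Theta> only. The extension is continuous on the two
  open sets \<Theta> and the complement of \<open>K\<close>, which together cover the space.\<close>

lemma continuous_on_zero_extension:
  fixes u \<phi> :: "'a::euclidean_space \<Rightarrow> real"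
  assumes "open \<Theta>" "continuous_on \<Theta> u" "continuous_on UNIV \<phi>"
    and K: "closed K" "K \<subseteq> \<Theta>" "\<And>x. x \<notin> K \<Longrightarrow> \<phi> x = 0"
  shows "continuous_on UNIV (\<lambda>x. if x \<in> \<Theta> then u x * \<phi> x else 0)"
proof -
  have "continuous_on (\<Theta> \<union> - K) (\<lambda>x. if x \<in> \<Theta> then u x * \<phi> x else 0)"
  proof (rule continuous_on_open_Un)
    show "continuous_on \<Theta> (\<lambda>x. if x \<in> \<Theta> then u x * \<phi> x else 0)"
      using assms by (subst continuous_on_cong[where g = "\<lambda>x. u x * \<phi> x"]) (auto intro!: continuous_intros intro: continuous_on_subset)
    show "continuous_on (- K) (\<lambda>x. if x \<in> \<Theta> then u x * \<phi> x else 0)"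
      using K by (subst continuous_on_cong[where g = "\<lambda>x. 0"]) auto
  qed (use assms in \<open>auto simp: open_Compl\<close>)
  moreover have "\<Theta> \<union> - K = UNIV" using K(2) by auto
  ultimately show ?thesis by simp
qed

lemma integral_lebesgue_on_zero_extension:
  fixes f :: "'a::euclidean_space \<Rightarrow> real"
  assumes "open \<Theta>" "(\<lambda>x. if x \<in> \<Theta> then f x else 0) \<in> borel_measurable borel"
  shows "(LINT x|lebesgue_on \<Theta>. f x) = (LINT x|lborel. (if x \<in> \<Theta> then f x else 0))"
proof -
  have "(LINT x|lebesgue_on \<Theta>. f x) = (LINT x|lebesgue. indicator \<Theta> x *\<^sub>R f x)"
    using assms(1) by (simp add: integral_restrict_space)
  also have "\<dots> = (LINT x|lebesgue. (if x \<in> \<Theta> then f x else 0))"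
    by (intro Bochner_Integration.integral_cong) (auto simp: indicator_def)
  also have "\<dots> = (LINT x|lborel. (if x \<in> \<Theta> then f x else 0))"
    using assms(2) by (intro integral_completion) simp
  finally show ?thesis .
qed

text \<open>The zero extension of the product of \<open>u\<close> and \<open>\<phi>\<close> has
  compact support, so its directional derivative integrates to 0; the product rule splits that
  derivative into the two integrands.\<close>

lemma integration_by_parts:
  fixes \<Theta> :: "(real^'d::finite) set"
  assumes "open \<Theta>" and w: "w \<in> Basis"
    and u: "\<And>x. x \<in> \<Theta> \<Longrightarrow> ((\<lambda>t. u (x + t *\<^sub>R w)) has_field_derivative u' x) (at 0)"
    and c: "continuous_on \<Theta> u" "continuous_on \<Theta> u'"
    and \<phi>: "test_function \<Theta> \<phi>"
  shows "(LINT x|lebesgue_on \<Theta>. u x * iter_pd [w] \<phi> x) = - (LINT x|lebesgue_on \<Theta>. u' x * \<phi> x)"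
proof -
  define K where "K = closure {x. \<phi> x \<noteq> 0}"
  have K: "compact K" "closed K" "K \<subseteq> \<Theta>" "\<And>x. x \<notin> K \<Longrightarrow> \<phi> x = 0"
    using \<phi> closure_subset[of "{x. \<phi> x \<noteq> 0}"] unfolding K_def test_function_def by auto
  have \<phi>': "test_function \<Theta> (iter_pd [w] \<phi>)" using test_function_iter_pd[OF \<phi>, of "[w]"] w by simp
  have K': "iter_pd [w] \<phi> x = 0" if "x \<notin> K" for x using that unfolding K_def by (rule iter_pd_support)
  define F where "F = (\<lambda>x. if x \<in> \<Theta> then u x * \<phi> x else 0)"
  define F1 where "F1 = (\<lambda>x. if x \<in> \<Theta> then u x * iter_pd [w] \<phi> x else 0)"
  define F2 where "F2 = (\<lambda>x. if x \<in> \<Theta> then u' x * \<phi> x else 0)"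
  have cont: "continuous_on UNIV F" "continuous_on UNIV F1" "continuous_on UNIV F2"
    unfolding F_def F1_def F2_def
    using continuous_on_zero_extension[OF assms(1) _ _ K(2,3)] c test_function_continuous[OF \<phi>]
      test_function_continuous[OF \<phi>'] K(4) K' by auto
  have int: "integrable lborel F1" "integrable lborel F2"
    using integrable_continuous_compact_support[OF _ K(1)] cont K(4) K' by (auto simp: F1_def F2_def)
  have "pd_exists UNIV [w] \<phi>" using \<phi> w unfolding test_function_def by (metis (no_types) empty_set empty_subsetI insert_subset list.simps(15))
  from iter_pd_has_derivative[OF this]
  have d\<phi>: "((\<lambda>t. \<phi> (x + t *\<^sub>R w)) has_field_derivative iter_pd [w] \<phi> x) (at 0)" for x by simp
  have ev: "\<forall>\<^sub>F t in nhds 0. x + t *\<^sub>R w \<in> S" if "open S" "x \<in> S" for S :: "(real^'d) set" and x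
  proof -
    have "((\<lambda>t. x + t *\<^sub>R w) \<longlongrightarrow> x + 0 *\<^sub>R w) (nhds 0)" by (intro tendsto_intros filterlim_ident)
    from topological_tendstoD[OF this that(1)] that(2) show ?thesis by simp
  qed
  have dF: "((\<lambda>t. F (x + t *\<^sub>R w)) has_field_derivative (F1 x + F2 x)) (at 0)" for x
  proof (cases "x \<in> \<Theta>")
    case True
    have "((\<lambda>t. u (x + t *\<^sub>R w) * \<phi> (x + t *\<^sub>R w)) has_field_derivative (F1 x + F2 x)) (at 0)"
      using DERIV_mult[OF u[OF True] d\<phi>[of x]] True by (simp add: F1_def F2_def algebra_simps)
    moreover have "\<forall>\<^sub>F t in nhds 0. F (x + t *\<^sub>R w) = u (x + t *\<^sub>R w) * \<phi> (x + t *\<^sub>R w)"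
      using ev[OF assms(1) True] by eventually_elim (simp add: F_def)
    ultimately show ?thesis by (simp add: DERIV_cong_ev)
  next
    case False
    then have "x \<in> - K" using K by auto
    then have "\<forall>\<^sub>F t in nhds 0. F (x + t *\<^sub>R w) = 0"
      using ev[of "- K" x] K(2) by (auto simp: open_Compl F_def K(4) elim!: eventually_mono)
    then show ?thesis using False DERIV_cong_ev[OF refl _ refl, of "\<lambda>t. F (x + t *\<^sub>R w)" "\<lambda>_. 0" 0 0]
      by (simp add: F1_def F2_def)
  qed
  have "(LINT x|lborel. F1 x + F2 x) = 0"
    using K(4) by (intro integral_directional_derivative_eq_0[OF dF cont(1) _ K(1)] continuous_intros cont) (auto simp: F_def)
  then have "(LINT x|lborel. F1 x) = - (LINT x|lborel. F2 x)" using int by simp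
  moreover have "(LINT x|lebesgue_on \<Theta>. u x * iter_pd [w] \<phi> x) = (LINT x|lborel. F1 x)"
    unfolding F1_def using cont(2)
    by (intro integral_lebesgue_on_zero_extension assms(1)) (auto simp: F1_def intro: borel_measurable_continuous_onI)
  moreover have "(LINT x|lebesgue_on \<Theta>. u' x * \<phi> x) = (LINT x|lborel. F2 x)"
    unfolding F2_def using cont(3)
    by (intro integral_lebesgue_on_zero_extension assms(1)) (auto simp: F2_def intro: borel_measurable_continuous_onI)
  ultimately show ?thesis by simp
qed

section \<open>Sobolev spaces on bounded domains\<close>

lemma mi_list_0 [simp]: "mi_list (\<lambda>_. 0) = []"
  by (simp add: mi_list_def)

lemma length_mi_list: "length (mi_list \<alpha>) = (\<Sum>i\<in>UNIV. \<alpha> i)"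
proof -
  have "\<exists>is::'a list. distinct is \<and> set is = UNIV"
    using finite_distinct_list[of "UNIV :: 'a set"] by auto
  then have c: "distinct (coords :: 'a list)" "set (coords :: 'a list) = UNIV"
    unfolding coords_def by (metis (mono_tags, lifting) someI_ex)+
  have "length (mi_list \<alpha>) = sum_list (map \<alpha> coords)"
    by (simp add: mi_list_def length_concat o_def)
  also have "\<dots> = (\<Sum>i\<in>UNIV. \<alpha> i)" using c by (simp add: sum_list_distinct_conv_sum_set)
  finally show ?thesis .
qed

lemma zero_in_multi_indices [simp]: "(\<lambda>_. 0) \<in> multi_indices k"
  by (simp add: multi_indices_def)

definition dirs :: "('d::finite \<Rightarrow> nat) \<Rightarrow> (real^'d) list" where
  "dirs \<alpha> = map (\<lambda>i. axis i 1) (mi_list \<alpha>)"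

lemma dirs_Basis: "set (dirs \<alpha>) \<subseteq> Basis"
  by (auto simp: dirs_def axis_in_Basis_iff)

lemma length_dirs: "length (dirs \<alpha>) = (\<Sum>i\<in>UNIV. \<alpha> i)"
  by (simp add: dirs_def length_mi_list)

lemma length_dirs_le: "\<alpha> \<in> multi_indices k \<Longrightarrow> length (dirs \<alpha>) \<le> k"
  by (simp add: length_dirs multi_indices_def)

lemma dirs_0 [simp]: "dirs (\<lambda>_. 0) = []"
  by (simp add: dirs_def)

lemma pderiv_mi_eq: "pderiv_mi \<alpha> \<phi> = iter_pd (dirs \<alpha>) \<phi>"
  by (simp add: pderiv_mi_def dirs_def)

lemma mixed_deriv_eq_jet: "mixed_deriv \<alpha> \<beta> h (x, y) = jet_kernel h (dirs \<alpha>, x) (dirs \<beta>, y)"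
  by (simp add: mixed_deriv_def jet_kernel_def dirs_def o_def)

lemma dirs_jets: "\<alpha> \<in> multi_indices k \<Longrightarrow> x \<in> \<Theta> \<Longrightarrow> (dirs \<alpha>, x) \<in> jets \<Theta> k"
  using dirs_Basis by (auto simp: jets_def length_dirs_le)

section \<open>Integrability and weak derivatives on a bounded open set\<close>

locale bounded_domain =
  fixes \<Theta> :: "(real^'d::finite) set"
  assumes open_\<Theta>: "open \<Theta>" and bounded_\<Theta>: "bounded \<Theta>"
begin

abbreviation M where "M \<equiv> lebesgue_on \<Theta>"

lemma \<Theta>_sets [simp]: "\<Theta> \<in> sets lebesgue"
  using open_\<Theta> by simp

lemma \<Theta>_lmeasurable: "\<Theta> \<in> lmeasurable"
  using bounded_\<Theta> by (simp add: bounded_set_imp_lmeasurable)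

sublocale M: finite_measure M
  by (rule finite_measure_lebesgue_on[OF \<Theta>_lmeasurable])

lemma measure_M: "measure M \<Theta> = measure lebesgue \<Theta>"
  by (simp add: measure_restrict_space)

lemma continuous_measurable: "continuous_on \<Theta> f \<Longrightarrow> f \<in> borel_measurable M" for f :: "_ \<Rightarrow> real"
  by (rule continuous_imp_measurable_on_sets_lebesgue) auto

lemma test_measurable: "test_function \<Theta> \<phi> \<Longrightarrow> \<phi> \<in> borel_measurable M"
  using test_function_continuous[of \<Theta> \<phi>] by (intro continuous_measurable) (auto intro: continuous_on_subset)

lemma test_bounded:
  assumes "test_function \<Theta> \<phi>"
  obtains C where "\<And>x. \<bar>\<phi> x\<bar> \<le> C"
proof -
  let ?K = "closure {x. \<phi> x \<noteq> 0}"
  have "compact ?K" using assms by (simp add: test_function_def)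
  then have "bounded (\<phi> ` ?K)"
    using test_function_continuous[OF assms]
    by (intro compact_imp_bounded compact_continuous_image) (auto intro: continuous_on_subset)
  then obtain C where C: "\<And>x. x \<in> ?K \<Longrightarrow> \<bar>\<phi> x\<bar> \<le> C" by (auto simp: bounded_iff)
  have "\<bar>\<phi> x\<bar> \<le> max C 0" for x
  proof (cases "x \<in> ?K")
    case True then show ?thesis using C[of x] by simp
  next
    case False
    then have "\<phi> x = 0" using closure_subset[of "{x. \<phi> x \<noteq> 0}"] by blast
    then show ?thesis by simp
  qed
  then show thesis by (rule that)
qed

lemma integrable_mult_bounded:
  assumes "integrable M f" "g \<in> borel_measurable M" "\<And>x. x \<in> \<Theta> \<Longrightarrow> \<bar>g x\<bar> \<le> (C::real)"
  shows "integrable M (\<lambda>x. f x * g x)"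
proof (rule Bochner_Integration.integrable_bound)
  show "integrable M (\<lambda>x. C * f x)" using assms(1) by simp
  have "\<bar>f x * g x\<bar> \<le> \<bar>C * f x\<bar>" if "x \<in> \<Theta>" for x
  proof -
    have "\<bar>g x\<bar> \<le> \<bar>C\<bar>" using assms(3)[OF that] by simp
    then show ?thesis by (metis abs_ge_zero abs_mult mult.commute mult_left_mono)
  qed
  then show "AE x in M. norm (f x * g x) \<le> norm (C * f x)" by (intro AE_I2) simp
qed (use assms in simp)

lemma locally_integrable_mult_test:
  assumes "locally_integrable \<Theta> f" "test_function \<Theta> \<phi>"
  shows "integrable M (\<lambda>x. f x * \<phi> x)"
proof -
  let ?K = "closure {x. \<phi> x \<noteq> 0}"
  have K: "compact ?K" "?K \<subseteq> \<Theta>" using assms(2) by (auto simp: test_function_def)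
  then have Ks: "?K \<in> sets lebesgue" by (simp add: lmeasurable_compact fmeasurableD)
  obtain C where C: "\<And>x. \<bar>\<phi> x\<bar> \<le> C" using test_bounded[OF assms(2)] by metis
  have "integrable (lebesgue_on ?K) f" using assms(1) K by (simp add: locally_integrable_def)
  then have i: "integrable lebesgue (\<lambda>x. indicat_real ?K x * f x)" using Ks by (simp add: integrable_restrict_space)
  then have iM: "integrable M (\<lambda>x. indicat_real ?K x * f x)"
    by (simp add: integrable_restrict_space integrable_mult_indicator[where 'b = real, simplified])
  have "integrable M (\<lambda>x. (indicat_real ?K x * f x) * \<phi> x)"
    using iM test_measurable[OF assms(2)] C by (rule integrable_mult_bounded)
  also have "(\<lambda>x. (indicat_real ?K x * f x) * \<phi> x) = (\<lambda>x. f x * \<phi> x)"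
    using closure_subset[of "{x. \<phi> x \<noteq> 0}"] by (fastforce simp: indicator_def fun_eq_iff)
  finally show ?thesis .
qed

text \<open>Local integrability speaks only of compact subsets; a countable cover of \<Theta> by
  closed boxes glues their measurability together.\<close>

lemma locally_integrable_measurable:
  assumes "locally_integrable \<Theta> f"
  shows "f \<in> borel_measurable M"
proof -
  obtain D where D: "countable D" "D \<subseteq> Pow \<Theta>" "\<And>X. X \<in> D \<Longrightarrow> \<exists>a b. X = cbox a b" "\<Union>D = \<Theta>"
    using open_countable_Union_open_cbox[OF open_\<Theta>] by metis
  show ?thesis
  proof (rule measurable_piecewise_restrict[OF D(1)])
    fix X assume X: "X \<in> D"
    then obtain a b where ab: "X = cbox a b" "cbox a b \<subseteq> \<Theta>" using D by blast
    then have "X \<inter> \<Theta> = X" by auto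
    then show "X \<inter> space M \<in> sets M" using ab by (auto simp: sets_restrict_space_iff)
    have "f \<in> borel_measurable (lebesgue_on X)"
      using assms ab by (intro borel_measurable_integrable) (simp add: locally_integrable_def)
    then show "f \<in> borel_measurable (restrict_space M X)"
      using \<open>X \<inter> \<Theta> = X\<close> ab by (subst restrict_restrict_space) (auto simp: Int_commute)
  qed (use D in auto)
qed

lemma integrable_locally: "integrable M f \<Longrightarrow> locally_integrable \<Theta> f"
  unfolding locally_integrable_def
proof (intro allI impI)
  fix K :: "(real^'d) set" assume f: "integrable M f" and K: "compact K \<and> K \<subseteq> \<Theta>"
  then have Ks: "K \<in> sets lebesgue" by (simp add: lmeasurable_compact fmeasurableD)
  have "integrable lebesgue (\<lambda>x. indicat_real \<Theta> x * f x)" using f by (simp add: integrable_restrict_space)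
  from integrable_mult_indicator[OF Ks this]
  have "integrable lebesgue (\<lambda>x. indicat_real K x * (indicat_real \<Theta> x * f x))" by simp
  also have "(\<lambda>x. indicat_real K x * (indicat_real \<Theta> x * f x)) = (\<lambda>x. indicat_real K x * f x)"
    using K by (auto simp: indicator_def fun_eq_iff)
  finally show "integrable (lebesgue_on K) f" using Ks by (simp add: integrable_restrict_space)
qed

lemma locally_integrable_lin:
  assumes "locally_integrable \<Theta> f" "locally_integrable \<Theta> g"
  shows "locally_integrable \<Theta> (\<lambda>x. a * f x + b * g x)"
  using assms unfolding locally_integrable_def by simp

lemma has_weak_deriv_cong:
  assumes "has_weak_deriv \<Theta> \<alpha> f g" "ae_eq \<Theta> f f'" "locally_integrable \<Theta> f'" "ae_eq \<Theta> g g'" "locally_integrable \<Theta> g'"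
  shows "has_weak_deriv \<Theta> \<alpha> f' g'"
  unfolding has_weak_deriv_def
proof (intro conjI allI impI assms)
  fix \<phi> assume \<phi>: "test_function \<Theta> \<phi>"
  have t: "test_function \<Theta> (pderiv_mi \<alpha> \<phi>)" unfolding pderiv_mi_eq by (rule test_function_iter_pd[OF \<phi> dirs_Basis])
  have li: "locally_integrable \<Theta> f" "locally_integrable \<Theta> g" using assms(1) by (auto simp: has_weak_deriv_def)
  have 1: "(LINT x|M. f x * pderiv_mi \<alpha> \<phi> x) = (LINT x|M. f' x * pderiv_mi \<alpha> \<phi> x)"
    using assms(2,3) li \<phi> t unfolding ae_eq_def
    by (intro integral_cong_AE borel_measurable_integrable locally_integrable_mult_test) auto
  have 2: "(LINT x|M. g x * \<phi> x) = (LINT x|M. g' x * \<phi> x)"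
    using assms(4,5) li \<phi> unfolding ae_eq_def
    by (intro integral_cong_AE borel_measurable_integrable locally_integrable_mult_test) auto
  show "(LINT x|M. f' x * pderiv_mi \<alpha> \<phi> x) = (- 1) ^ sum \<alpha> UNIV * (LINT x|M. g' x * \<phi> x)"
    using assms(1) \<phi> 1 2 by (simp add: has_weak_deriv_def)
qed

lemma has_weak_deriv_unique:
  assumes "has_weak_deriv \<Theta> \<alpha> f g" "has_weak_deriv \<Theta> \<alpha> f g'"
  shows "ae_eq \<Theta> g g'"
proof -
  have li: "locally_integrable \<Theta> g" "locally_integrable \<Theta> g'" using assms by (auto simp: has_weak_deriv_def)
  have "AE x in M. g x - g' x = 0"
  proof (rule fundamental_lemma[OF open_\<Theta>])
    show "locally_integrable \<Theta> (\<lambda>x. g x - g' x)" using locally_integrable_lin[OF li, of 1 "-1"] by simp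
    fix \<phi> assume \<phi>: "test_function \<Theta> \<phi>"
    have "(- 1) ^ (\<Sum>i\<in>UNIV. \<alpha> i) * (LINT x|M. g x * \<phi> x) = (- 1) ^ (\<Sum>i\<in>UNIV. \<alpha> i) * (LINT x|M. g' x * \<phi> x)"
      using assms(1)[unfolded has_weak_deriv_def, THEN conjunct2, THEN conjunct2, rule_format, OF \<phi>]
        assms(2)[unfolded has_weak_deriv_def, THEN conjunct2, THEN conjunct2, rule_format, OF \<phi>] by (rule_tac trans[OF sym])
    then have "(LINT x|M. g x * \<phi> x) = (LINT x|M. g' x * \<phi> x)" by simp
    moreover have "(LINT x|M. (g x - g' x) * \<phi> x) = (LINT x|M. g x * \<phi> x) - (LINT x|M. g' x * \<phi> x)"
      using locally_integrable_mult_test[OF li(1) \<phi>] locally_integrable_mult_test[OF li(2) \<phi>]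
      by (simp add: left_diff_distrib)
    ultimately show "(LINT x|M. (g x - g' x) * \<phi> x) = 0" by simp
  qed
  then show ?thesis by (simp add: ae_eq_def)
qed

lemma has_weak_deriv_lin:
  assumes "has_weak_deriv \<Theta> \<alpha> f f'" "has_weak_deriv \<Theta> \<alpha> g g'"
  shows "has_weak_deriv \<Theta> \<alpha> (\<lambda>x. a * f x + b * g x) (\<lambda>x. a * f' x + b * g' x)"
  unfolding has_weak_deriv_def
proof (intro conjI allI impI)
  have li: "locally_integrable \<Theta> f" "locally_integrable \<Theta> g" "locally_integrable \<Theta> f'" "locally_integrable \<Theta> g'"
    using assms by (auto simp: has_weak_deriv_def)
  show "locally_integrable \<Theta> (\<lambda>x. a * f x + b * g x)" "locally_integrable \<Theta> (\<lambda>x. a * f' x + b * g' x)"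
    by (intro locally_integrable_lin li)+
  fix \<phi> assume \<phi>: "test_function \<Theta> \<phi>"
  have t: "test_function \<Theta> (pderiv_mi \<alpha> \<phi>)" unfolding pderiv_mi_eq by (rule test_function_iter_pd[OF \<phi> dirs_Basis])
  have lin: "(LINT x|M. (a * u x + b * v x) * \<psi> x) = a * (LINT x|M. u x * \<psi> x) + b * (LINT x|M. v x * \<psi> x)"
    if "locally_integrable \<Theta> u" "locally_integrable \<Theta> v" "test_function \<Theta> \<psi>" for u v \<psi>
    using locally_integrable_mult_test[OF that(1,3)] locally_integrable_mult_test[OF that(2,3)]
    by (simp add: distrib_right mult.assoc)
  show "(LINT x|M. (a * f x + b * g x) * pderiv_mi \<alpha> \<phi> x) = (- 1) ^ sum \<alpha> UNIV * (LINT x|M. (a * f' x + b * g' x) * \<phi> x)"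
    using assms \<phi> unfolding lin[OF li(1,2) t] lin[OF li(3,4) \<phi>] by (simp add: has_weak_deriv_def algebra_simps)
qed

lemma has_weak_deriv_0: "locally_integrable \<Theta> f \<Longrightarrow> has_weak_deriv \<Theta> (\<lambda>_. 0) f f"
  by (simp add: has_weak_deriv_def pderiv_mi_eq)

lemma ae_eq_sym: "ae_eq \<Theta> f g \<Longrightarrow> ae_eq \<Theta> g f"
  unfolding ae_eq_def by (erule eventually_mono) simp

lemma ae_eq_trans: "ae_eq \<Theta> f g \<Longrightarrow> ae_eq \<Theta> g h \<Longrightarrow> ae_eq \<Theta> f h"
  unfolding ae_eq_def by (erule (1) eventually_elim2) simp

lemma ae_eq_refl [simp]: "ae_eq \<Theta> f f"
  by (simp add: ae_eq_def)

lemma ae_eq_lin: "ae_eq \<Theta> f f' \<Longrightarrow> ae_eq \<Theta> g g' \<Longrightarrow> ae_eq \<Theta> (\<lambda>x. a * f x + b * g x) (\<lambda>x. a * f' x + b * g' x)"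
  unfolding ae_eq_def by (erule (1) eventually_elim2) simp

lemma ae_eqI: "(\<And>x. x \<in> \<Theta> \<Longrightarrow> f x = g x) \<Longrightarrow> ae_eq \<Theta> f g"
  unfolding ae_eq_def by (rule AE_I2) simp

lemma L2_integrable_mult:
  assumes "f \<in> L2 \<Theta>" "g \<in> L2 \<Theta>"
  shows "integrable M (\<lambda>x. f x * g x)"
proof (rule Bochner_Integration.integrable_bound)
  show "integrable M (\<lambda>x. (f x)\<^sup>2 + (g x)\<^sup>2)" using assms by (auto simp: L2_def)
  have "\<bar>a * b\<bar> \<le> \<bar>a\<^sup>2 + b\<^sup>2\<bar>" for a b :: real
    using sum_squares_bound[of a b] sum_squares_bound[of a "-b"] by (simp add: abs_le_iff power2_eq_square)
  then show "AE x in M. norm (f x * g x) \<le> norm ((f x)\<^sup>2 + (g x)\<^sup>2)" by (intro AE_I2) simp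
qed (use assms in \<open>auto simp: L2_def\<close>)

lemma L2_lin:
  assumes "f \<in> L2 \<Theta>" "g \<in> L2 \<Theta>"
  shows "(\<lambda>x. a * f x + b * g x) \<in> L2 \<Theta>"
proof -
  have "(\<lambda>x. (a * f x + b * g x)\<^sup>2) = (\<lambda>x. a\<^sup>2 * (f x)\<^sup>2 + b\<^sup>2 * (g x)\<^sup>2 + (2 * a * b) * (f x * g x))"
    by (simp add: power2_eq_square algebra_simps)
  then show ?thesis using assms L2_integrable_mult[OF assms] by (auto simp: L2_def)
qed

lemma L2_measurable: "f \<in> L2 \<Theta> \<Longrightarrow> f \<in> borel_measurable M"
  by (simp add: L2_def)

lemma L2_bounded:
  assumes "f \<in> borel_measurable M" "\<And>x. x \<in> \<Theta> \<Longrightarrow> \<bar>f x\<bar> \<le> C"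
  shows "f \<in> L2 \<Theta>"
proof -
  have "integrable M (\<lambda>x. (f x)\<^sup>2)"
  proof (rule M.integrable_const_bound)
    have "(f x)\<^sup>2 \<le> C\<^sup>2" if "x \<in> \<Theta>" for x
      using assms(2)[OF that] by (metis abs_ge_zero power2_abs power_mono)
    then show "AE x in M. norm ((f x)\<^sup>2) \<le> C\<^sup>2" by (intro AE_I2) simp
  qed (use assms in simp)
  then show ?thesis using assms(1) by (simp add: L2_def)
qed

lemma L2_integrable: "f \<in> L2 \<Theta> \<Longrightarrow> integrable M f"
  using L2_integrable_mult[OF _ L2_bounded[of "\<lambda>_. 1" 1]] by simp

lemma L2_locally_integrable: "f \<in> L2 \<Theta> \<Longrightarrow> locally_integrable \<Theta> f"
  by (intro integrable_locally L2_integrable)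

lemma L2_cong:
  assumes "f \<in> L2 \<Theta>" "ae_eq \<Theta> f g" "g \<in> borel_measurable M"
  shows "g \<in> L2 \<Theta>"
proof -
  have "integrable M (\<lambda>x. (g x)\<^sup>2)"
  proof (rule integrable_cong_AE_imp)
    show "integrable M (\<lambda>x. (f x)\<^sup>2)" using assms by (simp add: L2_def)
    show "AE x in M. (f x)\<^sup>2 = (g x)\<^sup>2" using assms(2) unfolding ae_eq_def by eventually_elim simp
  qed (use assms in simp)
  then show ?thesis using assms by (simp add: L2_def)
qed

lemma L2_norm_zero:
  assumes "f \<in> L2 \<Theta>"
  shows "(LINT x|M. f x * f x) = 0 \<longleftrightarrow> ae_eq \<Theta> f (\<lambda>_. 0)"
  using integral_nonneg_eq_0_iff_AE[of M "\<lambda>x. f x * f x"] L2_integrable_mult[OF assms assms]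
  by (simp add: ae_eq_def)

lemma has_weak_deriv_weak_deriv:
  assumes "has_weak_deriv \<Theta> \<alpha> f g"
  shows "has_weak_deriv \<Theta> \<alpha> f (weak_deriv \<Theta> \<alpha> f)" "ae_eq \<Theta> (weak_deriv \<Theta> \<alpha> f) g"
proof -
  show "has_weak_deriv \<Theta> \<alpha> f (weak_deriv \<Theta> \<alpha> f)" 
    unfolding weak_deriv_def by (rule someI[where P = "has_weak_deriv \<Theta> \<alpha> f", OF assms])
  then show "ae_eq \<Theta> (weak_deriv \<Theta> \<alpha> f) g" using assms by (rule has_weak_deriv_unique)
qed

text \<open>\<open>weak_deriv\<close> picks an arbitrary weak derivative, not necessarily the
  square-integrable one from the definition of \<open>sobolev\<close>. Uniqueness almost everywhere
  carries square integrability over to it.\<close>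

lemma sobolevD:
  assumes "f \<in> sobolev k \<Theta>" "\<alpha> \<in> multi_indices k"
  shows "has_weak_deriv \<Theta> \<alpha> f (weak_deriv \<Theta> \<alpha> f)" "weak_deriv \<Theta> \<alpha> f \<in> L2 \<Theta>"
proof -
  obtain g where g: "g \<in> L2 \<Theta>" "has_weak_deriv \<Theta> \<alpha> f g" using assms by (auto simp: sobolev_def)
  show w: "has_weak_deriv \<Theta> \<alpha> f (weak_deriv \<Theta> \<alpha> f)" using has_weak_deriv_weak_deriv(1)[OF g(2)] .
  have "weak_deriv \<Theta> \<alpha> f \<in> borel_measurable M"
    using w by (intro locally_integrable_measurable) (simp add: has_weak_deriv_def)
  then show "weak_deriv \<Theta> \<alpha> f \<in> L2 \<Theta>"
    using L2_cong[OF g(1) ae_eq_sym[OF has_weak_deriv_weak_deriv(2)[OF g(2)]]] by blast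
qed

text \<open>The multi-index 0 is among those listed, and its weak derivative is \<open>f\<close>
  almost everywhere; so \<open>g\<close> at 0 also certifies that \<open>f\<close> itself is
  square-integrable.\<close>

lemma sobolevI:
  assumes "\<And>\<alpha>. \<alpha> \<in> multi_indices k \<Longrightarrow> has_weak_deriv \<Theta> \<alpha> f (g \<alpha>)"
    "\<And>\<alpha>. \<alpha> \<in> multi_indices k \<Longrightarrow> g \<alpha> \<in> L2 \<Theta>"
  shows "f \<in> sobolev k \<Theta>"
proof -
  have f0: "has_weak_deriv \<Theta> (\<lambda>_. 0) f (g (\<lambda>_. 0))" by (rule assms(1)[OF zero_in_multi_indices])
  then have li: "locally_integrable \<Theta> f" by (simp add: has_weak_deriv_def)
  have "ae_eq \<Theta> (g (\<lambda>_. 0)) f" using has_weak_deriv_unique[OF f0 has_weak_deriv_0[OF li]] .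
  then have "f \<in> L2 \<Theta>"
    using L2_cong[OF assms(2)[OF zero_in_multi_indices] _ locally_integrable_measurable[OF li]] by simp
  then show ?thesis using assms by (auto simp: sobolev_def)
qed

section \<open>Square-integrable families and the embedding of the Sobolev space into them\<close>

definition L2_family :: "nat \<Rightarrow> (('d \<Rightarrow> nat) \<times> (real^'d) \<Rightarrow> real) set" where
  "L2_family k = {F. \<forall>\<alpha>\<in>multi_indices k. (\<lambda>x. F (\<alpha>, x)) \<in> L2 \<Theta>}"

definition family_inner :: "nat \<Rightarrow> (('d \<Rightarrow> nat) \<times> (real^'d) \<Rightarrow> real) \<Rightarrow> (('d \<Rightarrow> nat) \<times> (real^'d) \<Rightarrow> real) \<Rightarrow> real" where
  "family_inner k F G = (\<Sum>\<alpha>\<in>multi_indices k. LINT x|M. F (\<alpha>, x) * G (\<alpha>, x))"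

definition weak_derivs :: "(real^'d \<Rightarrow> real) \<Rightarrow> ('d \<Rightarrow> nat) \<times> (real^'d) \<Rightarrow> real" where
  "weak_derivs f = (\<lambda>(\<alpha>, x). weak_deriv \<Theta> \<alpha> f x)"

text \<open>A family is one function of the pair of multi-index and point, so its linear structure
  is pointwise as the locale demands. Components of order above \<open>k\<close> are arbitrary and
  invisible to the inner product.\<close>

lemma semi_inner_family: "semi_inner (L2_family k) (family_inner k)"
proof
  have "(\<lambda>_. 0) \<in> L2_family k" by (auto simp: L2_family_def intro!: L2_bounded[where C = 0])
  then show "L2_family k \<noteq> {}" by blast
  show "(\<lambda>x. a * f x + b * g x) \<in> L2_family k" if "f \<in> L2_family k" "g \<in> L2_family k" for f g a b
    using that by (auto simp: L2_family_def intro: L2_lin)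
  show "family_inner k (\<lambda>x. a * f x + b * g x) u = a * family_inner k f u + b * family_inner k g u"
    if "f \<in> L2_family k" "g \<in> L2_family k" "u \<in> L2_family k" for f g u a b
  proof -
    have "(LINT x|M. (a * f (\<alpha>, x) + b * g (\<alpha>, x)) * u (\<alpha>, x)) = a * (LINT x|M. f (\<alpha>, x) * u (\<alpha>, x)) + b * (LINT x|M. g (\<alpha>, x) * u (\<alpha>, x))"
      if "\<alpha> \<in> multi_indices k" for \<alpha>
    proof -
      have "integrable M (\<lambda>x. f (\<alpha>, x) * u (\<alpha>, x))" "integrable M (\<lambda>x. g (\<alpha>, x) * u (\<alpha>, x))"
        using that \<open>f \<in> L2_family k\<close> \<open>g \<in> L2_family k\<close> \<open>u \<in> L2_family k\<close>
        by (auto simp: L2_family_def intro: L2_integrable_mult)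
      then show ?thesis by (simp add: distrib_right mult.assoc)
    qed
    then show ?thesis by (simp add: family_inner_def sum.distrib sum_distrib_left)
  qed
  show "family_inner k f g = family_inner k g f" for f g
    by (simp add: family_inner_def mult.commute)
  show "0 \<le> family_inner k f f" for f
    unfolding family_inner_def by (intro sum_nonneg integral_nonneg) simp
qed

lemma family_inner_null:
  assumes "F \<in> L2_family k"
  shows "family_inner k F F = 0 \<longleftrightarrow> (\<forall>\<alpha>\<in>multi_indices k. ae_eq \<Theta> (\<lambda>x. F (\<alpha>, x)) (\<lambda>_. 0))"
proof -
  have "family_inner k F F = 0 \<longleftrightarrow> (\<forall>\<alpha>\<in>multi_indices k. (LINT x|M. F (\<alpha>, x) * F (\<alpha>, x)) = 0)"
    unfolding family_inner_def by (subst sum_nonneg_eq_0_iff) (auto intro: integral_nonneg)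
  then show ?thesis using L2_norm_zero assms by (simp add: L2_family_def)
qed

lemma family_inner_cong:
  assumes "F \<in> L2_family k" "F' \<in> L2_family k" "G \<in> L2_family k" "G' \<in> L2_family k"
    "\<And>\<alpha>. \<alpha> \<in> multi_indices k \<Longrightarrow> ae_eq \<Theta> (\<lambda>x. F (\<alpha>, x)) (\<lambda>x. F' (\<alpha>, x))"
    "\<And>\<alpha>. \<alpha> \<in> multi_indices k \<Longrightarrow> ae_eq \<Theta> (\<lambda>x. G (\<alpha>, x)) (\<lambda>x. G' (\<alpha>, x))"
  shows "family_inner k F G = family_inner k F' G'"
  unfolding family_inner_def
proof (intro sum.cong refl integral_cong_AE)
  fix \<alpha> :: "'d \<Rightarrow> nat" assume \<alpha>: "\<alpha> \<in> multi_indices k"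
  show "AE x in M. F (\<alpha>, x) * G (\<alpha>, x) = F' (\<alpha>, x) * G' (\<alpha>, x)"
    using assms(5)[OF \<alpha>] assms(6)[OF \<alpha>] unfolding ae_eq_def by eventually_elim simp
  show "(\<lambda>x. F (\<alpha>, x) * G (\<alpha>, x)) \<in> borel_measurable M" "(\<lambda>x. F' (\<alpha>, x) * G' (\<alpha>, x)) \<in> borel_measurable M"
    using assms(1-4) \<alpha> by (intro borel_measurable_integrable L2_integrable_mult; simp add: L2_family_def)+
qed

lemma sob_inner_eq: "sob_inner k \<Theta> f g = family_inner k (weak_derivs f) (weak_derivs g)"
  by (simp add: sob_inner_def family_inner_def weak_derivs_def)

lemma weak_derivs_family: "f \<in> sobolev k \<Theta> \<Longrightarrow> weak_derivs f \<in> L2_family k"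
  by (simp add: L2_family_def weak_derivs_def sobolevD)

lemma sobolev_lin:
  assumes "f \<in> sobolev k \<Theta>" "g \<in> sobolev k \<Theta>"
  shows "(\<lambda>x. a * f x + b * g x) \<in> sobolev k \<Theta>"
    "\<alpha> \<in> multi_indices k \<Longrightarrow> ae_eq \<Theta> (weak_deriv \<Theta> \<alpha> (\<lambda>x. a * f x + b * g x))
       (\<lambda>x. a * weak_deriv \<Theta> \<alpha> f x + b * weak_deriv \<Theta> \<alpha> g x)"
proof -
  note w = has_weak_deriv_lin[OF sobolevD(1)[OF assms(1)] sobolevD(1)[OF assms(2)]]
  show "(\<lambda>x. a * f x + b * g x) \<in> sobolev k \<Theta>"
    by (rule sobolevI[OF w L2_lin]) (use sobolevD assms in auto)
  show "ae_eq \<Theta> (weak_deriv \<Theta> \<alpha> (\<lambda>x. a * f x + b * g x)) (\<lambda>x. a * weak_deriv \<Theta> \<alpha> f x + b * weak_deriv \<Theta> \<alpha> g x)"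
    if "\<alpha> \<in> multi_indices k" by (rule has_weak_deriv_weak_deriv(2)[OF w[OF that that]])
qed

lemma semi_inner_sobolev: "semi_inner (sobolev k \<Theta>) (sob_inner k \<Theta>)"
proof
  interpret F: semi_inner "L2_family k" "family_inner k" by (rule semi_inner_family)
  have "has_weak_deriv \<Theta> \<alpha> (\<lambda>_. 0) (\<lambda>_. 0)" for \<alpha>
    by (simp add: has_weak_deriv_def locally_integrable_def)
  then have "(\<lambda>_. 0) \<in> sobolev k \<Theta>" by (rule sobolevI) (auto intro: L2_bounded[where C = 0])
  then show "sobolev k \<Theta> \<noteq> {}" by blast
  show "(\<lambda>x. a * f x + b * g x) \<in> sobolev k \<Theta>" if "f \<in> sobolev k \<Theta>" "g \<in> sobolev k \<Theta>" for f g a b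
    using sobolev_lin(1) that .
  show "sob_inner k \<Theta> (\<lambda>x. a * f x + b * g x) u = a * sob_inner k \<Theta> f u + b * sob_inner k \<Theta> g u"
    if "f \<in> sobolev k \<Theta>" "g \<in> sobolev k \<Theta>" "u \<in> sobolev k \<Theta>" for f g u a b
  proof -
    have "sob_inner k \<Theta> (\<lambda>x. a * f x + b * g x) u
       = family_inner k (\<lambda>p. a * weak_derivs f p + b * weak_derivs g p) (weak_derivs u)"
      unfolding sob_inner_eq using that sobolev_lin[OF that(1,2)]
      by (intro family_inner_cong weak_derivs_family F.lincomb) (auto simp: weak_derivs_def)
    then show ?thesis using that by (simp add: F.ip_lin weak_derivs_family sob_inner_eq)
  qed
  show "sob_inner k \<Theta> f g = sob_inner k \<Theta> g f" for f g
    by (simp add: sob_inner_def mult.commute)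
  show "0 \<le> sob_inner k \<Theta> f f" for f
    unfolding sob_inner_def by (intro sum_nonneg integral_nonneg) simp
qed

text \<open>The component of order 0 recovers \<open>f\<close>. Conversely, a function that vanishes
  almost everywhere has the weak derivative 0 for every multi-index, and weak derivatives are
  unique.\<close>

lemma sob_inner_null:
  assumes "f \<in> sobolev k \<Theta>"
  shows "sob_inner k \<Theta> f f = 0 \<longleftrightarrow> ae_eq \<Theta> f (\<lambda>_. 0)"
proof
  have li: "locally_integrable \<Theta> f" using assms by (intro L2_locally_integrable) (simp add: sobolev_def)
  have w0: "ae_eq \<Theta> (weak_deriv \<Theta> (\<lambda>_. 0) f) f"
    by (rule has_weak_deriv_weak_deriv(2)[OF has_weak_deriv_0[OF li]])
  assume "sob_inner k \<Theta> f f = 0"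
  then have "ae_eq \<Theta> (weak_deriv \<Theta> (\<lambda>_. 0) f) (\<lambda>_. 0)"
    using family_inner_null[OF weak_derivs_family[OF assms]] unfolding sob_inner_eq
    by (auto simp: weak_derivs_def)
  then show "ae_eq \<Theta> f (\<lambda>_. 0)" using w0 ae_eq_sym ae_eq_trans by blast
next
  assume z: "ae_eq \<Theta> f (\<lambda>_. 0)"
  have "ae_eq \<Theta> (weak_deriv \<Theta> \<alpha> f) (\<lambda>_. 0)" if \<alpha>: "\<alpha> \<in> multi_indices k" for \<alpha>
  proof (rule has_weak_deriv_unique)
    have wf: "has_weak_deriv \<Theta> \<alpha> f (weak_deriv \<Theta> \<alpha> f)" using sobolevD(1)[OF assms \<alpha>] .
    then have li: "locally_integrable \<Theta> (weak_deriv \<Theta> \<alpha> f)" by (simp add: has_weak_deriv_def)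
    show "has_weak_deriv \<Theta> \<alpha> (\<lambda>_. 0) (weak_deriv \<Theta> \<alpha> f)"
      by (rule has_weak_deriv_cong[OF wf z _ ae_eq_refl li]) (simp add: locally_integrable_def)
    show "has_weak_deriv \<Theta> \<alpha> (\<lambda>_. 0) (\<lambda>_. 0)"
      by (simp add: has_weak_deriv_def locally_integrable_def)
  qed
  then show "sob_inner k \<Theta> f f = 0"
    using family_inner_null[OF weak_derivs_family[OF assms]] unfolding sob_inner_eq
    by (auto simp: weak_derivs_def)
qed

lemma ae_eq_iff_sob_inner:
  assumes "f \<in> sobolev k \<Theta>" "g \<in> sobolev k \<Theta>"
  shows "ae_eq \<Theta> f g \<longleftrightarrow> sob_inner k \<Theta> (\<lambda>x. f x - g x) (\<lambda>x. f x - g x) = 0"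
proof -
  have "(\<lambda>x. f x - g x) \<in> sobolev k \<Theta>" using semi_inner.diff_in[OF semi_inner_sobolev assms] .
  from sob_inner_null[OF this] show ?thesis by (simp add: ae_eq_def)
qed

section \<open>Partitions into cells and equicontinuous families\<close>

text \<open>The compact closure is covered by finitely many balls, and each point is sent to the
  first ball in a fixed enumeration that contains it, which makes the cells disjoint and measurable.
  The centres lie in \<Theta>, so kernels can be evaluated there.\<close>

lemma cells:
  assumes "\<delta> > 0"
  obtains P q where "finite P" "P \<subseteq> \<Theta>" "\<And>x. x \<in> \<Theta> \<Longrightarrow> q x \<in> P \<and> dist x (q x) < \<delta>"
    "\<And>p. {x \<in> \<Theta>. q x = p} \<in> sets M"
proof -
  have "compact (closure \<Theta>)" using bounded_\<Theta> by simp
  moreover have "closure \<Theta> \<subseteq> (\<Union>p\<in>\<Theta>. ball p \<delta>)"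
    using assms by (auto simp: closure_approachable)
  ultimately obtain P where P: "P \<subseteq> \<Theta>" "finite P" "closure \<Theta> \<subseteq> (\<Union>p\<in>P. ball p \<delta>)"
    using compactE_image[of "closure \<Theta>" \<Theta> "\<lambda>p. ball p \<delta>"] open_ball by metis
  obtain ps where ps: "set ps = P" using finite_list[OF P(2)] by auto
  define n where "n = length ps"
  define i where "i = (\<lambda>x. LEAST i. i < n \<and> dist x (ps ! i) < \<delta>)"
  have ex: "\<exists>i. i < n \<and> dist x (ps ! i) < \<delta>" if "x \<in> \<Theta>" for x
  proof -
    have "x \<in> (\<Union>p\<in>P. ball p \<delta>)" using that P(3) closure_subset[of \<Theta>] by blast
    then obtain p where "p \<in> P" "dist p x < \<delta>" by auto
    moreover from \<open>p \<in> P\<close> obtain l where "l < n" "ps ! l = p"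
      using ps by (metis in_set_conv_nth n_def)
    ultimately show ?thesis by (auto simp: dist_commute)
  qed
  have i: "i x < n \<and> dist x (ps ! i x) < \<delta>" if "x \<in> \<Theta>" for x
    unfolding i_def using ex[OF that] by (rule LeastI_ex)
  have meas: "{x \<in> \<Theta>. i x = j} \<in> sets M" for j
  proof -
    have B: "ball (ps ! l) \<delta> \<inter> \<Theta> \<in> sets M" for l by (auto simp: sets_restrict_space_iff intro!: sets.Int)
    have "{x \<in> \<Theta>. i x = j} = (if j < n then (ball (ps ! j) \<delta> \<inter> \<Theta>) - (\<Union>l<j. ball (ps ! l) \<delta> \<inter> \<Theta>) else {})"
    proof (cases "j < n")
      case True
      have iff: "i x = j \<longleftrightarrow> dist x (ps ! j) < \<delta> \<and> (\<forall>l<j. \<not> dist x (ps ! l) < \<delta>)" if "x \<in> \<Theta>" for x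
      proof
        assume "i x = j"
        then show "dist x (ps ! j) < \<delta> \<and> (\<forall>l<j. \<not> dist x (ps ! l) < \<delta>)"
          using i[OF that] not_less_Least[of _ "\<lambda>i. i < n \<and> dist x (ps ! i) < \<delta>"] True
          by (auto simp: i_def)
      next
        assume "dist x (ps ! j) < \<delta> \<and> (\<forall>l<j. \<not> dist x (ps ! l) < \<delta>)"
        then show "i x = j" unfolding i_def using True
          by (intro Least_equality) (auto simp: not_less[symmetric])
      qed
      have R: "x \<in> (ball (ps ! j) \<delta> \<inter> \<Theta>) - (\<Union>l<j. ball (ps ! l) \<delta> \<inter> \<Theta>) \<longleftrightarrow>
          x \<in> \<Theta> \<and> dist x (ps ! j) < \<delta> \<and> (\<forall>l<j. \<not> dist x (ps ! l) < \<delta>)" for x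
        by (auto simp: dist_commute)
      show ?thesis unfolding if_P[OF True] set_eq_iff R mem_Collect_eq using iff by blast
    next
      case False
      then show ?thesis using i by auto
    qed
    also have "\<dots> \<in> sets M"
    proof (cases "j < n")
      case True
      show ?thesis unfolding if_P[OF True] by (intro sets.Diff sets.finite_UN B finite_lessThan)
    qed simp
    finally show ?thesis .
  qed
  show thesis
  proof (rule that[OF P(2,1), of "\<lambda>x. ps ! i x"])
    show "ps ! i x \<in> P \<and> dist x (ps ! i x) < \<delta>" if "x \<in> \<Theta>" for x
      using i[OF that] ps by (auto simp: n_def)
    have "{x \<in> \<Theta>. ps ! i x = p} = (\<Union>j\<in>{j. j < n \<and> ps ! j = p}. {x \<in> \<Theta>. i x = j})" for p
      using i by auto
    then show "{x \<in> \<Theta>. ps ! i x = p} \<in> sets M" for p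
      using meas by (auto intro!: sets.finite_UN)
  qed
qed

text \<open>At a point \<open>x\<close> only the summand \<open>p = q x\<close> survives. Sums over
  sample points, weighted with cell integrals of a density, thereby become integrals in which the
  argument of \<open>\<Phi>\<close> is rounded to its cell centre.\<close>

lemma cell_sum:
  assumes P: "finite P" "\<And>x. x \<in> \<Theta> \<Longrightarrow> q x \<in> P" "\<And>p. {x \<in> \<Theta>. q x = p} \<in> sets M"
    and g: "integrable M g"
  shows "(\<Sum>p\<in>P. \<Phi> p * (LINT x|M. indicator {x \<in> \<Theta>. q x = p} x * g x)) = (LINT x|M. \<Phi> (q x) * g x)"
    "integrable M (\<lambda>x. \<Phi> (q x) * g x :: real)"
proof -
  have i: "integrable M (\<lambda>x. \<Phi> p * (indicator {x \<in> \<Theta>. q x = p} x * g x))" for p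
    using integrable_mult_indicator[OF P(3) g] by simp
  have eq: "(\<Sum>p\<in>P. \<Phi> p * (indicator {x \<in> \<Theta>. q x = p} x * g x)) = \<Phi> (q x) * g x" if "x \<in> \<Theta>" for x
  proof -
    have "(\<Sum>p\<in>P. \<Phi> p * (indicator {x \<in> \<Theta>. q x = p} x * g x)) = (\<Sum>p\<in>P. if p = q x then \<Phi> (q x) * g x else 0)"
      using that by (intro sum.cong) auto
    then show ?thesis using P(1) P(2)[OF that] by simp
  qed
  have "(\<Sum>p\<in>P. \<Phi> p * (LINT x|M. indicator {x \<in> \<Theta>. q x = p} x * g x))
     = (LINT x|M. (\<Sum>p\<in>P. \<Phi> p * (indicator {x \<in> \<Theta>. q x = p} x * g x)))"
    using i by (subst Bochner_Integration.integral_sum) auto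
  also have "\<dots> = (LINT x|M. \<Phi> (q x) * g x)"
    by (intro Bochner_Integration.integral_cong refl eq) simp
  finally show "(\<Sum>p\<in>P. \<Phi> p * (LINT x|M. indicator {x \<in> \<Theta>. q x = p} x * g x)) = (LINT x|M. \<Phi> (q x) * g x)" .
  have "integrable M (\<lambda>x. (\<Sum>p\<in>P. \<Phi> p * (indicator {x \<in> \<Theta>. q x = p} x * g x)))"
    using i by (intro Bochner_Integration.integrable_sum)
  moreover have "integrable M (\<lambda>x. (\<Sum>p\<in>P. \<Phi> p * (indicator {x \<in> \<Theta>. q x = p} x * g x))) \<longleftrightarrow> integrable M (\<lambda>x. \<Phi> (q x) * g x)"
    by (intro Bochner_Integration.integrable_cong refl eq) simp
  ultimately show "integrable M (\<lambda>x. \<Phi> (q x) * g x)" by simp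
qed

lemma integral_abs_bound_mult:
  assumes "integrable M f" "integrable M (\<lambda>x. u x * f x)" "\<And>x. x \<in> \<Theta> \<Longrightarrow> \<bar>u x\<bar> \<le> (c::real)"
  shows "\<bar>LINT x|M. u x * f x\<bar> \<le> c * (LINT x|M. \<bar>f x\<bar>)"
proof -
  have "\<bar>LINT x|M. u x * f x\<bar> \<le> (LINT x|M. \<bar>u x * f x\<bar>)"
    using integral_norm_bound[of M "\<lambda>x. u x * f x"] by simp
  also have "\<dots> \<le> (LINT x|M. c * \<bar>f x\<bar>)"
  proof (rule integral_mono)
    show "integrable M (\<lambda>x. \<bar>u x * f x\<bar>)" using assms(2) by (rule integrable_abs)
    show "integrable M (\<lambda>x. c * \<bar>f x\<bar>)" using assms(1) by simp
    show "\<bar>u x * f x\<bar> \<le> c * \<bar>f x\<bar>" if "x \<in> space M" for x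
      using assms(3) that by (simp add: abs_mult mult_right_mono)
  qed
  finally show ?thesis by simp
qed

text \<open>Uniformly continuous functions on \<Theta> extend to the compact closure, where the
  classical theorem holds. Boundedness and equicontinuity pass to the extensions by limits along
  sequences in \<Theta>; the modulus for \<open>e / 2\<close> is used since limits preserve only
  weak inequalities.\<close>

lemma arzela_ascoli_open:
  fixes f :: "nat \<Rightarrow> real^'d \<Rightarrow> real"
  assumes bd: "\<And>n x. x \<in> \<Theta> \<Longrightarrow> \<bar>f n x\<bar> \<le> C"
    and eq: "\<And>e. e > 0 \<Longrightarrow> \<exists>d>0. \<forall>n. \<forall>x\<in>\<Theta>. \<forall>y\<in>\<Theta>. dist x y < d \<longrightarrow> \<bar>f n x - f n y\<bar> \<le> e"
  obtains r g where "strict_mono (r :: nat \<Rightarrow> nat)"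
    "\<And>e. e > 0 \<Longrightarrow> \<exists>N. \<forall>n\<ge>N. \<forall>x\<in>\<Theta>. \<bar>f (r n) x - g x\<bar> < e"
proof -
  have uc: "uniformly_continuous_on \<Theta> (f n)" for n
    unfolding uniformly_continuous_on_def
  proof (intro allI impI)
    fix e :: real assume "e > 0"
    then obtain d where d: "d > 0" "\<forall>n. \<forall>x\<in>\<Theta>. \<forall>y\<in>\<Theta>. dist x y < d \<longrightarrow> \<bar>f n x - f n y\<bar> \<le> e / 2"
      using eq[of "e/2"] by auto
    have "dist (f n x') (f n x) < e" if "x \<in> \<Theta>" "x' \<in> \<Theta>" "dist x' x < d" for x x'
      using d(2)[rule_format, of x' x n] that \<open>e > 0\<close> by (simp add: dist_real_def)
    then show "\<exists>d>0. \<forall>x\<in>\<Theta>. \<forall>x'\<in>\<Theta>. dist x' x < d \<longrightarrow> dist (f n x') (f n x) < e"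
      using d(1) by blast
  qed
  have "\<exists>g. uniformly_continuous_on (closure \<Theta>) g \<and> (\<forall>x\<in>\<Theta>. f n x = g x)" for n
    using uniformly_continuous_on_extension_on_closure[OF uc[of n]] by metis
  then obtain g where g: "\<And>n. uniformly_continuous_on (closure \<Theta>) (g n)" "\<And>n x. x \<in> \<Theta> \<Longrightarrow> f n x = g n x" by metis
  have gc: "continuous_on (closure \<Theta>) (g n)" for n using g(1) by (rule uniformly_continuous_imp_continuous)
  have gb: "norm (g n x) \<le> C" if "x \<in> closure \<Theta>" for n x
    using gc[of n] bd g(2) that by (intro continuous_on_closure_norm_le[of \<Theta> "g n"]) auto
  obtain G r where G: "strict_mono (r :: nat \<Rightarrow> nat)"
    "\<And>e. 0 < e \<Longrightarrow> \<exists>N. \<forall>n x. n \<ge> N \<and> x \<in> closure \<Theta> \<longrightarrow> norm (g (r n) x - G x) < e"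
  proof (rule Arzela_Ascoli[of "closure \<Theta>" g C])
    show "compact (closure \<Theta>)" using bounded_\<Theta> by simp
    show "norm (g n x) \<le> C" if "x \<in> closure \<Theta>" for n x using gb[OF that] .
    fix x and e :: real assume x: "x \<in> closure \<Theta>" and "0 < e"
    then obtain d where d: "d > 0" "\<forall>n. \<forall>x\<in>\<Theta>. \<forall>y\<in>\<Theta>. dist x y < d \<longrightarrow> \<bar>f n x - f n y\<bar> \<le> e / 2"
      using eq[of "e/2"] by auto
    have "norm (g n x - g n y) < e" if y: "y \<in> closure \<Theta>" "norm (x - y) < d" for n y
    proof -
      obtain xs ys where xs: "\<And>i. xs i \<in> \<Theta>" "xs \<longlonglongrightarrow> x" and ys: "\<And>i. ys i \<in> \<Theta>" "ys \<longlonglongrightarrow> y"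
        using x y closure_sequential by metis
      have cl: "xs i \<in> closure \<Theta>" "ys i \<in> closure \<Theta>" for i using xs ys closure_subset by blast+
      have "(\<lambda>i. g n (xs i)) \<longlonglongrightarrow> g n x" "(\<lambda>i. g n (ys i)) \<longlonglongrightarrow> g n y"
        using x y cl by (auto intro: continuous_on_tendsto_compose[OF gc xs(2)] continuous_on_tendsto_compose[OF gc ys(2)])
      then have lim: "(\<lambda>i. g n (xs i) - g n (ys i)) \<longlonglongrightarrow> g n x - g n y" by (rule tendsto_diff)
      have "(\<lambda>i. dist (xs i) (ys i)) \<longlonglongrightarrow> dist x y" by (intro tendsto_intros xs ys)
      then have "\<forall>\<^sub>F i in sequentially. dist (xs i) (ys i) < d"
        using y(2) by (intro order_tendstoD) (auto simp: dist_norm)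
      then have "\<forall>\<^sub>F i in sequentially. norm (g n (xs i) - g n (ys i)) \<le> e / 2"
        by eventually_elim (use d(2) xs(1) ys(1) in \<open>auto simp flip: g(2)\<close>)
      then have "norm (g n x - g n y) \<le> e / 2" using lim by (intro Lim_norm_ubound[OF _ lim]) auto
      then show ?thesis using \<open>0 < e\<close> by simp
    qed
    then show "\<exists>d. 0 < d \<and> (\<forall>n y. y \<in> closure \<Theta> \<and> norm (x - y) < d \<longrightarrow> norm (g n x - g n y) < e)"
      using d(1) by blast
  qed (rule that)
  have "\<exists>N. \<forall>n\<ge>N. \<forall>x\<in>\<Theta>. \<bar>f (r n) x - G x\<bar> < e" if "e > 0" for e
    using G(2)[OF that] closure_subset[of \<Theta>] by (auto simp: g(2))
  then show thesis using that G(1) by blast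
qed

text \<open>Subsequences are extracted one component after the other; passing to a further
  subsequence keeps the uniform convergence of the earlier components.\<close>

lemma arzela_ascoli_family:
  fixes f :: "'i \<Rightarrow> nat \<Rightarrow> real^'d \<Rightarrow> real"
  assumes "finite I"
    and bd: "\<And>i n x. i \<in> I \<Longrightarrow> x \<in> \<Theta> \<Longrightarrow> \<bar>f i n x\<bar> \<le> C"
    and eq: "\<And>i e. i \<in> I \<Longrightarrow> e > 0 \<Longrightarrow> \<exists>d>0. \<forall>n. \<forall>x\<in>\<Theta>. \<forall>y\<in>\<Theta>. dist x y < d \<longrightarrow> \<bar>f i n x - f i n y\<bar> \<le> e"
  shows "\<exists>r g. strict_mono (r :: nat \<Rightarrow> nat) \<and>
    (\<forall>i\<in>I. \<forall>e>0. \<exists>N. \<forall>n\<ge>N. \<forall>x\<in>\<Theta>. \<bar>f i (r n) x - g i x\<bar> < e)"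
  using assms
proof (induction I rule: finite_induct)
  case empty
  show ?case by (intro exI[of _ id]) (auto simp: strict_mono_def)
next
  case (insert j I)
  obtain r g where r: "strict_mono (r :: nat \<Rightarrow> nat)"
    and g: "\<forall>i\<in>I. \<forall>e>0. \<exists>N. \<forall>n\<ge>N. \<forall>x\<in>\<Theta>. \<bar>f i (r n) x - g i x\<bar> < e"
    using insert.IH insert.prems by (metis insertCI)
  have "\<exists>s G. strict_mono (s :: nat \<Rightarrow> nat) \<and> (\<forall>e>0. \<exists>N. \<forall>n\<ge>N. \<forall>x\<in>\<Theta>. \<bar>f j (r (s n)) x - G x\<bar> < e)"
  proof (rule arzela_ascoli_open[of "\<lambda>n. f j (r n)" C])
    show "\<bar>f j (r n) x\<bar> \<le> C" if "x \<in> \<Theta>" for n x using insert.prems(1)[of j x] that by simp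
    show "\<exists>d>0. \<forall>n. \<forall>x\<in>\<Theta>. \<forall>y\<in>\<Theta>. dist x y < d \<longrightarrow> \<bar>f j (r n) x - f j (r n) y\<bar> \<le> e" if "e > 0" for e
      using insert.prems(2)[of j e] that by (metis insertI1)
  qed blast
  then obtain s G where s: "strict_mono (s :: nat \<Rightarrow> nat)"
    and G: "\<forall>e>0. \<exists>N. \<forall>n\<ge>N. \<forall>x\<in>\<Theta>. \<bar>f j (r (s n)) x - G x\<bar> < e" by blast
  have "\<forall>e>0. \<exists>N. \<forall>n\<ge>N. \<forall>x\<in>\<Theta>. \<bar>f i (r (s n)) x - g i x\<bar> < e" if "i \<in> I" for i
    using g that seq_suble[OF s] by (meson order_trans)
  then have "\<forall>i\<in>insert j I. \<forall>e>0. \<exists>N. \<forall>n\<ge>N. \<forall>x\<in>\<Theta>. \<bar>f i ((r \<circ> s) n) x - (g(j := G)) i x\<bar> < e"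
    using G insert.hyps(2) by auto
  then show ?case using strict_mono_o[OF r s] by blast
qed

end

text \<open>\<open>Lim\<close> has a meaning only where a limit exists. Uniform continuity provides
  it, through the continuous extension to the closure, and the bound passes to the limit.\<close>

lemma cont_ext_bounded:
  fixes f :: "'b::metric_space \<Rightarrow> real"
  assumes f: "uniformly_continuous_on S f" and C: "\<And>x. x \<in> S \<Longrightarrow> \<bar>f x\<bar> \<le> C" and x: "x \<in> closure S"
  shows "\<bar>cont_ext S f x\<bar> \<le> C"
proof (cases "x \<in> S")
  case True
  then show ?thesis using C by (simp add: cont_ext_def)
next
  case False
  obtain g where g: "uniformly_continuous_on (closure S) g" "\<And>x. x \<in> S \<Longrightarrow> f x = g x"
    using uniformly_continuous_on_extension_on_closure[OF f] by metis
  have nb: "at x within S \<noteq> bot" using False x by (auto simp: at_within_eq_bot_iff closure_def)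
  have "(g \<longlongrightarrow> g x) (at x within S)"
    using uniformly_continuous_imp_continuous[OF g(1)] x closure_subset[of S]
    by (auto simp: continuous_on_def intro: tendsto_within_subset)
  then have lim: "(f \<longlongrightarrow> g x) (at x within S)"
    by (rule Lim_transform_eventually) (auto simp: eventually_at_filter g(2))
  have "\<bar>g x\<bar> \<le> C"
  proof (rule tendsto_upperbound[OF tendsto_rabs[OF lim] _ nb])
    show "\<forall>\<^sub>F y in at x within S. \<bar>f y\<bar> \<le> C" using C by (auto simp: eventually_at_filter)
  qed
  then show ?thesis using False tendsto_Lim[OF nb lim] by (simp add: cont_ext_def)
qed

section \<open>The kernel operator on families\<close>

locale sobolev_kernel = bounded_domain +
  fixes h :: "(real^'a) \<times> (real^'a) \<Rightarrow> real" and k :: nat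
  assumes h: "h \<in> Ckk k \<Theta>" and pos_def: "pos_def_kernel \<Theta> h"
begin

abbreviation A where "A \<equiv> multi_indices k :: ('a \<Rightarrow> nat) set"
abbreviation V where "V \<equiv> L2_family k"
abbreviation ip where "ip \<equiv> family_inner k"
abbreviation K where "K \<alpha> \<beta> x y \<equiv> mixed_deriv \<alpha> \<beta> h (x, y)"

lemma K_uniformly_continuous:
  assumes "\<alpha> \<in> A" "\<beta> \<in> A"
  shows "uniformly_continuous_on (\<Theta> \<times> \<Theta>) (mixed_deriv \<alpha> \<beta> h)"
proof -
  have "mixed_deriv \<alpha> \<beta> h = iter_pd (map (\<lambda>v. (v, 0)) (dirs \<alpha>) @ map (\<lambda>v. (0, v)) (dirs \<beta>)) h"
    by (simp add: mixed_deriv_def dirs_def o_def)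
  then show ?thesis
    using split_list_valid(2)[OF open_\<Theta> h dirs_Basis dirs_Basis length_dirs_le[OF assms(1)] length_dirs_le[OF assms(2)]]
    by simp
qed

lemma K_uniform:
  assumes "\<epsilon> > 0"
  obtains \<delta> where "\<delta> > 0" "\<And>\<alpha> \<beta> x x' y y'. \<alpha> \<in> A \<Longrightarrow> \<beta> \<in> A \<Longrightarrow> x \<in> \<Theta> \<Longrightarrow> x' \<in> \<Theta> \<Longrightarrow> y \<in> \<Theta> \<Longrightarrow> y' \<in> \<Theta> \<Longrightarrow>
     dist x x' < \<delta> \<Longrightarrow> dist y y' < \<delta> \<Longrightarrow> \<bar>K \<alpha> \<beta> x y - K \<alpha> \<beta> x' y'\<bar> < \<epsilon>"
proof -
  have "\<exists>d>0. \<forall>p\<in>\<Theta> \<times> \<Theta>. \<forall>p'\<in>\<Theta> \<times> \<Theta>. dist p' p < d \<longrightarrow> dist (mixed_deriv \<alpha> \<beta> h p') (mixed_deriv \<alpha> \<beta> h p) < \<epsilon>"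
    if "\<alpha> \<in> A" "\<beta> \<in> A" for \<alpha> \<beta>
    using K_uniformly_continuous[OF that] assms unfolding uniformly_continuous_on_def by blast
  then obtain d where d: "\<And>\<alpha> \<beta>. \<alpha> \<in> A \<Longrightarrow> \<beta> \<in> A \<Longrightarrow> d \<alpha> \<beta> > 0"
    "\<And>\<alpha> \<beta> p p'. \<alpha> \<in> A \<Longrightarrow> \<beta> \<in> A \<Longrightarrow> p \<in> \<Theta> \<times> \<Theta> \<Longrightarrow> p' \<in> \<Theta> \<times> \<Theta> \<Longrightarrow> dist p' p < d \<alpha> \<beta> \<Longrightarrow>
       dist (mixed_deriv \<alpha> \<beta> h p') (mixed_deriv \<alpha> \<beta> h p) < \<epsilon>" by metis
  define D where "D = Min ((\<lambda>(\<alpha>, \<beta>). d \<alpha> \<beta>) ` (A \<times> A))"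
  have D: "D > 0" "\<And>\<alpha> \<beta>. \<alpha> \<in> A \<Longrightarrow> \<beta> \<in> A \<Longrightarrow> D \<le> d \<alpha> \<beta>"
  proof -
    have ne: "A \<times> A \<noteq> {}" using zero_in_multi_indices by blast
    have fin: "finite ((\<lambda>(\<alpha>, \<beta>). d \<alpha> \<beta>) ` (A \<times> A))" by simp
    show "D > 0" unfolding D_def using ne d(1) by (subst Min_gr_iff[OF fin]) auto
    show "D \<le> d \<alpha> \<beta>" if "\<alpha> \<in> A" "\<beta> \<in> A" for \<alpha> \<beta>
      unfolding D_def using that by (intro Min_le[OF fin]) auto
  qed
  show thesis
  \<comment> \<open>Half of \<open>D\<close> for each variable, as the distance in the product is at
    most the sum of the two distances.\<close>
  proof (rule that[of "D / 2"])
    show "D / 2 > 0" using D by simp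
    fix \<alpha> \<beta> :: "'a \<Rightarrow> nat" and x x' y y'
    assume ab: "\<alpha> \<in> A" "\<beta> \<in> A" and m: "x \<in> \<Theta>" "x' \<in> \<Theta>" "y \<in> \<Theta>" "y' \<in> \<Theta>" and xy: "dist x x' < D / 2" "dist y y' < D / 2"
    have "dist (x, y) (x', y') \<le> dist x x' + dist y y'"
      unfolding dist_Pair_Pair by (rule sqrt_sum_squares_le_sum) auto
    also have "\<dots> < d \<alpha> \<beta>" using xy D(2)[OF ab] by simp
    finally have "dist (K \<alpha> \<beta> x y) (K \<alpha> \<beta> x' y') < \<epsilon>" by (intro d(2)[OF ab]) (use m in auto)
    then show "\<bar>K \<alpha> \<beta> x y - K \<alpha> \<beta> x' y'\<bar> < \<epsilon>" by (simp add: dist_real_def)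
  qed
qed

lemma K_bounded: "\<exists>C\<ge>0. \<forall>\<alpha>\<in>A. \<forall>\<beta>\<in>A. \<forall>x\<in>\<Theta>. \<forall>y\<in>\<Theta>. \<bar>K \<alpha> \<beta> x y\<bar> \<le> C"
proof -
  have "\<exists>C. \<forall>p\<in>\<Theta> \<times> \<Theta>. \<bar>mixed_deriv \<alpha> \<beta> h p\<bar> \<le> C" if "\<alpha> \<in> A" "\<beta> \<in> A" for \<alpha> \<beta>
  proof -
    have "bounded (mixed_deriv \<alpha> \<beta> h ` (\<Theta> \<times> \<Theta>))"
      using K_uniformly_continuous[OF that] bounded_Times[OF bounded_\<Theta> bounded_\<Theta>]
      by (rule bounded_uniformly_continuous_image)
    then show ?thesis by (auto simp: bounded_iff)
  qed
  then obtain C where C: "\<And>\<alpha> \<beta> p. \<alpha> \<in> A \<Longrightarrow> \<beta> \<in> A \<Longrightarrow> p \<in> \<Theta> \<times> \<Theta> \<Longrightarrow> \<bar>mixed_deriv \<alpha> \<beta> h p\<bar> \<le> C \<alpha> \<beta>" by metis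
  have "\<bar>K \<alpha> \<beta> x y\<bar> \<le> (\<Sum>\<alpha>\<in>A. \<Sum>\<beta>\<in>A. \<bar>C \<alpha> \<beta>\<bar>)" if "\<alpha> \<in> A" "\<beta> \<in> A" "x \<in> \<Theta>" "y \<in> \<Theta>" for \<alpha> \<beta> x y
  proof -
    have "\<bar>K \<alpha> \<beta> x y\<bar> \<le> \<bar>C \<alpha> \<beta>\<bar>" using C[OF that(1,2), of "(x, y)"] that by auto
    also have "\<dots> \<le> (\<Sum>\<beta>\<in>A. \<bar>C \<alpha> \<beta>\<bar>)" using that by (intro member_le_sum) auto
    also have "\<dots> \<le> (\<Sum>\<alpha>\<in>A. \<Sum>\<beta>\<in>A. \<bar>C \<alpha> \<beta>\<bar>)"
      using that by (intro member_le_sum[of \<alpha> A "\<lambda>\<alpha>. \<Sum>\<beta>\<in>A. \<bar>C \<alpha> \<beta>\<bar>"]) (auto intro: sum_nonneg)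
    finally show ?thesis .
  qed
  then show ?thesis by (intro exI[of _ "\<Sum>\<alpha>\<in>A. \<Sum>\<beta>\<in>A. \<bar>C \<alpha> \<beta>\<bar>"]) (auto intro!: sum_nonneg)
qed

definition KB where "KB = (SOME C. 0 \<le> C \<and> (\<forall>\<alpha>\<in>A. \<forall>\<beta>\<in>A. \<forall>x\<in>\<Theta>. \<forall>y\<in>\<Theta>. \<bar>K \<alpha> \<beta> x y\<bar> \<le> C))"

lemma KB: "0 \<le> KB" "\<alpha> \<in> A \<Longrightarrow> \<beta> \<in> A \<Longrightarrow> x \<in> \<Theta> \<Longrightarrow> y \<in> \<Theta> \<Longrightarrow> \<bar>K \<alpha> \<beta> x y\<bar> \<le> KB"
  using someI_ex[OF K_bounded, folded KB_def] by auto

lemma K_sym: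
  assumes "\<alpha> \<in> A" "\<beta> \<in> A" "x \<in> \<Theta>" "y \<in> \<Theta>"
  shows "K \<alpha> \<beta> x y = K \<beta> \<alpha> y x"
  unfolding mixed_deriv_eq_jet using pos_def
  by (intro jet_kernel_sym[OF open_\<Theta> h] dirs_jets assms) (auto simp: pos_def_kernel_def)

lemma K_psd:
  assumes "finite I" "\<And>i. i \<in> I \<Longrightarrow> a i \<in> A \<and> x i \<in> \<Theta>"
  shows "0 \<le> (\<Sum>i\<in>I. \<Sum>j\<in>I. c i * K (a i) (a j) (x i) (x j) * c j)"
  unfolding mixed_deriv_eq_jet
  by (rule psd_on_sum[OF psd_on_jets[OF open_\<Theta> h pos_def] assms(1), of "\<lambda>i. (dirs (a i), x i)"])
     (use assms(2) dirs_jets in blast)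

lemma K_section:
  assumes "\<alpha> \<in> A" "\<beta> \<in> A"
  shows "y \<in> \<Theta> \<Longrightarrow> (\<lambda>x. K \<alpha> \<beta> x y) \<in> borel_measurable M" "x \<in> \<Theta> \<Longrightarrow> (\<lambda>y. K \<alpha> \<beta> x y) \<in> borel_measurable M"
    "(\<lambda>x. K \<alpha> \<beta> x x) \<in> borel_measurable M"
proof -
  have c: "continuous_on (\<Theta> \<times> \<Theta>) (mixed_deriv \<alpha> \<beta> h)"
    using K_uniformly_continuous[OF assms] by (rule uniformly_continuous_imp_continuous)
  show "y \<in> \<Theta> \<Longrightarrow> (\<lambda>x. K \<alpha> \<beta> x y) \<in> borel_measurable M" "x \<in> \<Theta> \<Longrightarrow> (\<lambda>y. K \<alpha> \<beta> x y) \<in> borel_measurable M"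
    "(\<lambda>x. K \<alpha> \<beta> x x) \<in> borel_measurable M"
    by (auto intro!: continuous_measurable continuous_on_compose2[OF c] continuous_intros)
qed

lemma K_integrable:
  assumes "\<alpha> \<in> A" "\<beta> \<in> A" "y \<in> \<Theta>" "integrable M f"
  shows "integrable M (\<lambda>x. K \<alpha> \<beta> x y * f x)" "integrable M (\<lambda>x. K \<alpha> \<beta> y x * f x)"
  using integrable_mult_bounded[OF assms(4) K_section(1)[OF assms(1-3)] KB(2)[OF assms(1,2) _ assms(3)]]
    integrable_mult_bounded[OF assms(4) K_section(2)[OF assms(1-3)] KB(2)[OF assms(1-3)]]
  by (simp_all add: mult.commute)

lemma K_swap:
  assumes ab: "\<alpha> \<in> A" "\<beta> \<in> A" and f: "integrable M f" and g: "integrable M g"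
  shows "(LINT y|M. (LINT x|M. K \<alpha> \<beta> x y * f x) * g y) = (LINT x|M. f x * (LINT y|M. K \<alpha> \<beta> x y * g y))"
    "integrable M (\<lambda>y. (LINT x|M. K \<alpha> \<beta> x y * f x) * g y)"
    "integrable M (\<lambda>x. f x * (LINT y|M. K \<alpha> \<beta> x y * g y))"
proof -
  interpret P: pair_sigma_finite M M ..
  have c: "continuous_on (\<Theta> \<times> \<Theta>) (mixed_deriv \<alpha> \<beta> h)"
    using K_uniformly_continuous[OF ab] by (rule uniformly_continuous_imp_continuous)
  \<comment> \<open>Continuity of the kernel gives Borel measurability on the product set, while
    Fubini's theorem works with the product of the two Lebesgue structures. The identity mediates
    between them.\<close>
  have id: "(\<lambda>p. p) \<in> (M \<Otimes>\<^sub>M M) \<rightarrow>\<^sub>M restrict_space (borel :: ((real^'a) \<times> (real^'a)) measure) (\<Theta> \<times> \<Theta>)"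
  proof (rule measurable_restrict_space2)
    have "id \<in> M \<rightarrow>\<^sub>M (borel :: (real^'a) measure)"
      using measurable_completion[of id lborel borel] by (intro measurable_restrict_space1) (simp add: id_def)
    then have "(\<lambda>p. (fst p, snd p)) \<in> (M \<Otimes>\<^sub>M M) \<rightarrow>\<^sub>M (borel :: (real^'a) measure) \<Otimes>\<^sub>M (borel :: (real^'a) measure)"
      by (intro measurable_Pair measurable_compose[OF measurable_fst] measurable_compose[OF measurable_snd]) (simp_all add: id_def)
    then show "(\<lambda>p. p) \<in> (M \<Otimes>\<^sub>M M) \<rightarrow>\<^sub>M (borel :: ((real^'a) \<times> (real^'a)) measure)"
      by (simp add: borel_prod)
  qed (simp add: space_pair_measure)
  have Km: "mixed_deriv \<alpha> \<beta> h \<in> borel_measurable (M \<Otimes>\<^sub>M M)"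
    using measurable_compose[OF id borel_measurable_continuous_on_restrict[OF c]] by simp
  have fg: "f \<in> borel_measurable M" "g \<in> borel_measurable M" using f g by auto
  have fgm: "(\<lambda>(x, y). K \<alpha> \<beta> x y * f x * g y) \<in> borel_measurable (M \<Otimes>\<^sub>M M)"
    using Km fg measurable_compose[OF measurable_fst fg(1), of M] measurable_compose[OF measurable_snd fg(2), of M]
    by (simp add: case_prod_beta) 
  have int: "integrable (M \<Otimes>\<^sub>M M) (\<lambda>(x, y). K \<alpha> \<beta> x y * f x * g y)"
  proof (rule P.Fubini_integrable[OF fgm])
    have i2: "integrable M (\<lambda>y. K \<alpha> \<beta> x y * f x * g y)" if "x \<in> \<Theta>" for x
    proof -
      have "integrable M (\<lambda>y. f x * (K \<alpha> \<beta> x y * g y))"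
        using K_integrable(2)[OF ab that g] by simp
      then show ?thesis by (simp add: mult_ac)
    qed
    then show "AE x in M. integrable M (\<lambda>y. (case (x, y) of (x, y) \<Rightarrow> K \<alpha> \<beta> x y * f x * g y))" by (intro AE_I2) simp
    show "integrable M (\<lambda>x. LINT y|M. norm (case (x, y) of (x, y) \<Rightarrow> K \<alpha> \<beta> x y * f x * g y))"
    proof (rule Bochner_Integration.integrable_bound)
      show "integrable M (\<lambda>x. KB * (LINT y|M. \<bar>g y\<bar>) * f x)" using f by simp
      have "(\<lambda>x. LINT y|M. norm ((\<lambda>(x, y). K \<alpha> \<beta> x y * f x * g y) (x, y))) \<in> borel_measurable M"
        using fgm by (intro M.borel_measurable_lebesgue_integral) (simp add: case_prod_beta)
      then show "(\<lambda>x. LINT y|M. norm (case (x, y) of (x, y) \<Rightarrow> K \<alpha> \<beta> x y * f x * g y)) \<in> borel_measurable M" by simp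
      show "AE x in M. norm (LINT y|M. norm (case (x, y) of (x, y) \<Rightarrow> K \<alpha> \<beta> x y * f x * g y)) \<le> norm (KB * (LINT y|M. \<bar>g y\<bar>) * f x)"
      proof (intro AE_I2)
        fix x assume "x \<in> space M"
        then have x: "x \<in> \<Theta>" by simp
        have "(LINT y|M. \<bar>K \<alpha> \<beta> x y * f x * g y\<bar>) \<le> (LINT y|M. KB * \<bar>f x\<bar> * \<bar>g y\<bar>)"
        proof (rule integral_mono)
          show "integrable M (\<lambda>y. \<bar>K \<alpha> \<beta> x y * f x * g y\<bar>)" using i2[OF x] by (rule integrable_abs)
          show "integrable M (\<lambda>y. KB * \<bar>f x\<bar> * \<bar>g y\<bar>)" using g by simp
          show "\<bar>K \<alpha> \<beta> x y * f x * g y\<bar> \<le> KB * \<bar>f x\<bar> * \<bar>g y\<bar>" if "y \<in> space M" for y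
            using KB(2)[OF ab x, of y] that by (simp add: abs_mult mult_right_mono)
        qed
        moreover have "0 \<le> (LINT y|M. \<bar>K \<alpha> \<beta> x y * f x * g y\<bar>)" by (intro Bochner_Integration.integral_nonneg) auto
        moreover have "0 \<le> (LINT y|M. \<bar>g y\<bar>)" by (intro Bochner_Integration.integral_nonneg) auto
        ultimately show "norm (LINT y|M. norm (case (x, y) of (x, y) \<Rightarrow> K \<alpha> \<beta> x y * f x * g y)) \<le> norm (KB * (LINT y|M. \<bar>g y\<bar>) * f x)"
          using KB(1) by (simp add: abs_mult mult_ac)
      qed
    qed
  qed
  have e1: "(LINT x|M. K \<alpha> \<beta> x y * f x * g y) = (LINT x|M. K \<alpha> \<beta> x y * f x) * g y" for y by simp
  have e2: "(LINT y|M. K \<alpha> \<beta> x y * f x * g y) = f x * (LINT y|M. K \<alpha> \<beta> x y * g y)" for x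
    by (subst Bochner_Integration.integral_mult_right_zero[symmetric]) (simp add: mult_ac)
  show "(LINT y|M. (LINT x|M. K \<alpha> \<beta> x y * f x) * g y) = (LINT x|M. f x * (LINT y|M. K \<alpha> \<beta> x y * g y))"
    using P.Fubini_integral[OF int] unfolding e1 e2 .
  show "integrable M (\<lambda>y. (LINT x|M. K \<alpha> \<beta> x y * f x) * g y)"
    using P.integrable_snd[OF int] unfolding e1 .
  show "integrable M (\<lambda>x. f x * (LINT y|M. K \<alpha> \<beta> x y * g y))"
    using P.integrable_fst[OF int] unfolding e2 .
qed

text \<open>
  The operator \<open>T\<^bsub>h,k\<^esub>\<close> is its restriction to families of weak derivatives. The value \<open>0\<close> outside
  \<open>\<Theta>\<close>, where the kernel is meaningless, makes it exactly linear.
\<close>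

definition Kop :: "(('a \<Rightarrow> nat) \<times> (real^'a) \<Rightarrow> real) \<Rightarrow> ('a \<Rightarrow> nat) \<times> (real^'a) \<Rightarrow> real" where
  "Kop F = (\<lambda>(\<beta>, y). if y \<in> \<Theta> then (\<Sum>\<alpha>\<in>A. LINT x|M. K \<alpha> \<beta> x y * F (\<alpha>, x)) else 0)"

text \<open>The L^1 norm of a family, the natural partner of a bounded kernel: the supremum and the
  modulus of continuity of \<open>Kop F\<close> are both controlled by multiples of it. On a set of
  finite measure it is dominated by the L^2 norm.\<close>

definition N1 :: "(('a \<Rightarrow> nat) \<times> (real^'a) \<Rightarrow> real) \<Rightarrow> real" where
  "N1 F = (\<Sum>\<alpha>\<in>A. LINT x|M. \<bar>F (\<alpha>, x)\<bar>)"

lemma V_integrable: "F \<in> V \<Longrightarrow> \<alpha> \<in> A \<Longrightarrow> integrable M (\<lambda>x. F (\<alpha>, x))"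
  by (simp add: L2_family_def L2_integrable)

lemma N1_nonneg: "0 \<le> N1 F"
  unfolding N1_def by (intro sum_nonneg Bochner_Integration.integral_nonneg) auto

lemma N1_bound: "F \<in> V \<Longrightarrow> (N1 F)\<^sup>2 \<le> card A * measure lebesgue \<Theta> * ip F F"
proof -
  assume F: "F \<in> V"
  interpret F: semi_inner V ip by (rule semi_inner_family)
  have 1: "(\<lambda>p. 1) \<in> V" by (auto simp: L2_family_def intro!: L2_bounded[where C = 1])
  have 2: "(\<lambda>p. \<bar>F p\<bar>) \<in> V" using F by (auto simp: L2_family_def L2_def)
  have "(ip (\<lambda>p. \<bar>F p\<bar>) (\<lambda>p. 1))\<^sup>2 \<le> ip (\<lambda>p. \<bar>F p\<bar>) (\<lambda>p. \<bar>F p\<bar>) * ip (\<lambda>p. 1) (\<lambda>p. 1)"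
    by (rule F.cauchy_schwarz[OF 2 1])
  moreover have "ip (\<lambda>p. 1) (\<lambda>p. 1) = card A * measure lebesgue \<Theta>"
    by (simp add: family_inner_def measure_M)
  moreover have "ip (\<lambda>p. \<bar>F p\<bar>) (\<lambda>p. 1) = N1 F" by (simp add: family_inner_def N1_def)
  moreover have "ip (\<lambda>p. \<bar>F p\<bar>) (\<lambda>p. \<bar>F p\<bar>) = ip F F" by (simp add: family_inner_def)
  ultimately show ?thesis by (simp add: mult_ac)
qed

lemma kernel_sum_bound:
  assumes "F \<in> V" and u: "\<And>\<alpha>. \<alpha> \<in> A \<Longrightarrow> integrable M (\<lambda>x. u \<alpha> x * F (\<alpha>, x))"
    "\<And>\<alpha> x. \<alpha> \<in> A \<Longrightarrow> x \<in> \<Theta> \<Longrightarrow> \<bar>u \<alpha> x\<bar> \<le> c"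
  shows "\<bar>\<Sum>\<alpha>\<in>A. LINT x|M. u \<alpha> x * F (\<alpha>, x)\<bar> \<le> c * N1 F"
proof -
  have "\<bar>\<Sum>\<alpha>\<in>A. LINT x|M. u \<alpha> x * F (\<alpha>, x)\<bar> \<le> (\<Sum>\<alpha>\<in>A. \<bar>LINT x|M. u \<alpha> x * F (\<alpha>, x)\<bar>)" by (rule sum_abs)
  also have "\<dots> \<le> (\<Sum>\<alpha>\<in>A. c * (LINT x|M. \<bar>F (\<alpha>, x)\<bar>))"
    using assms by (intro sum_mono integral_abs_bound_mult V_integrable) auto
  finally show ?thesis by (simp add: N1_def sum_distrib_left)
qed

lemma Kop_bound:
  assumes "F \<in> V" "\<beta> \<in> A" "y \<in> \<Theta>"
  shows "\<bar>Kop F (\<beta>, y)\<bar> \<le> KB * N1 F"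
  using kernel_sum_bound[OF assms(1), of "\<lambda>\<alpha> x. K \<alpha> \<beta> x y" KB] K_integrable(1) KB(2) V_integrable assms
  by (simp add: Kop_def)

lemma Kop_equicontinuous:
  assumes "e > 0"
  obtains d where "d > 0" "\<And>F \<beta> y y'. F \<in> V \<Longrightarrow> \<beta> \<in> A \<Longrightarrow> y \<in> \<Theta> \<Longrightarrow> y' \<in> \<Theta> \<Longrightarrow> dist y y' < d \<Longrightarrow>
     \<bar>Kop F (\<beta>, y) - Kop F (\<beta>, y')\<bar> \<le> e * N1 F"
proof -
  obtain d where d: "d > 0" "\<And>\<alpha> \<beta> x x' y y'. \<alpha> \<in> A \<Longrightarrow> \<beta> \<in> A \<Longrightarrow> x \<in> \<Theta> \<Longrightarrow> x' \<in> \<Theta> \<Longrightarrow> y \<in> \<Theta> \<Longrightarrow> y' \<in> \<Theta> \<Longrightarrow>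
     dist x x' < d \<Longrightarrow> dist y y' < d \<Longrightarrow> \<bar>K \<alpha> \<beta> x y - K \<alpha> \<beta> x' y'\<bar> < e" using K_uniform[OF assms] by metis
  show thesis
  proof (rule that[OF d(1)])
    fix F \<beta> y y' assume F: "F \<in> V" and b: "\<beta> \<in> A" and y: "y \<in> \<Theta>" "y' \<in> \<Theta>" "dist y y' < d"
    have i: "integrable M (\<lambda>x. K \<alpha> \<beta> x y * F (\<alpha>, x))" "integrable M (\<lambda>x. K \<alpha> \<beta> x y' * F (\<alpha>, x))" if "\<alpha> \<in> A" for \<alpha>
      using K_integrable(1) that b y V_integrable[OF F] by blast+
    have "\<bar>\<Sum>\<alpha>\<in>A. LINT x|M. (K \<alpha> \<beta> x y - K \<alpha> \<beta> x y') * F (\<alpha>, x)\<bar> \<le> e * N1 F"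
    proof (rule kernel_sum_bound[OF F])
      show "integrable M (\<lambda>x. (K \<alpha> \<beta> x y - K \<alpha> \<beta> x y') * F (\<alpha>, x))" if "\<alpha> \<in> A" for \<alpha>
        using i[OF that] by (simp add: left_diff_distrib)
      show "\<bar>K \<alpha> \<beta> x y - K \<alpha> \<beta> x y'\<bar> \<le> e" if "\<alpha> \<in> A" "x \<in> \<Theta>" for \<alpha> x
        using d(2)[OF that(1) b that(2) that(2) y(1,2)] d(1) y(3) by simp
    qed
    moreover have "(\<Sum>\<alpha>\<in>A. LINT x|M. (K \<alpha> \<beta> x y - K \<alpha> \<beta> x y') * F (\<alpha>, x)) = Kop F (\<beta>, y) - Kop F (\<beta>, y')"
      using i y by (simp add: Kop_def left_diff_distrib sum_subtractf)
    ultimately show "\<bar>Kop F (\<beta>, y) - Kop F (\<beta>, y')\<bar> \<le> e * N1 F" by simp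
  qed
qed

lemma Kop_continuous:
  assumes "F \<in> V" "\<beta> \<in> A"
  shows "continuous_on \<Theta> (\<lambda>y. Kop F (\<beta>, y))"
  unfolding continuous_on_iff
proof (intro ballI allI impI)
  fix y and e :: real assume y: "y \<in> \<Theta>" and "e > 0"
  have N: "N1 F + 1 > 0" using N1_nonneg[of F] by simp
  then have "e / (N1 F + 1) > 0" using \<open>e > 0\<close> by simp
  then obtain d where d: "d > 0" "\<And>G \<beta> y y'. G \<in> V \<Longrightarrow> \<beta> \<in> A \<Longrightarrow> y \<in> \<Theta> \<Longrightarrow> y' \<in> \<Theta> \<Longrightarrow> dist y y' < d \<Longrightarrow>
     \<bar>Kop G (\<beta>, y) - Kop G (\<beta>, y')\<bar> \<le> e / (N1 F + 1) * N1 G"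
    using Kop_equicontinuous by metis
  have "e / (N1 F + 1) * N1 F < e" using N \<open>e > 0\<close> by (simp add: field_simps)
  then show "\<exists>d>0. \<forall>y'\<in>\<Theta>. dist y' y < d \<longrightarrow> dist (Kop F (\<beta>, y')) (Kop F (\<beta>, y)) < e"
    using d(1) d(2)[OF assms _ y] by (intro exI[of _ d]) (force simp: dist_real_def)
qed

lemma Kop_in: "F \<in> V \<Longrightarrow> Kop F \<in> V"
  unfolding L2_family_def
  by (auto intro!: L2_bounded[where C = "KB * N1 F"] continuous_measurable Kop_continuous Kop_bound simp: L2_family_def)

lemma Kop_sum:
  assumes "finite I" "\<And>i. i \<in> I \<Longrightarrow> e i \<in> V" "\<beta> \<in> A"
  shows "Kop (\<lambda>z. \<Sum>i\<in>I. c i * e i z) (\<beta>, y) = (\<Sum>i\<in>I. c i * Kop (e i) (\<beta>, y))"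
proof (cases "y \<in> \<Theta>")
  case True
  have "(LINT x|M. K \<alpha> \<beta> x y * (\<Sum>i\<in>I. c i * e i (\<alpha>, x))) = (\<Sum>i\<in>I. c i * (LINT x|M. K \<alpha> \<beta> x y * e i (\<alpha>, x)))"
    if "\<alpha> \<in> A" for \<alpha>
  proof -
    have "(LINT x|M. K \<alpha> \<beta> x y * (\<Sum>i\<in>I. c i * e i (\<alpha>, x))) = (LINT x|M. (\<Sum>i\<in>I. c i * (K \<alpha> \<beta> x y * e i (\<alpha>, x))))"
      by (simp add: sum_distrib_left mult_ac)
    also have "\<dots> = (\<Sum>i\<in>I. (LINT x|M. c i * (K \<alpha> \<beta> x y * e i (\<alpha>, x))))"
      using K_integrable(1)[OF that assms(3) True V_integrable[OF assms(2) that]] by (intro Bochner_Integration.integral_sum) auto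
    finally show ?thesis by simp
  qed
  then have "Kop (\<lambda>z. \<Sum>i\<in>I. c i * e i z) (\<beta>, y) = (\<Sum>\<alpha>\<in>A. \<Sum>i\<in>I. c i * (LINT x|M. K \<alpha> \<beta> x y * e i (\<alpha>, x)))"
    using True by (simp add: Kop_def)
  also have "\<dots> = (\<Sum>i\<in>I. \<Sum>\<alpha>\<in>A. c i * (LINT x|M. K \<alpha> \<beta> x y * e i (\<alpha>, x)))" by (rule sum.swap)
  finally show ?thesis using True by (simp add: Kop_def sum_distrib_left)
qed (simp add: Kop_def)

lemma Kop_cong:
  assumes "F \<in> V" "G \<in> V" "\<And>\<alpha>. \<alpha> \<in> A \<Longrightarrow> ae_eq \<Theta> (\<lambda>x. F (\<alpha>, x)) (\<lambda>x. G (\<alpha>, x))" "\<beta> \<in> A"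
  shows "Kop F (\<beta>, y) = Kop G (\<beta>, y)"
proof (cases "y \<in> \<Theta>")
  case True
  have "(LINT x|M. K \<alpha> \<beta> x y * F (\<alpha>, x)) = (LINT x|M. K \<alpha> \<beta> x y * G (\<alpha>, x))" if \<alpha>: "\<alpha> \<in> A" for \<alpha>
  proof (rule integral_cong_AE)
    show "AE x in M. K \<alpha> \<beta> x y * F (\<alpha>, x) = K \<alpha> \<beta> x y * G (\<alpha>, x)"
      using assms(3)[OF \<alpha>] unfolding ae_eq_def by eventually_elim simp
  qed (use K_integrable(1)[OF \<alpha> assms(4) True] V_integrable[OF _ \<alpha>] assms(1,2) in blast)+
  then show ?thesis by (simp add: Kop_def)
qed (simp add: Kop_def)

text \<open>Fubini's theorem moves the weight \<open>g\<close> onto the kernel. Both the symmetry of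
  the operator and the weak differentiability of its images start from this identity.\<close>

lemma integral_Kop_mult:
  assumes "F \<in> V" "\<beta> \<in> A" "integrable M g"
  shows "(LINT y|M. Kop F (\<beta>, y) * g y) = (\<Sum>\<alpha>\<in>A. LINT x|M. F (\<alpha>, x) * (LINT y|M. K \<alpha> \<beta> x y * g y))"
proof -
  have "(LINT y|M. Kop F (\<beta>, y) * g y) = (LINT y|M. (\<Sum>\<alpha>\<in>A. (LINT x|M. K \<alpha> \<beta> x y * F (\<alpha>, x)) * g y))"
    by (intro Bochner_Integration.integral_cong refl) (simp add: Kop_def sum_distrib_right)
  also have "\<dots> = (\<Sum>\<alpha>\<in>A. (LINT y|M. (LINT x|M. K \<alpha> \<beta> x y * F (\<alpha>, x)) * g y))"
    using K_swap(2) assms V_integrable by (intro Bochner_Integration.integral_sum) blast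
  also have "\<dots> = (\<Sum>\<alpha>\<in>A. LINT x|M. F (\<alpha>, x) * (LINT y|M. K \<alpha> \<beta> x y * g y))"
    using K_swap(1) assms V_integrable by (intro sum.cong refl) blast
  finally show ?thesis .
qed

lemma Kop_sym:
  assumes "F \<in> V" "G \<in> V"
  shows "ip (Kop F) G = ip F (Kop G)"
proof -
  have "ip (Kop F) G = (\<Sum>\<beta>\<in>A. \<Sum>\<alpha>\<in>A. LINT x|M. F (\<alpha>, x) * (LINT y|M. K \<alpha> \<beta> x y * G (\<beta>, y)))"
    unfolding family_inner_def using integral_Kop_mult[OF assms(1)] V_integrable[OF assms(2)] by (intro sum.cong refl) blast
  also have "\<dots> = (\<Sum>\<alpha>\<in>A. \<Sum>\<beta>\<in>A. LINT x|M. F (\<alpha>, x) * (LINT y|M. K \<alpha> \<beta> x y * G (\<beta>, y)))" by (rule sum.swap)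
  also have "\<dots> = (\<Sum>\<alpha>\<in>A. \<Sum>\<beta>\<in>A. LINT x|M. F (\<alpha>, x) * (LINT y|M. K \<beta> \<alpha> y x * G (\<beta>, y)))"
    using K_sym by (intro sum.cong refl Bochner_Integration.integral_cong arg_cong2[where f = "(*)"]) auto
  also have "\<dots> = (\<Sum>\<alpha>\<in>A. LINT x|M. (\<Sum>\<beta>\<in>A. F (\<alpha>, x) * (LINT y|M. K \<beta> \<alpha> y x * G (\<beta>, y))))"
  proof (intro sum.cong refl Bochner_Integration.integral_sum[symmetric])
    fix \<alpha> \<beta> :: "'a \<Rightarrow> nat" assume "\<alpha> \<in> A" "\<beta> \<in> A"
    then show "integrable M (\<lambda>x. F (\<alpha>, x) * (LINT y|M. K \<beta> \<alpha> y x * G (\<beta>, y)))"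
      using K_swap(2)[of \<beta> \<alpha> "\<lambda>y. G (\<beta>, y)" "\<lambda>x. F (\<alpha>, x)"] V_integrable assms by (simp add: mult.commute)
  qed
  also have "\<dots> = ip F (Kop G)"
    unfolding family_inner_def
    by (intro sum.cong refl Bochner_Integration.integral_cong) (simp add: Kop_def sum_distrib_left)
  finally show ?thesis .
qed

text \<open>One integration by parts per direction, each moving the outermost derivative of the test
  function to the front of the kernel's list; hence the sign and the reversal. The second-variable
  directions stand outermost here so that each new one can be prepended, and the bound on the total
  length keeps every derivative that occurs classical.\<close>

lemma K_section_parts:
  assumes "\<alpha> \<in> A" "x \<in> \<Theta>" and \<phi>: "test_function \<Theta> \<phi>"
  shows "set us \<subseteq> Basis \<Longrightarrow> set ws \<subseteq> Basis \<Longrightarrow> length us + length ws \<le> k \<Longrightarrow>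
    (LINT y|M. iter_pd (map (\<lambda>v. (0, v)) us @ map (\<lambda>v. (v, 0)) (dirs \<alpha>)) h (x, y) * iter_pd ws \<phi> y)
    = (- 1) ^ length ws * (LINT y|M. iter_pd (map (\<lambda>v. (0, v)) (rev ws @ us) @ map (\<lambda>v. (v, 0)) (dirs \<alpha>)) h (x, y) * \<phi> y)"
proof (induction ws arbitrary: us)
  case (Cons w ws)
  let ?D = "\<lambda>us. iter_pd (map (\<lambda>v. (0, v)) us @ map (\<lambda>v. (v, 0)) (dirs \<alpha>)) h"
  have ex: "pd_exists (\<Theta> \<times> \<Theta>) (map (\<lambda>v. (0, v)) vs @ map (\<lambda>v. (v, 0)) (dirs \<alpha>)) h"
    "continuous_on (\<Theta> \<times> \<Theta>) (?D vs)" if "set vs \<subseteq> Basis" "length vs \<le> k" for vs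
  proof -
    have "mset (map (\<lambda>v. (0, v)) vs @ map (\<lambda>v. (v, 0)) (dirs \<alpha>)) \<subseteq># mset (map (\<lambda>v. (v, 0)) (dirs \<alpha>) @ map (\<lambda>v. (0, v)) vs)"
      by (simp add: union_commute)
    from split_list_valid[OF open_\<Theta> h dirs_Basis that(1) length_dirs_le[OF assms(1)] that(2) this]
    show "pd_exists (\<Theta> \<times> \<Theta>) (map (\<lambda>v. (0, v)) vs @ map (\<lambda>v. (v, 0)) (dirs \<alpha>)) h" "continuous_on (\<Theta> \<times> \<Theta>) (?D vs)"
      by (auto intro: uniformly_continuous_imp_continuous)
  qed
  have w: "w \<in> Basis" and wu: "set (w # us) \<subseteq> Basis" "length (w # us) \<le> k" and us: "set us \<subseteq> Basis" "length us \<le> k"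
    using Cons.prems by auto
  have d: "((\<lambda>t. ?D us (x, y + t *\<^sub>R w)) has_field_derivative ?D (w # us) (x, y)) (at 0)" if "y \<in> \<Theta>" for y
    using iter_pd_has_derivative[of "\<Theta> \<times> \<Theta>" "(0, w)" "map (\<lambda>v. (0, v)) us @ map (\<lambda>v. (v, 0)) (dirs \<alpha>)" h "(x, y)"]
      ex(1)[OF wu] assms(2) that by simp
  have c: "continuous_on \<Theta> (\<lambda>y. ?D vs (x, y))" if "set vs \<subseteq> Basis" "length vs \<le> k" for vs
    by (rule continuous_on_compose2[OF ex(2)[OF that]]) (use assms(2) in \<open>auto intro!: continuous_intros\<close>)
  have t: "test_function \<Theta> (iter_pd ws \<phi>)" using test_function_iter_pd[OF \<phi>] Cons.prems by simp
  have "(LINT y|M. ?D us (x, y) * iter_pd [w] (iter_pd ws \<phi>) y) = - (LINT y|M. ?D (w # us) (x, y) * iter_pd ws \<phi> y)"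
    by (rule integration_by_parts[OF open_\<Theta> w d c[OF us] c[OF wu] t])
  also have "(LINT y|M. ?D (w # us) (x, y) * iter_pd ws \<phi> y) = (- 1) ^ length ws * (LINT y|M. ?D (rev ws @ w # us) (x, y) * \<phi> y)"
    using Cons.prems by (intro Cons.IH) auto
  finally show ?case by simp
qed simp

lemma K_weak_deriv:
  assumes "\<alpha> \<in> A" "\<beta> \<in> A" "x \<in> \<Theta>" and \<phi>: "test_function \<Theta> \<phi>"
  shows "(LINT y|M. K \<alpha> (\<lambda>_. 0) x y * pderiv_mi \<beta> \<phi> y) = (- 1) ^ (\<Sum>i\<in>UNIV. \<beta> i) * (LINT y|M. K \<alpha> \<beta> x y * \<phi> y)"
proof -
  have "(LINT y|M. K \<alpha> (\<lambda>_. 0) x y * pderiv_mi \<beta> \<phi> y) =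
    (- 1) ^ length (dirs \<beta>) * (LINT y|M. iter_pd (map (\<lambda>v. (0, v)) (rev (dirs \<beta>)) @ map (\<lambda>v. (v, 0)) (dirs \<alpha>)) h (x, y) * \<phi> y)"
    using K_section_parts[OF assms(1,3) \<phi>, of "[]" "dirs \<beta>", OF _ dirs_Basis] length_dirs_le[OF assms(2)]
    by (simp add: pderiv_mi_eq mixed_deriv_eq_jet jet_kernel_def)
  also have "(LINT y|M. iter_pd (map (\<lambda>v. (0, v)) (rev (dirs \<beta>)) @ map (\<lambda>v. (v, 0)) (dirs \<alpha>)) h (x, y) * \<phi> y) = (LINT y|M. K \<alpha> \<beta> x y * \<phi> y)"
  proof (intro Bochner_Integration.integral_cong refl arg_cong2[where f = "(*)"])
    fix y assume "y \<in> space M"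
    then have "(x, y) \<in> \<Theta> \<times> \<Theta>" using assms(3) by simp
    moreover have "mset (map (\<lambda>v. (0, v)) (rev (dirs \<beta>)) @ map (\<lambda>v. (v, 0)) (dirs \<alpha>)) = mset (map (\<lambda>v. (v, 0)) (dirs \<alpha>) @ map (\<lambda>v. (0, v)) (dirs \<beta>))"
      by (simp add: union_commute)
    ultimately show "iter_pd (map (\<lambda>v. (0, v)) (rev (dirs \<beta>)) @ map (\<lambda>v. (v, 0)) (dirs \<alpha>)) h (x, y) = K \<alpha> \<beta> x y"
      using split_list_perm[OF open_\<Theta> h dirs_Basis dirs_Basis length_dirs_le[OF assms(1)] length_dirs_le[OF assms(2)]]
      unfolding mixed_deriv_eq_jet jet_kernel_def fst_conv snd_conv by blast
  qed
  finally show ?thesis by (simp add: length_dirs)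
qed

lemma Kop_L2: "F \<in> V \<Longrightarrow> \<beta> \<in> A \<Longrightarrow> (\<lambda>y. Kop F (\<beta>, y)) \<in> L2 \<Theta>"
  using Kop_in by (simp add: L2_family_def)

text \<open>Against a test function the derivative falls on the kernel, where it is classical. The
  components of an image are thus the weak derivatives of its component 0, whatever family the
  operator is applied to; this is what places its range inside the embedded H^k.\<close>

lemma Kop_weak_deriv:
  assumes F: "F \<in> V" and \<beta>: "\<beta> \<in> A"
  shows "has_weak_deriv \<Theta> \<beta> (\<lambda>y. Kop F (\<lambda>_. 0, y)) (\<lambda>y. Kop F (\<beta>, y))"
  unfolding has_weak_deriv_def
proof (intro conjI allI impI)
  show "locally_integrable \<Theta> (\<lambda>y. Kop F (\<lambda>_. 0, y))" "locally_integrable \<Theta> (\<lambda>y. Kop F (\<beta>, y))"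
    using Kop_L2[OF F] \<beta> by (auto intro!: L2_locally_integrable)
  fix \<phi> assume \<phi>: "test_function \<Theta> \<phi>"
  have ti: "integrable M \<psi>" if "test_function \<Theta> \<psi>" for \<psi>
    using locally_integrable_mult_test[OF integrable_locally that, of "\<lambda>_. 1"] by simp
  have t: "test_function \<Theta> (pderiv_mi \<beta> \<phi>)" unfolding pderiv_mi_eq by (rule test_function_iter_pd[OF \<phi> dirs_Basis])
  have "(LINT y|M. Kop F (\<lambda>_. 0, y) * pderiv_mi \<beta> \<phi> y) = (\<Sum>\<alpha>\<in>A. LINT x|M. F (\<alpha>, x) * (LINT y|M. K \<alpha> (\<lambda>_. 0) x y * pderiv_mi \<beta> \<phi> y))"
    by (rule integral_Kop_mult[OF F zero_in_multi_indices ti[OF t]])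
  also have "\<dots> = (\<Sum>\<alpha>\<in>A. LINT x|M. (- 1) ^ sum \<beta> UNIV * (F (\<alpha>, x) * (LINT y|M. K \<alpha> \<beta> x y * \<phi> y)))"
    using K_weak_deriv[OF _ \<beta> _ \<phi>] by (intro sum.cong refl Bochner_Integration.integral_cong) simp_all
  also have "\<dots> = (- 1) ^ sum \<beta> UNIV * (\<Sum>\<alpha>\<in>A. LINT x|M. F (\<alpha>, x) * (LINT y|M. K \<alpha> \<beta> x y * \<phi> y))"
    by (simp add: sum_distrib_left)
  also have "\<dots> = (- 1) ^ sum \<beta> UNIV * (LINT y|M. Kop F (\<beta>, y) * \<phi> y)"
    by (subst integral_Kop_mult[OF F \<beta> ti[OF \<phi>]]) simp
  finally show "(LINT y|M. Kop F (\<lambda>_. 0, y) * pderiv_mi \<beta> \<phi> y) = (- 1) ^ sum \<beta> UNIV * (LINT y|M. Kop F (\<beta>, y) * \<phi> y)" .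
qed

section \<open>Boundedness, compactness and positivity of the integral operator\<close>

lemma ip_Kop_le: 
  assumes "F \<in> V"
  shows "ip (Kop F) F \<le> KB * card A * measure lebesgue \<Theta> * ip F F"
proof -
  have "ip (Kop F) F = (\<Sum>\<beta>\<in>A. LINT y|M. Kop F (\<beta>, y) * F (\<beta>, y))" by (simp add: family_inner_def)
  also have "\<dots> \<le> \<bar>\<Sum>\<beta>\<in>A. LINT y|M. Kop F (\<beta>, y) * F (\<beta>, y)\<bar>" by simp
  also have "\<dots> \<le> (KB * N1 F) * N1 F"
    using Kop_in[OF assms] assms by (intro kernel_sum_bound Kop_bound L2_integrable_mult) (auto simp: L2_family_def)
  also have "\<dots> = KB * (N1 F)\<^sup>2" by (simp add: power2_eq_square)
  also have "\<dots> \<le> KB * (card A * measure lebesgue \<Theta> * ip F F)"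
    by (intro mult_left_mono N1_bound assms KB(1))
  finally show ?thesis by (simp add: mult_ac)
qed

text \<open>Bounded families have bounded \<open>N1\<close>, so their images are uniformly bounded
  and equicontinuous in every component. Uniform limits also respect integrals against test
  functions, so the limit is again a family of weak derivatives: the same extraction provides limits
  inside H^k.\<close>

lemma Kop_compact:
  assumes F: "\<And>n. F n \<in> V" and C: "\<And>n::nat. ip (F n) (F n) \<le> C"
  obtains r G where "strict_mono (r :: nat \<Rightarrow> nat)" "G \<in> V"
    "\<And>\<beta>. \<beta> \<in> A \<Longrightarrow> has_weak_deriv \<Theta> \<beta> (\<lambda>y. G (\<lambda>_. 0, y)) (\<lambda>y. G (\<beta>, y))"
    "(\<lambda>n. ip (\<lambda>z. Kop (F (r n)) z - G z) (\<lambda>z. Kop (F (r n)) z - G z)) \<longlonglongrightarrow> 0"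
proof -
  define N where "N = sqrt (card A * measure lebesgue \<Theta> * \<bar>C\<bar>)"
  have N: "N1 (F n) \<le> N" for n
  proof -
    have "(N1 (F n))\<^sup>2 \<le> card A * measure lebesgue \<Theta> * ip (F n) (F n)" by (rule N1_bound[OF F])
    also have "\<dots> \<le> card A * measure lebesgue \<Theta> * \<bar>C\<bar>" using C[of n] by (intro mult_left_mono) auto
    finally show ?thesis unfolding N_def by (rule real_le_rsqrt)
  qed
  have N0: "N \<ge> 0" by (simp add: N_def)
  have "\<exists>r g. strict_mono (r :: nat \<Rightarrow> nat) \<and>
    (\<forall>\<beta>\<in>A. \<forall>e>0. \<exists>n0. \<forall>n\<ge>n0. \<forall>y\<in>\<Theta>. \<bar>Kop (F (r n)) (\<beta>, y) - g \<beta> y\<bar> < e)"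
  proof (rule arzela_ascoli_family[of A "\<lambda>\<beta> n y. Kop (F n) (\<beta>, y)" "KB * N"])
    show "finite A" by simp
    show "\<bar>Kop (F n) (\<beta>, y)\<bar> \<le> KB * N" if "\<beta> \<in> A" "y \<in> \<Theta>" for \<beta> n y
      using Kop_bound[OF F that, of n] mult_left_mono[OF N[of n] KB(1)] by linarith
    show "\<exists>d>0. \<forall>n. \<forall>x\<in>\<Theta>. \<forall>y\<in>\<Theta>. dist x y < d \<longrightarrow> \<bar>Kop (F n) (\<beta>, x) - Kop (F n) (\<beta>, y)\<bar> \<le> e"
      if "\<beta> \<in> A" "e > 0" for \<beta> e
    proof -
      have "e / (N + 1) > 0" using that N0 by simp
      then obtain d where d: "d > 0" "\<And>F \<beta> y y'. F \<in> V \<Longrightarrow> \<beta> \<in> A \<Longrightarrow> y \<in> \<Theta> \<Longrightarrow> y' \<in> \<Theta> \<Longrightarrow> dist y y' < d \<Longrightarrow>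
         \<bar>Kop F (\<beta>, y) - Kop F (\<beta>, y')\<bar> \<le> e / (N + 1) * N1 F"
        using Kop_equicontinuous by metis
      have "e / (N + 1) * N1 (F n) \<le> e" for n
      proof -
        have "e / (N + 1) * N1 (F n) \<le> e / (N + 1) * N" using N[of n] that N0 by (intro mult_left_mono) auto
        also have "\<dots> \<le> e" using that N0 by (simp add: field_simps)
        finally show ?thesis .
      qed
      then show ?thesis using d(1) d(2)[OF F that(1)] by (meson order_trans)
    qed
  qed
  then obtain r g where r: "strict_mono (r :: nat \<Rightarrow> nat)"
    and g: "\<And>\<beta> e. \<beta> \<in> A \<Longrightarrow> e > 0 \<Longrightarrow> \<exists>n0. \<forall>n\<ge>n0. \<forall>y\<in>\<Theta>. \<bar>Kop (F (r n)) (\<beta>, y) - g \<beta> y\<bar> < e" by blast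
  have lim: "(\<lambda>n. Kop (F (r n)) (\<beta>, y)) \<longlonglongrightarrow> g \<beta> y" if "\<beta> \<in> A" "y \<in> \<Theta>" for \<beta> y
  proof (rule LIMSEQ_I)
    fix e :: real assume "e > 0"
    from g[OF that(1) this] that(2)
    show "\<exists>n0. \<forall>n\<ge>n0. norm (Kop (F (r n)) (\<beta>, y) - g \<beta> y) < e" by fastforce
  qed
  have gm: "g \<beta> \<in> borel_measurable M" if "\<beta> \<in> A" for \<beta>
  proof (rule borel_measurable_LIMSEQ_real)
    show "(\<lambda>n. Kop (F (r n)) (\<beta>, y)) \<longlonglongrightarrow> g \<beta> y" if "y \<in> space M" for y
      using lim[OF \<open>\<beta> \<in> A\<close>] that by simp
    show "(\<lambda>y. Kop (F (r n)) (\<beta>, y)) \<in> borel_measurable M" for n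
      by (rule L2_measurable[OF Kop_L2[OF F \<open>\<beta> \<in> A\<close>]])
  qed
  have gL: "g \<beta> \<in> L2 \<Theta>" if "\<beta> \<in> A" for \<beta>
  proof -
    obtain n where n: "\<And>y. y \<in> \<Theta> \<Longrightarrow> \<bar>Kop (F (r n)) (\<beta>, y) - g \<beta> y\<bar> < 1" using g[OF \<open>\<beta> \<in> A\<close>, of 1] by auto
    have "\<bar>g \<beta> y\<bar> \<le> KB * N1 (F (r n)) + 1" if "y \<in> \<Theta>" for y
      using n[OF that] Kop_bound[OF F \<open>\<beta> \<in> A\<close> that, of "r n"] by linarith
    then show ?thesis by (rule L2_bounded[OF gm[OF that]])
  qed
  define G where "G = (\<lambda>(\<beta>, y). g \<beta> y)"
  have GV: "G \<in> V" using gL by (simp add: G_def L2_family_def)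
  interpret S: semi_inner V ip by (rule semi_inner_family)
  show thesis
  proof (rule that[OF r GV])
    have lim_int: "(\<lambda>n. LINT y|M. Kop (F (r n)) (\<beta>, y) * \<psi> y) \<longlonglongrightarrow> (LINT y|M. g \<beta> y * \<psi> y)"
      if "\<beta> \<in> A" "test_function \<Theta> \<psi>" for \<beta> \<psi>
    proof (rule integral_dominated_convergence)
      have \<psi>: "integrable M \<psi>" using locally_integrable_mult_test[OF integrable_locally that(2), of "\<lambda>_. 1"] by simp
      then show "integrable M (\<lambda>y. KB * N * \<bar>\<psi> y\<bar>)" by simp
      show "(\<lambda>y. g \<beta> y * \<psi> y) \<in> borel_measurable M" using gm[OF that(1)] \<psi> by simp
      show "(\<lambda>y. Kop (F (r n)) (\<beta>, y) * \<psi> y) \<in> borel_measurable M" for n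
        using L2_measurable[OF Kop_L2[OF F that(1)]] \<psi> by simp
      show "AE y in M. (\<lambda>n. Kop (F (r n)) (\<beta>, y) * \<psi> y) \<longlonglongrightarrow> g \<beta> y * \<psi> y"
        using lim[OF that(1)] by (intro AE_I2 tendsto_mult_right) simp
      show "AE y in M. norm (Kop (F (r n)) (\<beta>, y) * \<psi> y) \<le> KB * N * \<bar>\<psi> y\<bar>" for n
      proof (intro AE_I2)
        fix y assume "y \<in> space M"
        then have "\<bar>Kop (F (r n)) (\<beta>, y)\<bar> \<le> KB * N"
          using Kop_bound[OF F that(1), of y "r n"] mult_left_mono[OF N[of "r n"] KB(1)] by simp
        then show "norm (Kop (F (r n)) (\<beta>, y) * \<psi> y) \<le> KB * N * \<bar>\<psi> y\<bar>" by (simp add: abs_mult mult_right_mono)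
      qed
    qed
    show "has_weak_deriv \<Theta> \<beta> (\<lambda>y. G (\<lambda>_. 0, y)) (\<lambda>y. G (\<beta>, y))" if \<beta>: "\<beta> \<in> A" for \<beta>
      unfolding has_weak_deriv_def G_def case_prod_conv
    proof (intro conjI allI impI)
      show "locally_integrable \<Theta> (\<lambda>y. g (\<lambda>_. 0) y)" "locally_integrable \<Theta> (\<lambda>y. g \<beta> y)"
        using gL \<beta> by (auto intro: L2_locally_integrable)
      fix \<phi> assume \<phi>: "test_function \<Theta> \<phi>"
      have t: "test_function \<Theta> (pderiv_mi \<beta> \<phi>)" unfolding pderiv_mi_eq by (rule test_function_iter_pd[OF \<phi> dirs_Basis])
      have "(\<lambda>n. LINT y|M. Kop (F (r n)) (\<lambda>_. 0, y) * pderiv_mi \<beta> \<phi> y) \<longlonglongrightarrow> (LINT y|M. g (\<lambda>_. 0) y * pderiv_mi \<beta> \<phi> y)"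
        by (rule lim_int[OF zero_in_multi_indices t])
      moreover have "(\<lambda>n. LINT y|M. Kop (F (r n)) (\<lambda>_. 0, y) * pderiv_mi \<beta> \<phi> y) \<longlonglongrightarrow> (- 1) ^ sum \<beta> UNIV * (LINT y|M. g \<beta> y * \<phi> y)"
        using tendsto_mult_left[OF lim_int[OF \<beta> \<phi>], of "(- 1) ^ sum \<beta> UNIV"]
          Kop_weak_deriv[OF F \<beta>] \<phi> by (simp add: has_weak_deriv_def)
      ultimately show "(LINT y|M. g (\<lambda>_. 0) y * pderiv_mi \<beta> \<phi> y) = (- 1) ^ sum \<beta> UNIV * (LINT y|M. g \<beta> y * \<phi> y)"
        by (rule LIMSEQ_unique)
    qed
    show "(\<lambda>n. ip (\<lambda>z. Kop (F (r n)) z - G z) (\<lambda>z. Kop (F (r n)) z - G z)) \<longlonglongrightarrow> 0"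
      unfolding family_inner_def
    proof (rule tendsto_null_sum)
      fix \<beta> assume \<beta>: "\<beta> \<in> A"
      show "(\<lambda>n. LINT y|M. (Kop (F (r n)) (\<beta>, y) - G (\<beta>, y)) * (Kop (F (r n)) (\<beta>, y) - G (\<beta>, y))) \<longlonglongrightarrow> 0"
      proof (rule LIMSEQ_I)
        fix e :: real assume "e > 0"
        define m where "m = measure lebesgue \<Theta> + 1"
        have m: "m > 0" by (simp add: m_def add_nonneg_pos)
        define c where "c = sqrt (e / m)"
        have c: "c > 0" "c\<^sup>2 * m = e" using m \<open>e > 0\<close> by (simp_all add: c_def)
        obtain n0 where n0: "\<And>n y. n \<ge> n0 \<Longrightarrow> y \<in> \<Theta> \<Longrightarrow> \<bar>Kop (F (r n)) (\<beta>, y) - g \<beta> y\<bar> < c" using g[OF \<beta> c(1)] by auto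
        have "norm ((LINT y|M. (Kop (F (r n)) (\<beta>, y) - G (\<beta>, y)) * (Kop (F (r n)) (\<beta>, y) - G (\<beta>, y))) - 0) < e" if n: "n \<ge> n0" for n
        proof -
          have D: "(\<lambda>y. Kop (F (r n)) (\<beta>, y) - G (\<beta>, y)) \<in> L2 \<Theta>"
            using S.diff_in[OF Kop_in[OF F[of "r n"]] GV] \<beta> by (simp add: L2_family_def)
          have "(LINT y|M. (Kop (F (r n)) (\<beta>, y) - G (\<beta>, y)) * (Kop (F (r n)) (\<beta>, y) - G (\<beta>, y))) \<le> (LINT y|M. c\<^sup>2)"
          proof (rule integral_mono)
            show "integrable M (\<lambda>y. (Kop (F (r n)) (\<beta>, y) - G (\<beta>, y)) * (Kop (F (r n)) (\<beta>, y) - G (\<beta>, y)))"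
              by (rule L2_integrable_mult[OF D D])
            show "(Kop (F (r n)) (\<beta>, y) - G (\<beta>, y)) * (Kop (F (r n)) (\<beta>, y) - G (\<beta>, y)) \<le> c\<^sup>2" if "y \<in> space M" for y
              using n0[OF n, of y] that abs_le_square_iff[of "Kop (F (r n)) (\<beta>, y) - G (\<beta>, y)" c] c(1)
              by (simp add: G_def power2_eq_square)
          qed simp
          also have "\<dots> = c\<^sup>2 * (m - 1)" by (simp add: measure_M m_def)
          also have "\<dots> < e" using c by (simp add: algebra_simps)
          finally show ?thesis using Bochner_Integration.integral_nonneg[of M "\<lambda>y. (Kop (F (r n)) (\<beta>, y) - G (\<beta>, y)) * (Kop (F (r n)) (\<beta>, y) - G (\<beta>, y))"] by simp
        qed
        then show "\<exists>n0. \<forall>n\<ge>n0. norm ((LINT y|M. (Kop (F (r n)) (\<beta>, y) - G (\<beta>, y)) * (Kop (F (r n)) (\<beta>, y) - G (\<beta>, y))) - 0) < e" by blast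
      qed
    qed
  qed
qed

text \<open>
  The density \<open>G\<close> is approximated by point masses on a fine partition, which reduces the claim to
  the positive definiteness of the jet kernel.
\<close>

lemma psd_point_and_density:
  assumes G: "G \<in> V" and \<alpha>: "\<alpha> \<in> A" and x: "x \<in> \<Theta>"
  shows "0 \<le> s\<^sup>2 * K \<alpha> \<alpha> x x + 2 * s * Kop G (\<alpha>, x) + ip (Kop G) G"
proof -
  define N where "N = N1 G"
  have N: "N \<ge> 0" using N1_nonneg by (simp add: N_def)
  \<comment> \<open>Discretisation costs at most \<open>e * N\<close> in each value of
    \<open>Kop G\<close>, hence \<open>2 * \<bar>s\<bar> * e * N\<close> in the cross term and
    \<open>e * N * N\<close> in the quadratic term; the second is stated with a spare factor
    2.\<close>
  have main: "0 \<le> s\<^sup>2 * K \<alpha> \<alpha> x x + 2 * s * Kop G (\<alpha>, x) + ip (Kop G) G + e * (2 * \<bar>s\<bar> * N + 2 * N * N)" if e: "e > 0" for e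
  proof -
    obtain d where d: "d > 0" "\<And>\<alpha> \<beta> x x' y y'. \<alpha> \<in> A \<Longrightarrow> \<beta> \<in> A \<Longrightarrow> x \<in> \<Theta> \<Longrightarrow> x' \<in> \<Theta> \<Longrightarrow> y \<in> \<Theta> \<Longrightarrow> y' \<in> \<Theta> \<Longrightarrow>
       dist x x' < d \<Longrightarrow> dist y y' < d \<Longrightarrow> \<bar>K \<alpha> \<beta> x y - K \<alpha> \<beta> x' y'\<bar> < e" using K_uniform[OF e] by metis
    obtain P q where P: "finite P" "P \<subseteq> \<Theta>" "\<And>x. x \<in> \<Theta> \<Longrightarrow> q x \<in> P \<and> dist x (q x) < d"
      "\<And>p. {x \<in> \<Theta>. q x = p} \<in> sets M" by (rule cells[OF d(1)]) (rule that)
    have qP: "\<And>x. x \<in> \<Theta> \<Longrightarrow> q x \<in> P" using P(3) by blast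
    have q\<Theta>: "\<And>x. x \<in> \<Theta> \<Longrightarrow> q x \<in> \<Theta>" using P(2,3) by blast
    define a where "a = (\<lambda>\<beta> p. LINT x|M. indicator {x \<in> \<Theta>. q x = p} x * G (\<beta>, x))"
    have Gi: "integrable M (\<lambda>x. G (\<beta>, x))" if "\<beta> \<in> A" for \<beta> using V_integrable[OF G that] .
    have cs: "(\<Sum>p\<in>P. \<Phi> p * (LINT x|M. indicator {x \<in> \<Theta>. q x = p} x * g x)) = (LINT x|M. \<Phi> (q x) * g x)"
      "integrable M (\<lambda>x. \<Phi> (q x) * g x)" if "integrable M g" for g and \<Phi> :: "real^'a \<Rightarrow> real"
      using cell_sum[of P q g \<Phi>] P(1,4) qP that by blast+
    \<comment> \<open>\<open>Kop G\<close> with the density replaced by its cell masses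
      \<open>a \<beta> p\<close>, placed at the centres \<open>p\<close>.\<close>
    define S where "S = (\<lambda>\<gamma> y. \<Sum>\<beta>\<in>A. \<Sum>p\<in>P. K \<beta> \<gamma> p y * a \<beta> p)"
    have S_eq: "S \<gamma> y = (\<Sum>\<beta>\<in>A. LINT z|M. K \<beta> \<gamma> (q z) y * G (\<beta>, z))" for \<gamma> y
      unfolding S_def a_def by (intro sum.cong refl cs(1) Gi)
    have S_err: "\<bar>S \<gamma> y - Kop G (\<gamma>, y')\<bar> \<le> e * N" if \<gamma>: "\<gamma> \<in> A" and y: "y \<in> \<Theta>" "y' \<in> \<Theta>" "dist y y' < d" for \<gamma> y y'
    proof -
      have i1: "integrable M (\<lambda>z. K \<beta> \<gamma> (q z) y * G (\<beta>, z))" if "\<beta> \<in> A" for \<beta>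
        by (rule cs(2)[OF Gi[OF that]])
      have i2: "integrable M (\<lambda>z. K \<beta> \<gamma> z y' * G (\<beta>, z))" if "\<beta> \<in> A" for \<beta>
        using K_integrable(1)[OF that \<gamma> y(2) Gi[OF that]] .
      have "S \<gamma> y - Kop G (\<gamma>, y') = (\<Sum>\<beta>\<in>A. LINT z|M. (K \<beta> \<gamma> (q z) y - K \<beta> \<gamma> z y') * G (\<beta>, z))"
        unfolding S_eq Kop_def using y i1 i2 by (simp add: left_diff_distrib sum_subtractf)
      also have "\<bar>\<dots>\<bar> \<le> e * N" unfolding N_def
      proof (rule kernel_sum_bound[OF G])
        show "integrable M (\<lambda>z. (K \<beta> \<gamma> (q z) y - K \<beta> \<gamma> z y') * G (\<beta>, z))" if "\<beta> \<in> A" for \<beta>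
          using i1[OF that] i2[OF that] by (simp add: left_diff_distrib)
        show "\<bar>K \<beta> \<gamma> (q z) y - K \<beta> \<gamma> z y'\<bar> \<le> e" if "\<beta> \<in> A" "z \<in> \<Theta>" for \<beta> z
          using d(2)[OF that(1) \<gamma> q\<Theta>[OF that(2)] that(2) y(1,2)] P(3)[OF that(2)] y(3) by (simp add: dist_commute)
      qed
      finally show ?thesis .
    qed
    \<comment> \<open>\<open>None\<close> indexes the given point with weight \<open>s\<close>, and
      \<open>Some (\<beta>, p)\<close> the cell mass of component \<open>\<beta>\<close> at
      \<open>p\<close>. The option type keeps the two apart even if \<open>x\<close> is one of the
      centres.\<close>
    define I where "I = insert None (Some ` (A \<times> P))"
    define c where "c = case_option s (\<lambda>(\<beta>, p). a \<beta> p)"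
    define ai :: "(('a \<Rightarrow> nat) \<times> (real^'a)) option \<Rightarrow> 'a \<Rightarrow> nat" where "ai = case_option \<alpha> fst"
    define xi :: "(('a \<Rightarrow> nat) \<times> (real^'a)) option \<Rightarrow> real^'a" where "xi = case_option x snd"
    have "0 \<le> (\<Sum>i\<in>I. \<Sum>j\<in>I. c i * K (ai i) (ai j) (xi i) (xi j) * c j)"
      using P(1,2) \<alpha> x by (intro K_psd) (auto simp: I_def ai_def xi_def)
    also have "\<dots> = s * K \<alpha> \<alpha> x x * s + (\<Sum>t\<in>A \<times> P. s * K \<alpha> (fst t) x (snd t) * a (fst t) (snd t))
       + (\<Sum>t\<in>A \<times> P. a (fst t) (snd t) * K (fst t) \<alpha> (snd t) x * s)
       + (\<Sum>t\<in>A \<times> P. \<Sum>u\<in>A \<times> P. a (fst t) (snd t) * K (fst t) (fst u) (snd t) (snd u) * a (fst u) (snd u))"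
      using P(1) by (simp add: I_def c_def ai_def xi_def sum.reindex case_prod_beta sum.distrib)
    also have "(\<Sum>t\<in>A \<times> P. s * K \<alpha> (fst t) x (snd t) * a (fst t) (snd t)) = (\<Sum>t\<in>A \<times> P. a (fst t) (snd t) * K (fst t) \<alpha> (snd t) x * s)"
      using K_sym[OF \<alpha>] x P(2) by (intro sum.cong refl) (auto simp: subset_iff)
    also have "(\<Sum>t\<in>A \<times> P. a (fst t) (snd t) * K (fst t) \<alpha> (snd t) x * s) = s * S \<alpha> x"
      by (simp add: S_def sum.cartesian_product' sum_distrib_left mult_ac)
    also have "(\<Sum>t\<in>A \<times> P. \<Sum>u\<in>A \<times> P. a (fst t) (snd t) * K (fst t) (fst u) (snd t) (snd u) * a (fst u) (snd u))
       = (\<Sum>u\<in>A \<times> P. \<Sum>t\<in>A \<times> P. a (fst t) (snd t) * K (fst t) (fst u) (snd t) (snd u) * a (fst u) (snd u))"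
      by (rule sum.swap)
    also have "\<dots> = (\<Sum>\<gamma>\<in>A. \<Sum>p\<in>P. S \<gamma> p * a \<gamma> p)"
      by (simp add: S_def sum.cartesian_product' sum_distrib_left mult_ac)
    also have "\<dots> = (\<Sum>\<gamma>\<in>A. LINT y|M. S \<gamma> (q y) * G (\<gamma>, y))"
      unfolding a_def by (intro sum.cong refl cs(1) Gi)
    finally have pos: "0 \<le> s\<^sup>2 * K \<alpha> \<alpha> x x + 2 * s * S \<alpha> x + (\<Sum>\<gamma>\<in>A. LINT y|M. S \<gamma> (q y) * G (\<gamma>, y))"
      by (simp add: power2_eq_square mult_ac)
    have i1: "integrable M (\<lambda>y. S \<gamma> (q y) * G (\<gamma>, y))" if "\<gamma> \<in> A" for \<gamma>
      using cs(2)[OF Gi[OF that]] .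
    have i2: "integrable M (\<lambda>y. Kop G (\<gamma>, y) * G (\<gamma>, y))" if "\<gamma> \<in> A" for \<gamma>
      using Kop_L2[OF G that] G that by (intro L2_integrable_mult) (auto simp: L2_family_def)
    have "(\<Sum>\<gamma>\<in>A. LINT y|M. S \<gamma> (q y) * G (\<gamma>, y)) - ip (Kop G) G = (\<Sum>\<gamma>\<in>A. LINT y|M. (S \<gamma> (q y) - Kop G (\<gamma>, y)) * G (\<gamma>, y))"
      using i1 i2 by (simp add: family_inner_def left_diff_distrib sum_subtractf)
    also have "\<bar>\<dots>\<bar> \<le> (e * N) * N" unfolding N_def
    proof (rule kernel_sum_bound[OF G])
      show "integrable M (\<lambda>y. (S \<gamma> (q y) - Kop G (\<gamma>, y)) * G (\<gamma>, y))" if "\<gamma> \<in> A" for \<gamma>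
        using i1[OF that] i2[OF that] by (simp add: left_diff_distrib)
      show "\<bar>S \<gamma> (q y) - Kop G (\<gamma>, y)\<bar> \<le> e * N1 G" if "\<gamma> \<in> A" "y \<in> \<Theta>" for \<gamma> y
        using S_err[OF that(1) q\<Theta>[OF that(2)] that(2)] P(3)[OF that(2)] by (simp add: N_def dist_commute)
    qed
    finally have 2: "(\<Sum>\<gamma>\<in>A. LINT y|M. S \<gamma> (q y) * G (\<gamma>, y)) \<le> ip (Kop G) G + (e * N) * N" by linarith
    have "\<bar>S \<alpha> x - Kop G (\<alpha>, x)\<bar> \<le> e * N" using S_err[OF \<alpha> x x] d(1) by simp
    then have "\<bar>s * (S \<alpha> x - Kop G (\<alpha>, x))\<bar> \<le> \<bar>s\<bar> * (e * N)" by (simp add: abs_mult mult_left_mono)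
    then have 1: "s * S \<alpha> x \<le> s * Kop G (\<alpha>, x) + \<bar>s\<bar> * (e * N)" by (simp add: right_diff_distrib)
    have "e * N * N \<ge> 0" using e N by simp
    then show ?thesis using pos 1 2 by (simp add: algebra_simps)
  qed
  define c where "c = 2 * \<bar>s\<bar> * N + 2 * N * N + 1"
  have c: "c > 0" using N by (simp add: c_def add_nonneg_pos)
  show ?thesis
  proof (rule field_le_epsilon)
    fix e :: real assume "e > 0"
    then have "0 \<le> s\<^sup>2 * K \<alpha> \<alpha> x x + 2 * s * Kop G (\<alpha>, x) + ip (Kop G) G + e / c * (2 * \<bar>s\<bar> * N + 2 * N * N)"
      using c by (intro main) simp
    moreover have "e / c * (2 * \<bar>s\<bar> * N + 2 * N * N) \<le> e"
    proof -
      have "e / c * (2 * \<bar>s\<bar> * N + 2 * N * N) = e / c * (c - 1)" by (simp add: c_def)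
      also have "\<dots> = e - e / c" using c by (simp add: right_diff_distrib)
      also have "\<dots> \<le> e" using c \<open>e > 0\<close> by simp
      finally show ?thesis .
    qed
    ultimately show "0 \<le> s\<^sup>2 * K \<alpha> \<alpha> x x + 2 * s * Kop G (\<alpha>, x) + ip (Kop G) G + e" by linarith
  qed
qed

text \<open>The case \<open>s = 0\<close> of the previous inequality. A point of \<Theta> has to be
  named there, so the empty set is treated apart.\<close>

lemma Kop_pos:
  assumes "F \<in> V"
  shows "0 \<le> ip (Kop F) F"
proof (cases "\<Theta> = {}")
  case True
  have "(LINT x|M. f x) = (0::real)" for f
    using True by (intro integral_eq_zero_AE AE_I2) simp
  then show ?thesis by (simp add: family_inner_def)
next
  case False
  then obtain x where "x \<in> \<Theta>" by auto
  from psd_point_and_density[OF assms zero_in_multi_indices this, of 0] show ?thesis by simp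
qed

sublocale S: psd_compact V ip Kop "KB * card A * measure lebesgue \<Theta>"
proof -
  interpret semi_inner V ip by (rule semi_inner_family)
  show "psd_compact V ip Kop (KB * card A * measure lebesgue \<Theta>)"
  proof
    fix F :: "nat \<Rightarrow> ('a \<Rightarrow> nat) \<times> (real^'a) \<Rightarrow> real" and C
    assume F: "\<And>n. F n \<in> V" "\<And>n. ip (F n) (F n) \<le> C"
    show "\<exists>r g. strict_mono r \<and> g \<in> V \<and>
          (\<lambda>n. ip (\<lambda>x. Kop (F (r n)) x - g x) (\<lambda>x. Kop (F (r n)) x - g x)) \<longlonglongrightarrow> 0"
      by (rule Kop_compact[of F C, OF F]) blast
  qed (use Kop_in Kop_sym Kop_pos ip_Kop_le in auto)
qed

section \<open>The trace formula\<close>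

definition kernel_trace :: real where
  "kernel_trace = (\<Sum>\<alpha>\<in>A. LINT x|M. K \<alpha> \<alpha> x x)"

lemma K_diag_integrable: "\<alpha> \<in> A \<Longrightarrow> integrable M (\<lambda>x. K \<alpha> \<alpha> x x)"
  using KB(2)[of \<alpha> \<alpha>] K_section(3)[of \<alpha> \<alpha>] by (intro M.integrable_const_bound[where B = KB] AE_I2) auto

text \<open>
  Mercer's upper bound: testing positivity against a point mass minus its projection to finitely
  many eigenfunctions.
\<close>

lemma eigenfunction_sum_le_diag:
  assumes es: "S.eigsys Kop J lam e" and F: "finite F" "F \<subseteq> J" and \<alpha>: "\<alpha> \<in> A" and x: "x \<in> \<Theta>"
  shows "(\<Sum>j\<in>F. (Kop (e j) (\<alpha>, x))\<^sup>2 / lam j) \<le> K \<alpha> \<alpha> x x"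
proof -
  \<comment> \<open>\<open>Kop (e j) / lam j\<close> is the continuous representative of
    \<open>e j\<close>, so the \<open>c j\<close> are minus the coefficients of the point mass at
    \<open>(\<alpha>, x)\<close>. Writing Q for the sum to be bounded, <Kop G, G> = Q and Kop
    G(\<alpha>, x) = -Q, and positivity with s = 1 reads K - 2 Q + Q \<ge> 0.\<close>
  define c where "c = (\<lambda>j. - Kop (e j) (\<alpha>, x) / lam j)"
  define G where "G = (\<lambda>z. \<Sum>j\<in>F. c j * e j z)"
  have p: "lam j > 0" "e j \<in> V" "S.eigv Kop (lam j) (e j)" if "j \<in> F" for j
    using S.eigsys_pos[OF es, of j] that F(2) by auto
  have on: "ip (e i) (e j) = (if i = j then 1 else 0)" if "i \<in> F" "j \<in> F" for i j
    using es that F(2) unfolding S.eigsys_def by (metis subsetD)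
  have GV: "G \<in> V" unfolding G_def by (intro S.sum_in F(1) p)
  have ipG: "ip G u = (\<Sum>j\<in>F. c j * ip (e j) u)" if "u \<in> V" for u
    unfolding G_def by (intro S.ip_sum F(1) p that)
  have Ge: "ip (e i) G = c i" if "i \<in> F" for i
  proof -
    have "ip (e i) G = ip G (e i)" using S.ip_sym GV p(2)[OF that] by blast
    also have "\<dots> = (\<Sum>j\<in>F. if j = i then c i else 0)"
      unfolding ipG[OF p(2)[OF that]] using on that by (intro sum.cong) auto
    finally show ?thesis using that F(1) by simp
  qed
  have "ip (Kop G) G = ip G (Kop G)" by (rule S.T_sym[OF GV GV])
  also have "\<dots> = (\<Sum>j\<in>F. c j * ip (e j) (Kop G))" by (rule ipG[OF Kop_in[OF GV]])
  also have "\<dots> = (\<Sum>j\<in>F. c j * (lam j * c j))"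
  proof (intro sum.cong refl arg_cong2[where f = "(*)"])
    fix j assume j: "j \<in> F"
    have "ip (e j) (Kop G) = ip (Kop (e j)) G" using S.T_sym[OF p(2)[OF j] GV] by simp
    also have "\<dots> = lam j * c j" using p(3)[OF j] GV Ge[OF j] by (simp add: S.eigv_def)
    finally show "ip (e j) (Kop G) = lam j * c j" .
  qed
  also have "\<dots> = (\<Sum>j\<in>F. (Kop (e j) (\<alpha>, x))\<^sup>2 / lam j)"
    using p(1) by (intro sum.cong refl) (auto simp: c_def power2_eq_square field_simps)
  finally have 1: "ip (Kop G) G = (\<Sum>j\<in>F. (Kop (e j) (\<alpha>, x))\<^sup>2 / lam j)" .
  have "Kop G (\<alpha>, x) = (\<Sum>j\<in>F. c j * Kop (e j) (\<alpha>, x))"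
    unfolding G_def by (rule Kop_sum[OF F(1) p(2) \<alpha>])
  also have "\<dots> = - (\<Sum>j\<in>F. (Kop (e j) (\<alpha>, x))\<^sup>2 / lam j)"
    by (simp add: c_def power2_eq_square sum_negf)
  finally have 2: "Kop G (\<alpha>, x) = - (\<Sum>j\<in>F. (Kop (e j) (\<alpha>, x))\<^sup>2 / lam j)" .
  show ?thesis using psd_point_and_density[OF GV \<alpha> x, of 1] 1 2 by simp
qed

text \<open>Since |Kop e_j|^2 = lam_j^2, each eigenvalue is the integral of the squared components
  of \<open>Kop (e j)\<close> divided by \<open>lam j\<close>; summing over \<open>F\<close> and
  integrating the pointwise Mercer bound yields the trace.\<close>

lemma sum_eigenvalues_le_trace:
  assumes es: "S.eigsys Kop J lam e" and F: "finite F" "F \<subseteq> J"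
  shows "(\<Sum>j\<in>F. lam j) \<le> kernel_trace"
proof -
  have p: "lam j > 0" "e j \<in> V" "S.eigv Kop (lam j) (e j)" "ip (e j) (Kop (e j)) = lam j" if "j \<in> F" for j
    using S.eigsys_pos[OF es, of j] that F(2) S.T_sym[of "e j" "e j"] by auto
  have i: "integrable M (\<lambda>x. (Kop (e j) (\<alpha>, x))\<^sup>2 / lam j)" if "j \<in> F" "\<alpha> \<in> A" for j \<alpha>
    using L2_integrable_mult[OF Kop_L2[OF p(2)[OF that(1)] that(2)] Kop_L2[OF p(2)[OF that(1)] that(2)]]
    by (simp add: power2_eq_square)
  have "lam j = (\<Sum>\<alpha>\<in>A. LINT x|M. (Kop (e j) (\<alpha>, x))\<^sup>2 / lam j)" if j: "j \<in> F" for j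
  proof -
    have "ip (Kop (e j)) (Kop (e j)) = lam j * lam j"
      using p[OF j] Kop_in[OF p(2)[OF j]] by (simp add: S.eigv_def)
    then have "lam j = ip (Kop (e j)) (Kop (e j)) / lam j" using p(1)[OF j] by simp
    then show ?thesis by (simp add: family_inner_def power2_eq_square sum_divide_distrib)
  qed
  then have "(\<Sum>j\<in>F. lam j) = (\<Sum>j\<in>F. \<Sum>\<alpha>\<in>A. LINT x|M. (Kop (e j) (\<alpha>, x))\<^sup>2 / lam j)" by (rule sum.cong[OF refl])
  also have "\<dots> = (\<Sum>\<alpha>\<in>A. \<Sum>j\<in>F. LINT x|M. (Kop (e j) (\<alpha>, x))\<^sup>2 / lam j)" by (rule sum.swap)
  also have "\<dots> = (\<Sum>\<alpha>\<in>A. LINT x|M. (\<Sum>j\<in>F. (Kop (e j) (\<alpha>, x))\<^sup>2 / lam j))"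
    using i by (intro sum.cong refl Bochner_Integration.integral_sum[symmetric])
  also have "\<dots> \<le> kernel_trace" unfolding kernel_trace_def
  proof (intro sum_mono integral_mono)
    fix \<alpha> assume \<alpha>: "\<alpha> \<in> A"
    show "integrable M (\<lambda>x. \<Sum>j\<in>F. (Kop (e j) (\<alpha>, x))\<^sup>2 / lam j)"
      using i[OF _ \<alpha>] by (intro Bochner_Integration.integrable_sum)
    show "integrable M (\<lambda>x. K \<alpha> \<alpha> x x)" by (rule K_diag_integrable[OF \<alpha>])
    show "(\<Sum>j\<in>F. (Kop (e j) (\<alpha>, x))\<^sup>2 / lam j) \<le> K \<alpha> \<alpha> x x" if "x \<in> space M" for x
      using eigenfunction_sum_le_diag[OF es F \<alpha>] that by simp
  qed
  finally show ?thesis .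
qed

text \<open>
  Lower bound: the trace of the compression of the operator to families that are constant on small
  cells tends to the integral of the diagonal.
\<close>

lemma trace_le_eigenvalue_bound:
  assumes es: "S.eigsys Kop J lam e"
    and s: "\<And>F. finite F \<Longrightarrow> F \<subseteq> J \<Longrightarrow> (\<Sum>j\<in>F. lam j) \<le> s"
  shows "kernel_trace \<le> s"
proof -
  \<comment> \<open>A pointwise loss of \<epsilon> in every diagonal entry costs
    \<open>\<epsilon> * m\<close> in the trace.\<close>
  define m where "m = card A * measure lebesgue \<Theta>"
  have m: "m \<ge> 0" by (simp add: m_def)
  have main: "kernel_trace - \<epsilon> * m \<le> s" if \<epsilon>: "\<epsilon> > 0" for \<epsilon>
  proof -
    obtain d where d: "d > 0" "\<And>\<alpha> \<beta> x x' y y'. \<alpha> \<in> A \<Longrightarrow> \<beta> \<in> A \<Longrightarrow> x \<in> \<Theta> \<Longrightarrow> x' \<in> \<Theta> \<Longrightarrow> y \<in> \<Theta> \<Longrightarrow> y' \<in> \<Theta> \<Longrightarrow>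
       dist x x' < d \<Longrightarrow> dist y y' < d \<Longrightarrow> \<bar>K \<alpha> \<beta> x y - K \<alpha> \<beta> x' y'\<bar> < \<epsilon>" using K_uniform[OF \<epsilon>] by metis
    \<comment> \<open>Points of one cell are within \<open>d / 2\<close> of its centre and hence
      within \<open>d\<close> of each other.\<close>
    have d2: "d / 2 > 0" using d(1) by simp
    obtain P q where P: "finite P" "P \<subseteq> \<Theta>" "\<And>x. x \<in> \<Theta> \<Longrightarrow> q x \<in> P \<and> dist x (q x) < d / 2"
      "\<And>p. {x \<in> \<Theta>. q x = p} \<in> sets M" by (rule cells[OF d2]) (rule that)
    define C where "C = (\<lambda>p. {x \<in> \<Theta>. q x = p})"
    have Cs: "C p \<in> sets M" "C p \<subseteq> \<Theta>" for p using P(4) by (auto simp: C_def)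
    have ind: "indicator (C p) \<in> borel_measurable M" for p using Cs(1) by (rule borel_measurable_indicator)
    define \<mu> where "\<mu> = (\<lambda>p. measure M (C p))"
    \<comment> \<open>The normalised indicators of the cells, one for each component. For a null
      cell the division by 0 makes \<open>u\<close> the zero family, so the system is orthonormal up
      to zero vectors.\<close>
    define u :: "(real^'a) \<times> ('a \<Rightarrow> nat) \<Rightarrow> ('a \<Rightarrow> nat) \<times> (real^'a) \<Rightarrow> real" where
      "u = (\<lambda>(p, \<alpha>) (\<beta>, x). if \<beta> = \<alpha> then indicator (C p) x / sqrt (\<mu> p) else 0)"
    have ui: "integrable M (\<lambda>x. indicator (C p) x * f x)" if "integrable M f" for f :: "_ \<Rightarrow> real" and p
      using integrable_mult_indicator[OF Cs(1) that] by simp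
    have uV: "u t \<in> V" for t
    proof -
      obtain p \<alpha> where t: "t = (p, \<alpha>)" by (cases t)
      have "(\<lambda>x. indicator (C p) x / sqrt (\<mu> p)) \<in> L2 \<Theta>"
      proof (rule L2_bounded[where C = "1 / sqrt (\<mu> p)"])
        show "(\<lambda>x. indicator (C p) x / sqrt (\<mu> p)) \<in> borel_measurable M"
          by (rule borel_measurable_divide[OF ind]) simp
      qed (auto simp: indicator_def \<mu>_def)
      moreover have "(\<lambda>x. 0) \<in> L2 \<Theta>" by (rule L2_bounded[where C = 0]) auto
      ultimately have "(\<lambda>x. u t (\<beta>, x)) \<in> L2 \<Theta>" for \<beta> by (cases "\<beta> = \<alpha>") (simp_all add: t u_def)
      then show ?thesis by (simp add: L2_family_def)
    qed
    have ip_u: "ip (u (p, \<alpha>)) g = (LINT x|M. indicator (C p) x * g (\<alpha>, x)) / sqrt (\<mu> p)" if "\<alpha> \<in> A" for p \<alpha> g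
    proof -
      have "ip (u (p, \<alpha>)) g = (\<Sum>\<beta>\<in>A. if \<beta> = \<alpha> then (LINT x|M. indicator (C p) x * g (\<alpha>, x)) / sqrt (\<mu> p) else 0)"
        unfolding family_inner_def u_def by (intro sum.cong refl) auto
      then show ?thesis using that by simp
    qed
    have uu: "ip (u (p, \<alpha>)) (u (p', \<alpha>')) = (if \<alpha> = \<alpha>' \<and> p = p' \<and> \<mu> p > 0 then 1 else 0)" if "\<alpha> \<in> A" for p p' \<alpha> \<alpha>'
    proof -
      have "(LINT x|M. indicator (C p) x * u (p', \<alpha>') (\<alpha>, x)) = (if \<alpha> = \<alpha>' \<and> p = p' then \<mu> p / sqrt (\<mu> p) else 0)"
      proof (cases "\<alpha> = \<alpha>' \<and> p = p'")
        case True
        have "(LINT x|M. indicator (C p) x * u (p', \<alpha>') (\<alpha>, x)) = (LINT x|M. indicator (C p) x / sqrt (\<mu> p))"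
          using True by (intro Bochner_Integration.integral_cong refl) (auto simp: u_def indicator_def)
        then show ?thesis using True Cs by (simp add: \<mu>_def Int_absorb2)
      next
        case False
        have "(LINT x|M. indicator (C p) x * u (p', \<alpha>') (\<alpha>, x)) = (LINT x|M. 0)"
          using False by (intro Bochner_Integration.integral_cong refl) (auto simp: u_def indicator_def C_def)
        then show ?thesis unfolding if_not_P[OF False] by simp
      qed
      moreover have "\<mu> p \<ge> 0" by (simp add: \<mu>_def)
      ultimately show ?thesis unfolding ip_u[OF that] by (auto simp: less_le)
    qed
    have le: "(\<Sum>t\<in>P \<times> A. ip (Kop (u t)) (u t)) \<le> s"
    proof (rule S.trace_le_sum_eigenvalues[OF es _ uV _ s])
      show "finite (P \<times> A)" using P(1) by simp
      fix g assume g: "g \<in> V"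
      show "(\<Sum>t\<in>P \<times> A. (ip (u t) g)\<^sup>2) \<le> ip g g"
        using P(1) by (intro S.bessel uV g) (auto simp: uu split: if_splits)
    qed
    \<comment> \<open>The right-hand side is the double integral of the kernel over the cell,
      divided by its measure. Replacing K(x,y) by K(y,y) - \<epsilon> under the integral over
      \<open>x\<close> cancels that division. On a null cell both sides vanish.\<close>
    have low: "(LINT y|M. indicator (C p) y * (K \<alpha> \<alpha> y y - \<epsilon>)) \<le> ip (Kop (u (p, \<alpha>))) (u (p, \<alpha>))" if \<alpha>: "\<alpha> \<in> A" for p \<alpha>
    proof -
      have Kd: "integrable M (\<lambda>y. K \<alpha> \<alpha> y y - \<epsilon>)" using K_diag_integrable[OF \<alpha>] by simp
      have Ku: "Kop (u (p, \<alpha>)) (\<alpha>, y) = (LINT x|M. indicator (C p) x * K \<alpha> \<alpha> x y) / sqrt (\<mu> p)" if "y \<in> \<Theta>" for y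
      proof -
        have "Kop (u (p, \<alpha>)) (\<alpha>, y) = (\<Sum>\<beta>\<in>A. LINT x|M. K \<beta> \<alpha> x y * u (p, \<alpha>) (\<beta>, x))"
          using that by (simp add: Kop_def)
        also have "\<dots> = (\<Sum>\<beta>\<in>A. if \<beta> = \<alpha> then (LINT x|M. indicator (C p) x * K \<alpha> \<alpha> x y) / sqrt (\<mu> p) else 0)"
          by (intro sum.cong refl) (auto simp: u_def mult.commute)
        finally show ?thesis using \<alpha> by simp
      qed
      have "(LINT y|M. indicator (C p) y * (K \<alpha> \<alpha> y y - \<epsilon>)) \<le> (LINT y|M. indicator (C p) y * (Kop (u (p, \<alpha>)) (\<alpha>, y) / sqrt (\<mu> p)))"
      proof (cases "\<mu> p = 0")
        case True
        then have "emeasure M (C p) = 0" by (simp add: \<mu>_def M.emeasure_eq_measure)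
        then have "C p \<in> null_sets M" using Cs by auto
        from AE_not_in[OF this] have "AE y in M. indicator (C p) y * (K \<alpha> \<alpha> y y - \<epsilon>) = 0"
          by eventually_elim simp
        then have "(LINT y|M. indicator (C p) y * (K \<alpha> \<alpha> y y - \<epsilon>)) = 0" by (rule integral_eq_zero_AE)
        then show ?thesis using True by simp
      next
        case False
        then have \<mu>: "\<mu> p > 0" by (simp add: \<mu>_def less_le)
        show ?thesis
        proof (rule integral_mono)
          show "integrable M (\<lambda>y. indicator (C p) y * (K \<alpha> \<alpha> y y - \<epsilon>))" by (rule ui[OF Kd])
          show "integrable M (\<lambda>y. indicator (C p) y * (Kop (u (p, \<alpha>)) (\<alpha>, y) / sqrt (\<mu> p)))"
            using L2_integrable[OF Kop_L2[OF uV \<alpha>]] by (intro ui) simp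
          fix y assume "y \<in> space M"
          show "indicator (C p) y * (K \<alpha> \<alpha> y y - \<epsilon>) \<le> indicator (C p) y * (Kop (u (p, \<alpha>)) (\<alpha>, y) / sqrt (\<mu> p))"
          proof (cases "y \<in> C p")
            case True
            have y: "y \<in> \<Theta>" "q y = p" using True by (auto simp: C_def)
            have "(LINT x|M. indicator (C p) x * (K \<alpha> \<alpha> y y - \<epsilon>)) \<le> (LINT x|M. indicator (C p) x * K \<alpha> \<alpha> x y)"
            proof (rule integral_mono)
              show "integrable M (\<lambda>x. indicator (C p) x * (K \<alpha> \<alpha> y y - \<epsilon>))" by (rule ui) simp
              show "integrable M (\<lambda>x. indicator (C p) x * K \<alpha> \<alpha> x y)"
                using K_integrable(1)[OF \<alpha> \<alpha> y(1), of "\<lambda>_. 1"] by (intro ui) simp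
              fix x assume "x \<in> space M"
              show "indicator (C p) x * (K \<alpha> \<alpha> y y - \<epsilon>) \<le> indicator (C p) x * K \<alpha> \<alpha> x y"
              proof (cases "x \<in> C p")
                case True
                then have x: "x \<in> \<Theta>" "q x = p" by (auto simp: C_def)
                have "dist x y \<le> dist x p + dist y p" by (rule dist_triangle2)
                also have "\<dots> < d" using P(3)[OF x(1)] P(3)[OF y(1)] x(2) y(2) by simp
                finally have "\<bar>K \<alpha> \<alpha> x y - K \<alpha> \<alpha> y y\<bar> < \<epsilon>" using d(1) by (intro d(2) \<alpha> x y) auto
                then show ?thesis using True by simp
              qed simp
            qed
            then have "(K \<alpha> \<alpha> y y - \<epsilon>) * \<mu> p \<le> (LINT x|M. indicator (C p) x * K \<alpha> \<alpha> x y)"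
              using Cs by (simp add: \<mu>_def Int_absorb2 mult.commute)
            then have "K \<alpha> \<alpha> y y - \<epsilon> \<le> (LINT x|M. indicator (C p) x * K \<alpha> \<alpha> x y) / \<mu> p"
              using \<mu> by (simp add: pos_le_divide_eq)
            also have "\<dots> = Kop (u (p, \<alpha>)) (\<alpha>, y) / sqrt (\<mu> p)" using \<mu> by (simp add: Ku[OF y(1)])
            finally show ?thesis using True by simp
          qed simp
        qed
      qed
      also have "\<dots> = (LINT y|M. indicator (C p) y * Kop (u (p, \<alpha>)) (\<alpha>, y)) / sqrt (\<mu> p)" by simp
      also have "\<dots> = ip (u (p, \<alpha>)) (Kop (u (p, \<alpha>)))" by (rule ip_u[OF \<alpha>, symmetric])
      also have "\<dots> = ip (Kop (u (p, \<alpha>))) (u (p, \<alpha>))" by (rule S.ip_sym[OF uV Kop_in[OF uV]])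
      finally show ?thesis .
    qed
    have "kernel_trace - \<epsilon> * m = (\<Sum>\<alpha>\<in>A. LINT y|M. K \<alpha> \<alpha> y y - \<epsilon>)"
      using K_diag_integrable by (simp add: kernel_trace_def m_def sum_subtractf measure_M)
    also have "\<dots> = (\<Sum>\<alpha>\<in>A. \<Sum>p\<in>P. LINT y|M. indicator (C p) y * (K \<alpha> \<alpha> y y - \<epsilon>))"
    proof (intro sum.cong refl)
      fix \<alpha> assume \<alpha>: "\<alpha> \<in> A"
      have "integrable M (\<lambda>y. K \<alpha> \<alpha> y y - \<epsilon>)" using K_diag_integrable[OF \<alpha>] by simp
      from cell_sum(1)[of P q _ "\<lambda>_. 1", OF P(1) _ P(4) this] P(3)
      show "(LINT y|M. K \<alpha> \<alpha> y y - \<epsilon>) = (\<Sum>p\<in>P. LINT y|M. indicator (C p) y * (K \<alpha> \<alpha> y y - \<epsilon>))"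
        by (simp add: C_def)
    qed
    also have "\<dots> \<le> (\<Sum>\<alpha>\<in>A. \<Sum>p\<in>P. ip (Kop (u (p, \<alpha>))) (u (p, \<alpha>)))" by (intro sum_mono low)
    also have "\<dots> = (\<Sum>p\<in>P. \<Sum>\<alpha>\<in>A. ip (Kop (u (p, \<alpha>))) (u (p, \<alpha>)))" by (rule sum.swap)
    also have "\<dots> = (\<Sum>t\<in>P \<times> A. ip (Kop (u t)) (u t))" by (simp add: sum.cartesian_product')
    also have "\<dots> \<le> s" by (rule le)
    finally show ?thesis .
  qed
  show ?thesis
  proof (rule field_le_epsilon)
    fix e :: real assume "e > 0"
    then have "e / (m + 1) > 0" using m by simp
    then have "kernel_trace - e / (m + 1) * m \<le> s" by (rule main)
    moreover have "e / (m + 1) * m \<le> e" using m \<open>e > 0\<close> by (simp add: field_simps)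
    ultimately show "kernel_trace \<le> s + e" by linarith
  qed
qed

text \<open>The bound on finite partial sums gives summability; the reverse inequality is then
  applied with the infinite sum itself as \<open>s\<close>.\<close>

lemma has_sum_eigenvalues:
  assumes es: "S.eigsys Kop J lam e"
  shows "(lam has_sum kernel_trace) J"
proof -
  have pos: "lam j \<ge> 0" if "j \<in> J" for j using S.eigsys_pos(1)[OF es that] by simp
  have sum: "lam summable_on J"
    using sum_eigenvalues_le_trace[OF es] pos
    by (intro nonneg_bdd_above_summable_on) (auto simp: bdd_above_def)
  have "infsum lam J \<le> kernel_trace" using sum sum_eigenvalues_le_trace[OF es] by (intro infsum_le_finite_sums)
  moreover have "kernel_trace \<le> infsum lam J"
    using sum pos by (intro trace_le_eigenvalue_bound[OF es] finite_sum_le_infsum) auto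
  ultimately show ?thesis using sum has_sum_infsum by force
qed

section \<open>Transfer to the Sobolev space\<close>

abbreviation T where "T \<equiv> kernel_op k \<Theta> h"
abbreviation W where "W \<equiv> weak_derivs"

lemma kernel_op_eq: "f \<in> sobolev k \<Theta> \<Longrightarrow> y \<in> \<Theta> \<Longrightarrow> T f y = Kop (W f) (\<lambda>_. 0, y)"
  using K_integrable(1)[OF _ zero_in_multi_indices _ V_integrable[OF weak_derivs_family]]
  by (simp add: kernel_op_def Kop_def weak_derivs_def)

lemma kernel_op_weak_deriv:
  assumes f: "f \<in> sobolev k \<Theta>" and \<beta>: "\<beta> \<in> A"
  shows "has_weak_deriv \<Theta> \<beta> (T f) (\<lambda>y. Kop (W f) (\<beta>, y))"
proof -
  have eq: "Kop (W f) (\<lambda>_. 0, y) = T f y" if "y \<in> \<Theta>" for y using kernel_op_eq[OF f that] by simp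
  have L: "(\<lambda>y. Kop (W f) (\<lambda>_. 0, y)) \<in> L2 \<Theta>" by (rule Kop_L2[OF weak_derivs_family[OF f] zero_in_multi_indices])
  have "T f \<in> borel_measurable M"
    using L2_measurable[OF L] eq by (subst measurable_cong[where g = "\<lambda>y. Kop (W f) (\<lambda>_. 0, y)"]) auto
  then have "T f \<in> L2 \<Theta>" using L2_cong[OF L ae_eqI[OF eq]] by simp
  then show ?thesis
    using Kop_weak_deriv[OF weak_derivs_family[OF f] \<beta>] Kop_L2[OF weak_derivs_family[OF f] \<beta>]
    by (intro has_weak_deriv_cong[OF _ ae_eqI[OF eq] _ ae_eq_refl]) (auto intro: L2_locally_integrable)
qed

lemma kernel_op_sobolev: "f \<in> sobolev k \<Theta> \<Longrightarrow> T f \<in> sobolev k \<Theta>"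
  by (rule sobolevI[OF kernel_op_weak_deriv]) (auto intro: Kop_L2 weak_derivs_family)

lemma weak_derivs_kernel_op:
  "f \<in> sobolev k \<Theta> \<Longrightarrow> \<beta> \<in> A \<Longrightarrow> ae_eq \<Theta> (\<lambda>x. W (T f) (\<beta>, x)) (\<lambda>x. Kop (W f) (\<beta>, x))"
  using has_weak_deriv_weak_deriv(2)[OF kernel_op_weak_deriv] by (simp add: weak_derivs_def)

lemma sob_inner_kernel_op:
  assumes "f \<in> sobolev k \<Theta>" "g \<in> sobolev k \<Theta>"
  shows "sob_inner k \<Theta> (T f) g = ip (Kop (W f)) (W g)"
  unfolding sob_inner_eq using assms
  by (intro family_inner_cong weak_derivs_family Kop_in kernel_op_sobolev weak_derivs_kernel_op ae_eq_refl)

lemma psd_compact_kernel_op: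
  "psd_compact (sobolev k \<Theta>) (sob_inner k \<Theta>) T (KB * card A * measure lebesgue \<Theta>)"
proof -
  interpret H0: semi_inner "sobolev k \<Theta>" "sob_inner k \<Theta>" by (rule semi_inner_sobolev)
  show ?thesis
  proof
    show "T f \<in> sobolev k \<Theta>" if "f \<in> sobolev k \<Theta>" for f by (rule kernel_op_sobolev[OF that])
    show "sob_inner k \<Theta> (T f) g = sob_inner k \<Theta> f (T g)" if "f \<in> sobolev k \<Theta>" "g \<in> sobolev k \<Theta>" for f g
    proof -
      have "sob_inner k \<Theta> f (T g) = sob_inner k \<Theta> (T g) f" using that kernel_op_sobolev H0.ip_sym by blast
      also have "\<dots> = ip (Kop (W g)) (W f)" by (rule sob_inner_kernel_op[OF that(2,1)])
      also have "\<dots> = ip (W g) (Kop (W f))" by (rule Kop_sym; rule weak_derivs_family; rule that)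
      also have "\<dots> = ip (Kop (W f)) (W g)" using that Kop_in weak_derivs_family S.ip_sym by blast
      finally show ?thesis using sob_inner_kernel_op[OF that] by simp
    qed
    show "0 \<le> sob_inner k \<Theta> (T f) f" if "f \<in> sobolev k \<Theta>" for f
      unfolding sob_inner_kernel_op[OF that that] by (rule Kop_pos[OF weak_derivs_family[OF that]])
    show "sob_inner k \<Theta> (T f) f \<le> KB * card A * measure lebesgue \<Theta> * sob_inner k \<Theta> f f" if "f \<in> sobolev k \<Theta>" for f
      unfolding sob_inner_kernel_op[OF that that] sob_inner_eq[of k f f] by (rule ip_Kop_le[OF weak_derivs_family[OF that]])
    fix f :: "nat \<Rightarrow> real^'a \<Rightarrow> real" and C
    assume f: "\<And>n. f n \<in> sobolev k \<Theta>" and C: "\<And>n. sob_inner k \<Theta> (f n) (f n) \<le> C"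
    show "\<exists>r g. strict_mono r \<and> g \<in> sobolev k \<Theta> \<and>
       (\<lambda>n. sob_inner k \<Theta> (\<lambda>x. T (f (r n)) x - g x) (\<lambda>x. T (f (r n)) x - g x)) \<longlonglongrightarrow> 0"
    proof (rule Kop_compact[of "\<lambda>n. W (f n)" C])
      show "W (f n) \<in> V" for n by (rule weak_derivs_family[OF f])
      show "ip (W (f n)) (W (f n)) \<le> C" for n using C[of n] by (simp add: sob_inner_eq)
      fix r :: "nat \<Rightarrow> nat" and G
      assume r: "strict_mono r" and G: "G \<in> V"
        and wd: "\<And>\<beta>. \<beta> \<in> A \<Longrightarrow> has_weak_deriv \<Theta> \<beta> (\<lambda>y. G (\<lambda>_. 0, y)) (\<lambda>y. G (\<beta>, y))"
        and lim: "(\<lambda>n. ip (\<lambda>z. Kop (W (f (r n))) z - G z) (\<lambda>z. Kop (W (f (r n))) z - G z)) \<longlonglongrightarrow> 0"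
      \<comment> \<open>The limit family consists of the weak derivatives of its component 0, so
        this component is the limit in H^k.\<close>
      define g where "g = (\<lambda>y. G (\<lambda>_. 0, y))"
      have gS: "g \<in> sobolev k \<Theta>" unfolding g_def
        by (rule sobolevI[OF wd]) (use G in \<open>auto simp: L2_family_def\<close>)
      have gG: "ae_eq \<Theta> (\<lambda>x. W g (\<beta>, x)) (\<lambda>x. G (\<beta>, x))" if "\<beta> \<in> A" for \<beta>
        using has_weak_deriv_weak_deriv(2)[OF wd[OF that]] by (simp add: weak_derivs_def g_def)
      have "sob_inner k \<Theta> (\<lambda>x. T (f (r n)) x - g x) (\<lambda>x. T (f (r n)) x - g x)
        = ip (\<lambda>z. Kop (W (f (r n))) z - G z) (\<lambda>z. Kop (W (f (r n))) z - G z)" for n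
      proof -
        have ae: "ae_eq \<Theta> (\<lambda>x. W (\<lambda>x. T (f (r n)) x - g x) (\<beta>, x)) (\<lambda>x. Kop (W (f (r n))) (\<beta>, x) - G (\<beta>, x))"
          if \<beta>: "\<beta> \<in> A" for \<beta>
        proof -
          have "ae_eq \<Theta> (\<lambda>x. W (\<lambda>x. T (f (r n)) x - g x) (\<beta>, x)) (\<lambda>x. 1 * W (T (f (r n))) (\<beta>, x) + (- 1) * W g (\<beta>, x))"
            using sobolev_lin(2)[OF kernel_op_sobolev[OF f[of "r n"]] gS \<beta>, of 1 "- 1"] by (simp add: weak_derivs_def)
          moreover have "ae_eq \<Theta> (\<lambda>x. 1 * W (T (f (r n))) (\<beta>, x) + (- 1) * W g (\<beta>, x)) (\<lambda>x. 1 * Kop (W (f (r n))) (\<beta>, x) + (- 1) * G (\<beta>, x))"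
            by (rule ae_eq_lin[OF weak_derivs_kernel_op[OF f \<beta>] gG[OF \<beta>]])
          ultimately show ?thesis using ae_eq_trans by fastforce
        qed
        have "(\<lambda>x. T (f (r n)) x - g x) \<in> sobolev k \<Theta>" by (rule H0.diff_in[OF kernel_op_sobolev[OF f] gS])
        moreover have "(\<lambda>z. Kop (W (f (r n))) z - G z) \<in> V" by (rule S.diff_in[OF Kop_in[OF weak_derivs_family[OF f]] G])
        ultimately show ?thesis unfolding sob_inner_eq by (intro family_inner_cong weak_derivs_family ae)
      qed
      then show ?thesis using r gS lim by (intro exI[of _ r] exI[of _ g]) simp
    qed
  qed
qed

sublocale H: psd_compact "sobolev k \<Theta>" "sob_inner k \<Theta>" T "KB * card A * measure lebesgue \<Theta>"
  by (rule psd_compact_kernel_op)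

text \<open>In H^k the eigenvalue equation is tested only against families of weak derivatives. Read
  as nullness of \<open>T e - \<mu> e\<close> it becomes an identity almost everywhere in each
  component, which can be tested against every family.\<close>

lemma eigv_weak_derivs:
  assumes e: "H.eigv T \<mu> e"
  shows "S.eigv Kop \<mu> (W e)"
proof -
  have eS: "e \<in> sobolev k \<Theta>" using e by (simp add: H.eigv_def)
  note TS = kernel_op_sobolev[OF eS]
  have D: "(\<lambda>x. 1 * T e x + (- \<mu>) * e x) \<in> sobolev k \<Theta>" by (rule H.lincomb[OF TS eS])
  have "sob_inner k \<Theta> (\<lambda>x. T e x - \<mu> * e x) (\<lambda>x. T e x - \<mu> * e x) = 0"
    using e H.eigv_iff_null[of e T \<mu>] eS TS by simp
  then have z: "ae_eq \<Theta> (\<lambda>x. W (\<lambda>x. 1 * T e x + (- \<mu>) * e x) (\<beta>, x)) (\<lambda>_. 0)" if "\<beta> \<in> A" for \<beta>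
    using family_inner_null[OF weak_derivs_family[OF D]] that by (simp add: sob_inner_eq)
  have ae: "ae_eq \<Theta> (\<lambda>x. Kop (W e) (\<beta>, x)) (\<lambda>x. \<mu> * W e (\<beta>, x))" if \<beta>: "\<beta> \<in> A" for \<beta>
  proof -
    have "ae_eq \<Theta> (\<lambda>x. W (\<lambda>x. 1 * T e x + (- \<mu>) * e x) (\<beta>, x)) (\<lambda>x. 1 * W (T e) (\<beta>, x) + (- \<mu>) * W e (\<beta>, x))"
      using sobolev_lin(2)[OF TS eS \<beta>, of 1 "- \<mu>"] by (simp add: weak_derivs_def)
    with z[OF \<beta>] weak_derivs_kernel_op[OF eS \<beta>] show ?thesis
      unfolding ae_eq_def by eventually_elim simp
  qed
  have WV: "W e \<in> V" by (rule weak_derivs_family[OF eS])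
  have "ip (Kop (W e)) u = \<mu> * ip (W e) u" if u: "u \<in> V" for u
  proof -
    have "ip (Kop (W e)) u = ip (\<lambda>z. \<mu> * W e z) u"
      by (intro family_inner_cong Kop_in WV S.scale_in u ae ae_eq_refl)
    then show ?thesis using S.ip_scale[OF WV u] by simp
  qed
  then show ?thesis using WV by (simp add: S.eigv_def)
qed

text \<open>Only completeness needs an argument: the larger space must bring no new eigenvectors.
  For \<mu> \<noteq> 0 an eigenfamily \<open>F\<close> equals \<open>Kop F / \<mu>\<close>, hence is
  the family of weak derivatives of its component 0, and completeness in H^k applies to that
  function.\<close>

lemma eigsys_weak_derivs:
  assumes es: "H.eigsys T J lam e"
  shows "S.eigsys Kop J lam (\<lambda>j. W (e j))"
  unfolding S.eigsys_def
proof (intro conjI ballI allI impI)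
  show "J = {1..} \<or> (\<exists>N. J = {1..N})" using es unfolding H.eigsys_def by blast
  show "lam j \<noteq> 0" "S.eigv Kop (lam j) (W (e j))" if "j \<in> J" for j
    using es that eigv_weak_derivs unfolding H.eigsys_def by blast+
  show "ip (W (e i)) (W (e j)) = (if i = j then 1 else 0)" if "i \<in> J" "j \<in> J" for i j
    using es that unfolding H.eigsys_def sob_inner_eq by blast
  show "\<bar>lam j\<bar> \<le> \<bar>lam i\<bar>" if "i \<in> J" "j \<in> J" "i \<le> j" for i j
    using es that unfolding H.eigsys_def by blast
  fix \<mu> F assume *: "\<mu> \<noteq> 0 \<and> S.eigv Kop \<mu> F \<and> (\<forall>j\<in>J. lam j = \<mu> \<longrightarrow> ip F (W (e j)) = 0)"
  then have \<mu>: "\<mu> \<noteq> 0" and F: "S.eigv Kop \<mu> F" and FV: "F \<in> V" by (auto simp: S.eigv_def)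
  have eS: "e j \<in> sobolev k \<Theta>" if "j \<in> J" for j using H.eigsys_pos(2)[OF es that] .
  \<comment> \<open>The vanishing second summand gives \<open>f\<close> the shape of a linear
    combination of two functions, for which weak derivatives are known.\<close>
  define f where "f = (\<lambda>y. (1 / \<mu>) * Kop F (\<lambda>_. 0, y) + 0 * Kop F (\<lambda>_. 0, y))"
  have wd: "has_weak_deriv \<Theta> \<beta> f (\<lambda>y. (1 / \<mu>) * Kop F (\<beta>, y) + 0 * Kop F (\<beta>, y))" if "\<beta> \<in> A" for \<beta>
    unfolding f_def by (rule has_weak_deriv_lin[OF Kop_weak_deriv[OF FV that] Kop_weak_deriv[OF FV that]])
  have fS: "f \<in> sobolev k \<Theta>" by (rule sobolevI[OF wd L2_lin[OF Kop_L2[OF FV] Kop_L2[OF FV]]])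
  have "ip (\<lambda>z. Kop F z - \<mu> * F z) (\<lambda>z. Kop F z - \<mu> * F z) = 0"
    using F S.eigv_iff_null[of F Kop \<mu>] FV Kop_in by simp
  then have n: "ae_eq \<Theta> (\<lambda>x. Kop F (\<beta>, x) - \<mu> * F (\<beta>, x)) (\<lambda>_. 0)" if "\<beta> \<in> A" for \<beta>
    using family_inner_null[OF S.diff_in[OF Kop_in[OF FV] S.scale_in[OF FV]]] that by simp
  have WF: "ae_eq \<Theta> (\<lambda>x. W f (\<beta>, x)) (\<lambda>x. F (\<beta>, x))" if \<beta>: "\<beta> \<in> A" for \<beta>
    using has_weak_deriv_weak_deriv(2)[OF wd[OF \<beta>]] n[OF \<beta>] \<mu>
    unfolding ae_eq_def weak_derivs_def by (auto elim!: eventually_elim2 simp: field_simps)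
  have WV: "W f \<in> V" by (rule weak_derivs_family[OF fS])
  have ipW: "ip (W f) u = ip F u" if "u \<in> V" for u
    by (intro family_inner_cong WV FV that WF ae_eq_refl)
  have "ae_eq \<Theta> (T f) (\<lambda>x. \<mu> * f x)"
  proof (rule ae_eqI)
    fix y assume y: "y \<in> \<Theta>"
    have "T f y = Kop (W f) (\<lambda>_. 0, y)" by (rule kernel_op_eq[OF fS y])
    also have "\<dots> = Kop F (\<lambda>_. 0, y)" by (rule Kop_cong[OF WV FV WF zero_in_multi_indices])
    finally show "T f y = \<mu> * f y" using \<mu> by (simp add: f_def)
  qed
  then have "H.eigv T \<mu> f"
    using H.eigv_iff_null[of f T \<mu>] fS kernel_op_sobolev[OF fS] ae_eq_iff_sob_inner[OF kernel_op_sobolev[OF fS] H.scale_in[OF fS]] by blast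
  moreover have "\<forall>j\<in>J. lam j = \<mu> \<longrightarrow> sob_inner k \<Theta> f (e j) = 0"
    using * ipW weak_derivs_family eS by (simp add: sob_inner_eq)
  ultimately have "sob_inner k \<Theta> f f = 0" using es \<mu> unfolding H.eigsys_def by blast
  then have "ip F (W f) = 0" using ipW[OF WV] by (simp add: sob_inner_eq)
  then show "ip F F = 0" using ipW[OF FV] S.ip_sym[OF FV WV] by simp
qed

text \<open>Almost everywhere equality in H^k is equality up to a null vector. The operator is kept
  general so that the statement also covers the composition of \<open>T\<close> with an unknown
  adjoint.\<close>

lemma eigensystem_iff:
  assumes "\<And>f. f \<in> sobolev k \<Theta> \<Longrightarrow> R f \<in> sobolev k \<Theta>"
  shows "eigensystem k \<Theta> R J lam e \<longleftrightarrow> H.eigsys R J lam e"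
proof -
  have ev: "H.eigv R \<mu> f \<longleftrightarrow> f \<in> sobolev k \<Theta> \<and> ae_eq \<Theta> (R f) (\<lambda>x. \<mu> * f x)" for \<mu> f
  proof (cases "f \<in> sobolev k \<Theta>")
    case True
    show ?thesis
      using H.eigv_iff_null[of f R \<mu>] True assms[OF True] ae_eq_iff_sob_inner[OF assms[OF True] H.scale_in[OF True]] by blast
  qed (simp add: H.eigv_def)
  have z: "f \<in> sobolev k \<Theta> \<Longrightarrow> ae_eq \<Theta> f (\<lambda>_. 0) \<longleftrightarrow> sob_inner k \<Theta> f f = 0" for f
    using sob_inner_null by blast
  show ?thesis unfolding eigensystem_def H.eigsys_def ev using z by blast
qed

section \<open>Compactness, singular values and nuclear norm of the kernel operator\<close>

lemma linear_op_kernel_op: "linear_op k \<Theta> T"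
  unfolding linear_op_def
proof (intro conjI ballI allI)
  show "T f \<in> sobolev k \<Theta>" if "f \<in> sobolev k \<Theta>" for f by (rule kernel_op_sobolev[OF that])
  fix f g a b assume f: "f \<in> sobolev k \<Theta>" and g: "g \<in> sobolev k \<Theta>"
  let ?l = "T (\<lambda>x. a * f x + b * g x)" and ?r = "\<lambda>x. a * T f x + b * T g x"
  have S: "?l \<in> sobolev k \<Theta>" "?r \<in> sobolev k \<Theta>"
    by (intro kernel_op_sobolev H.lincomb f g)+
  have "sob_inner k \<Theta> ?l u = sob_inner k \<Theta> ?r u" if "u \<in> sobolev k \<Theta>" for u
    using H.T_lin[OF f g that] H.ip_lin[OF kernel_op_sobolev[OF f] kernel_op_sobolev[OF g] that] by simp
  then have "sob_inner k \<Theta> (\<lambda>x. ?l x - ?r x) (\<lambda>x. ?l x - ?r x) = 0"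
    using H.ip_diff[OF S H.diff_in[OF S]] H.diff_in[OF S] by simp
  then show "ae_eq \<Theta> ?l ?r" using ae_eq_iff_sob_inner[OF S] by simp
qed

lemma compact_op_kernel_op: "compact_op k \<Theta> T"
  unfolding compact_op_def
proof (intro conjI allI impI linear_op_kernel_op)
  fix f :: "nat \<Rightarrow> real^'a \<Rightarrow> real"
  assume "(\<forall>n. f n \<in> sobolev k \<Theta>) \<and> (\<exists>C. \<forall>n. sob_norm k \<Theta> (f n) \<le> C)"
  then obtain C where f: "\<And>n. f n \<in> sobolev k \<Theta>" and C: "\<And>n. sob_norm k \<Theta> (f n) \<le> C" by auto
  have "sob_inner k \<Theta> (f n) (f n) \<le> C\<^sup>2" for n
    using C[of n] H.ip_nonneg[OF f[of n]] by (simp add: sob_norm_def sqrt_le_D)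
  from H.T_compact[of f, OF f this] obtain r :: "nat \<Rightarrow> nat" and g where "strict_mono r" "g \<in> sobolev k \<Theta>"
    and lim: "(\<lambda>n. sob_inner k \<Theta> (\<lambda>x. T (f (r n)) x - g x) (\<lambda>x. T (f (r n)) x - g x)) \<longlonglongrightarrow> 0"
    by (elim exE conjE) (rule that)
  moreover have "(\<lambda>n. sob_norm k \<Theta> (\<lambda>x. T (f (r n)) x - g x)) \<longlonglongrightarrow> 0"
    using tendsto_real_sqrt[OF lim] by (simp add: sob_norm_def)
  ultimately show "\<exists>r. \<exists>g\<in>sobolev k \<Theta>. strict_mono r \<and> (\<lambda>n. sob_norm k \<Theta> (\<lambda>x. T (f (r n)) x - g x)) \<longlonglongrightarrow> 0"
    by blast
qed

lemma adjoint_op_kernel_op: "adjoint_op k \<Theta> T T"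
  unfolding adjoint_op_def using linear_op_kernel_op H.T_sym by blast

lemma has_sum_eigensystem: "eigensystem k \<Theta> T J lam e \<Longrightarrow> (lam has_sum kernel_trace) J"
  using eigensystem_iff[of T, OF kernel_op_sobolev] eigsys_weak_derivs has_sum_eigenvalues by blast

text \<open>The adjoint \<open>R\<close> is any operator with the adjoint property. Since
  \<open>T\<close> is symmetric, the composition with \<open>R\<close> agrees weakly with the square
  of \<open>T\<close>, and the square roots of its eigenvalues form an eigensystem of
  \<open>T\<close>, whose sum is the trace.\<close>

lemma has_sum_singular_values:
  assumes "singular_values k \<Theta> T J s"
  shows "(s has_sum kernel_trace) J"
proof -
  obtain R mu e where R: "adjoint_op k \<Theta> T R" and es: "eigensystem k \<Theta> (R \<circ> T) J mu e"
    and s: "\<And>j. j \<in> J \<Longrightarrow> s j = sqrt (mu j)"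
    using assms unfolding singular_values_def by blast
  have RS: "R f \<in> sobolev k \<Theta>" if "f \<in> sobolev k \<Theta>" for f
    using R that unfolding adjoint_op_def linear_op_def by blast
  have RT: "(R \<circ> T) f \<in> sobolev k \<Theta>" if "f \<in> sobolev k \<Theta>" for f
    using RS kernel_op_sobolev[OF that] by simp
  have sq: "sob_inner k \<Theta> ((R \<circ> T) f) u = sob_inner k \<Theta> (T (T f)) u"
    if f: "f \<in> sobolev k \<Theta>" and u: "u \<in> sobolev k \<Theta>" for f u
  proof -
    have "sob_inner k \<Theta> ((R \<circ> T) f) u = sob_inner k \<Theta> u (R (T f))"
      using H.ip_sym[OF RT[OF f] u] by simp
    also have "\<dots> = sob_inner k \<Theta> (T u) (T f)"
      using R u kernel_op_sobolev[OF f] unfolding adjoint_op_def by metis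
    also have "\<dots> = sob_inner k \<Theta> u (T (T f))" by (rule H.T_sym[OF u kernel_op_sobolev[OF f]])
    also have "\<dots> = sob_inner k \<Theta> (T (T f)) u"
      by (rule H.ip_sym[OF u kernel_op_sobolev[OF kernel_op_sobolev[OF f]]])
    finally show ?thesis .
  qed
  have "H.eigsys (R \<circ> T) J mu e" using eigensystem_iff[of "R \<circ> T", OF RT] es by blast
  from H.eigsys_sqrt[OF sq this] have "((\<lambda>j. sqrt (mu j)) has_sum kernel_trace) J"
    using eigsys_weak_derivs has_sum_eigenvalues by blast
  then show ?thesis using s has_sum_cong by metis
qed

lemma singular_values_exist: "\<exists>J s. singular_values k \<Theta> T J s"
proof -
  obtain J lam e where "H.eigsys T J lam e" using H.eigsys_exists by blast
  from H.eigsys_square[of "T \<circ> T", OF _ this] have "H.eigsys (T \<circ> T) J (\<lambda>j. (lam j)\<^sup>2) e" by simp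
  then have "eigensystem k \<Theta> (T \<circ> T) J (\<lambda>j. (lam j)\<^sup>2) e"
    using eigensystem_iff[of "T \<circ> T"] kernel_op_sobolev by simp
  then have "singular_values k \<Theta> T J (\<lambda>j. sqrt ((lam j)\<^sup>2))"
    unfolding singular_values_def using adjoint_op_kernel_op
    by (intro exI[of _ T] exI[of _ "\<lambda>j. (lam j)\<^sup>2"] exI[of _ e]) simp
  then show ?thesis by blast
qed

lemma nuclear_op_kernel_op: "nuclear_op k \<Theta> T"
  unfolding nuclear_op_def
  using compact_op_kernel_op singular_values_exist has_sum_singular_values has_sum_imp_summable by blast

lemma nuclear_norm_kernel_op: "nuclear_norm k \<Theta> T = kernel_trace"
  unfolding nuclear_norm_def
proof (rule the_equality)
  show "\<exists>J s. singular_values k \<Theta> T J s \<and> kernel_trace = (\<Sum>\<^sub>\<infinity>j\<in>J. s j)"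
    using singular_values_exist has_sum_singular_values infsumI by metis
  show "r = kernel_trace" if "\<exists>J s. singular_values k \<Theta> T J s \<and> r = (\<Sum>\<^sub>\<infinity>j\<in>J. s j)" for r
    using that has_sum_singular_values infsumI by metis
qed

text \<open>On \<Theta> the extension is the kernel itself; the bound of the extension on the
  closure is what makes the real supremum an upper bound.\<close>

lemma kernel_trace_le: "kernel_trace \<le> measure lebesgue \<Theta> * (\<Sum>\<alpha>\<in>A. SUP x\<in>closure \<Theta>. \<bar>cont_ext (\<Theta> \<times> \<Theta>) (mixed_deriv \<alpha> \<alpha> h) (x, x)\<bar>)"
  unfolding kernel_trace_def sum_distrib_left
proof (rule sum_mono)
  fix \<alpha> assume \<alpha>: "\<alpha> \<in> A"
  let ?f = "\<lambda>x. \<bar>cont_ext (\<Theta> \<times> \<Theta>) (mixed_deriv \<alpha> \<alpha> h) (x, x)\<bar>"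
  have "?f x \<le> KB" if "x \<in> closure \<Theta>" for x
  proof (rule cont_ext_bounded[OF K_uniformly_continuous[OF \<alpha> \<alpha>]])
    show "\<bar>mixed_deriv \<alpha> \<alpha> h p\<bar> \<le> KB" if "p \<in> \<Theta> \<times> \<Theta>" for p using KB(2)[OF \<alpha> \<alpha>] that by auto
  qed (use that in \<open>simp add: closure_Times\<close>)
  then have bdd: "bdd_above (?f ` closure \<Theta>)" by (auto simp: bdd_above_def)
  have "(LINT x|M. K \<alpha> \<alpha> x x) \<le> (LINT x|M. (SUP x\<in>closure \<Theta>. ?f x))"
  proof (rule integral_mono)
    show "integrable M (\<lambda>x. K \<alpha> \<alpha> x x)" by (rule K_diag_integrable[OF \<alpha>])
    fix x assume "x \<in> space M"
    then have x: "x \<in> \<Theta>" by simp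
    have "K \<alpha> \<alpha> x x \<le> ?f x" using x by (simp add: cont_ext_def)
    also have "\<dots> \<le> (SUP x\<in>closure \<Theta>. ?f x)" using x closure_subset by (intro cSUP_upper bdd) auto
    finally show "K \<alpha> \<alpha> x x \<le> (SUP x\<in>closure \<Theta>. ?f x)" .
  qed simp
  then show "(LINT x|M. K \<alpha> \<alpha> x x) \<le> measure lebesgue \<Theta> * (SUP x\<in>closure \<Theta>. ?f x)"
    by (simp add: measure_M)
qed

lemma eigenvalue_le:
  assumes es: "eigensystem k \<Theta> T J lam e" and j: "j \<in> J"
  shows "lam j \<le> kernel_trace / real j"
proof -
  have H: "H.eigsys T J lam e" using eigensystem_iff[of T, OF kernel_op_sobolev] es by blast
  \<comment> \<open>The index set is an initial segment of the positive integers, so exactly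
    \<open>j\<close> eigenvalues up to \<open>lam j\<close> are available for the comparison with
    the trace.\<close>
  have J: "{1..j} \<subseteq> J" "j \<ge> 1" using es j unfolding eigensystem_def by auto
  have pos: "lam i > 0" if "i \<in> J" for i using H.eigsys_pos(1)[OF H that] .
  have "lam j \<le> lam i" if "i \<in> {1..j}" for i
  proof -
    have "i \<in> J" "i \<le> j" using J that by auto
    then have "\<bar>lam j\<bar> \<le> \<bar>lam i\<bar>" using es j unfolding eigensystem_def by blast
    then show ?thesis using pos[OF j] pos[OF \<open>i \<in> J\<close>] by simp
  qed
  then have "(\<Sum>i\<in>{1..j}. lam j) \<le> (\<Sum>i\<in>{1..j}. lam i)" by (rule sum_mono)
  also have "\<dots> \<le> kernel_trace" using sum_eigenvalues_le_trace[OF eigsys_weak_derivs[OF H] _ J(1)] by simp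
  finally show ?thesis using J(2) by (simp add: field_simps)
qed

end

theorem corollary3p7:
  fixes \<Theta> :: "(real^'d::finite) set"
    and h :: "(real^'d) \<times> (real^'d) \<Rightarrow> real"
    and k :: nat
  assumes "open \<Theta>" and "bounded \<Theta>"
    and "h \<in> Ckk k \<Theta>"
    and "pos_def_kernel \<Theta> h"
  shows "nuclear_op k \<Theta> (kernel_op k \<Theta> h)
    \<and> nonneg_op k \<Theta> (kernel_op k \<Theta> h)
    \<and> nuclear_norm k \<Theta> (kernel_op k \<Theta> h) =
        (\<Sum>\<alpha>\<in>multi_indices k. LINT x|lebesgue_on \<Theta>. mixed_deriv \<alpha> \<alpha> h (x, x))
    \<and> (\<forall>J lam e. eigensystem k \<Theta> (kernel_op k \<Theta> h) J lam e \<longrightarrow>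
          (lam has_sum nuclear_norm k \<Theta> (kernel_op k \<Theta> h)) J
        \<and> (\<forall>j\<in>J. lam j \<le> 1 / real j * measure lebesgue \<Theta> *
              (\<Sum>\<alpha>\<in>multi_indices k.
                 SUP x\<in>closure \<Theta>. \<bar>cont_ext (\<Theta> \<times> \<Theta>) (mixed_deriv \<alpha> \<alpha> h) (x, x)\<bar>)))"
proof -
  interpret sobolev_kernel \<Theta> h k
    using assms by unfold_locales
  show ?thesis
  proof (intro conjI allI impI ballI)
    show "nuclear_op k \<Theta> T" by (rule nuclear_op_kernel_op)
    show "nonneg_op k \<Theta> T" unfolding nonneg_op_def using H.T_pos by blast
    show "nuclear_norm k \<Theta> T = (\<Sum>\<alpha>\<in>multi_indices k. LINT x|lebesgue_on \<Theta>. mixed_deriv \<alpha> \<alpha> h (x, x))"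
      unfolding nuclear_norm_kernel_op kernel_trace_def ..
    fix J lam e assume es: "eigensystem k \<Theta> T J lam e"
    show "(lam has_sum nuclear_norm k \<Theta> T) J"
      unfolding nuclear_norm_kernel_op by (rule has_sum_eigensystem[OF es])
    fix j assume j: "j \<in> J"
    have "lam j \<le> kernel_trace / real j" by (rule eigenvalue_le[OF es j])
    also have "\<dots> \<le> (measure lebesgue \<Theta> * (\<Sum>\<alpha>\<in>multi_indices k. SUP x\<in>closure \<Theta>. \<bar>cont_ext (\<Theta> \<times> \<Theta>) (mixed_deriv \<alpha> \<alpha> h) (x, x)\<bar>)) / real j"
      by (intro divide_right_mono kernel_trace_le) simp
    finally show "lam j \<le> 1 / real j * measure lebesgue \<Theta> *
        (\<Sum>\<alpha>\<in>multi_indices k. SUP x\<in>closure \<Theta>. \<bar>cont_ext (\<Theta> \<times> \<Theta>) (mixed_deriv \<alpha> \<alpha> h) (x, x)\<bar>)"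
      by simp
  qed
qed

end
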